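(* Let $\alpha\in(\Lambda^\times)^n$. For every $C\in\mathcal C_{H_0}$, the spherical object $v_{\alpha,C}\in\mathcal I_C(\alpha)$ is well defined, has one-dimensional fibers on $O_C=B_HH_0/C$ and zero fibers off $O_C$, and is right $H_0$-equivariant. The objects $v_{\alpha,C}$ are compatible with refinement, and any pair $(C,v_{\alpha,C})$ represents an object $$v_\alpha\in\mathcal I_F^{u\text{-}\mathrm{sm}}(\alpha)$$ that is independent of $C$ up to the canonical refinement isomorphisms.
   Context: **Field.** $k=\mathbb F_q$, $E=k((u))$, $F=E((t))$, $\mathcal O_2=k[[u]]+tE[[t]]\subset F$. $v_t:F^\times\to\mathbb Z$, $v_u:E^\times\to\mathbb Z$ are the normalized valuations; a bar denotes reduction modulo $t$ of a $t$-adic unit. For $a,b\in F^\times$ put $\partial_t\{a,b\}=(-1)^{v_t(a)v_t(b)}\,\overline{a^{v_t(b)}b^{-v_t(a)}}\in E^\times$ and $\nu_F\{a,b\}=v_u(\partial_t\{a,b\})$. **Multiplier.** $\Lambda=\mathbb C((X))$, $n\ge1$, $G=\mathrm{GL}_n(F)$, $H=G_L\times G_R$ (two copies of $G$), $B\subset G$ the upper triangular Borel subgroup, $B_H=B_L\times B_R$. For $b=(b_L,b_R)\in B_H$ put $x_r(b)=(b_L)_{rr}$, $y_r(b)=(b_R)_{rr}$; $\sigma_\alpha(b,b')=\prod_{r=1}^n\alpha_r^{-\nu_F\{x_r(b),y_r(b')\}}$, a normalized 2-cocycle on $B_H$. $L_\alpha(b)=\Lambda e_b$, $m_{b,b'}:L_\alpha(b)\otimes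 L_\alpha(b')\to L_\alpha(bb')$, $e_b\otimes e_{b'}\mapsto\sigma_\alpha(b,b')e_{bb'}$. **Levels.** $H_0=\mathrm{GL}_n(\mathcal O_2)_L\times\mathrm{GL}_n(\mathcal O_2)_R$, $K_{ij}=I_n+u^it^jM_n(\mathcal O_2)$, $C^{\mathrm{dbl}}_{ij}=K_{ij,L}\times K_{ij,R}$ ($i,j\ge1$). $\mathcal C_H$ is the family of finite intersections of $H$-conjugates of the $C^{\mathrm{dbl}}_{ij}$; $\mathcal C_{H_0}\subseteq\mathcal C_H$ is the family of finite intersections of the $C^{\mathrm{dbl}}_{ij}$ themselves (every member is normal in $H_0$). For $C\in\mathcal C_H$: $S_C=H/C$; for $D\subseteq C$, $\pi_{D,C}^*$ is pullback along $gD\mapsto gC$. **Principal series category.** $\mathcal I_C(\alpha)$ is the category of $\sigma_\alpha$-twisted representations of the action groupoid $B_H\ltimes S_C$: families of $\Lambda$-vector spaces $(V_s)_{s\in S_C}$ with isomorphisms $\theta_b(s):L_\alpha(b)\otimes V_s\to V_{bs}$ satisfying $\theta_{bb'}(s)\circ(m_{b,b'}\otimes\mathrm{id})=\theta_b(b's)\circ(\mathrm{id}\otimes\theta_{b'}(s))$ and $\theta_1(s)(e_1\otimes v)=v$; morphisms are fiberwise linear maps compatible with $\theta$. $\mathcal I_F^{u\text{-}\mathrm{sm}}(\alpha)$ has objects $(C,V)$ with $C\in\mathcal C_H$, $V\in\mathcal I_C(\alpha)$, and $\operatorname{Hom}((C,V),(C',V'))=\varinjlim_{D\subseteq C\cap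 C',\,D\in\mathcal C_H}\operatorname{Hom}_{\mathcal I_D(\alpha)}(\pi^*_{D,C}V,\pi^*_{D,C'}V')$. **Spherical object.** For $C\in\mathcal C_{H_0}$ put $X_C=H_0/C$, $Q_0=B_H\cap H_0$, $O_C=B_HH_0/C\subseteq S_C$. One has $\sigma_\alpha(q,q')=1$ for $q,q'\in Q_0$. The inclusion of action groupoids $\iota_C:Q_0\ltimes X_C\to B_H\ltimes O_C$ is an equivalence. The constant line $\underline\Lambda_{X_C}$ with structure maps $\theta_q(x):L_\alpha(q)\otimes\Lambda\to\Lambda$, $e_q\otimes\lambda\mapsto\lambda$ ($q\in Q_0$, $x\in X_C$) is a $\sigma_\alpha|_{Q_0}$-twisted representation of $Q_0\ltimes X_C$. Transporting it across $\iota_C$ gives a $\sigma_\alpha$-twisted line bundle $\mathcal L^{\mathrm{sph}}_{\alpha,C}$ on $O_C$; concretely its fiber at $bkC$ ($b\in B_H$, $k\in H_0$) is represented by $L_\alpha(b)\otimes_\Lambda\Lambda$, and when $bkC=b'k'C$, with $q=b'^{-1}b\in Q_0$, the representations are identified by $$L_\alpha(b)\otimes\Lambda\xleftarrow{\,m_{b',q}\otimes\mathrm{id}\,}L_\alpha(b')\otimes L_\alpha(q)\otimes\Lambda\xrightarrow{\,\mathrm{id}\otimes\theta_q(kC)\,}L_\alpha(b')\otimes\Lambda.$$ $v_{\alpha,C}\in\mathcal I_C(\alpha)$ is the extension by zero of $\mathcal L^{\mathrm{sph}}_{\alpha,C}$ from the $B_H$-stable set $O_C$ to $S_C$. **Meaning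 of equivariance and compatibility.** For $h\in H_0$ (so $hCh^{-1}=C$), $R_h^C:\mathcal I_C(\alpha)\to\mathcal I_C(\alpha)$ is pullback along $gC\mapsto ghC$; right $H_0$-equivariance of $v$ means a system of isomorphisms $\varphi_h:R_h^Cv\to v$ in $\mathcal I_C(\alpha)$ with $\varphi_{h_1h_2}=\varphi_{h_1}\circ R^C_{h_1}(\varphi_{h_2})$ for $h_1,h_2\in H_0$. Here it is the one which, under $\iota_C$, is given by the identity maps on the fibers of the constant line. Compatibility with refinement means: for $D\subseteq C$ in $\mathcal C_{H_0}$ there are canonical isomorphisms $\pi_{D,C}^*v_{\alpha,C}\simeq v_{\alpha,D}$ compatible with the $B_H$-descent and right $H_0$-equivariant structures. *)

theory Defs
  imports
    "HOL-Analysis.Cartesian_Space"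
    "HOL-Algebra.Left_Coset"
    "HOL-Algebra.Module"
    "HOL-Algebra.Algebraic_Closure_Type"
    "HOL-Computational_Algebra.Formal_Laurent_Series"
begin

section \<open>The two-dimensional local field\<close>

text \<open>
  For a finite field \<open>'k\<close>, the field E = k((u)) is \<open>'k fls\<close> and F = E((t)) is \<open>'k fls fls\<close>:
  the outer series variable is t, the inner one is u.
\<close>

type_synonym 'k loc2 = "'k fls fls"

definition u_par :: "'k::field loc2" where
  "u_par = fls_const fls_X"

definition t_par :: "'k::field loc2" where
  "t_par = fls_X"

definition O2 :: "'k::field loc2 set" where
  "O2 = {fls_const (fps_to_fls a) + t_par * fps_to_fls b | (a :: 'k fps) (b :: 'k fls fps). True}"

text \<open>
  The coefficient of \<open>t^0\<close> is the reduction modulo t of a t-adic unit.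
\<close>

definition tame :: "'k::field loc2 \<Rightarrow> 'k loc2 \<Rightarrow> 'k fls" where
  "tame a b = (- 1) powi (fls_subdegree a * fls_subdegree b) *
     fls_nth (a powi fls_subdegree b * b powi (- fls_subdegree a)) 0"

definition nu_F :: "'k::field loc2 \<Rightarrow> 'k loc2 \<Rightarrow> int" where
  "nu_F a b = fls_subdegree (tame a b)"


section \<open>Groups\<close>

text \<open>
  Matrices are indexed by a finite, linearly ordered (hence nonempty) type \<open>'n\<close>; the order is the
  one that gives a meaning to upper triangular matrices.
\<close>

type_synonym ('a, 'n) sqmat = "(('a, 'n) vec, 'n) vec"
type_synonym ('k, 'n) dbl = "('k loc2, 'n) sqmat \<times> ('k loc2, 'n) sqmat"

definition GL :: "('a::semiring_1, 'n::finite) sqmat monoid" where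
  "GL = \<lparr>carrier = {A. invertible A}, monoid.mult = (**), one = mat 1\<rparr>"

definition H_grp :: "('k::{field,finite}, 'n::{finite,linorder}) dbl monoid" where
  "H_grp = GL \<times>\<times> GL"

definition Borel :: "('a::semiring_1, 'n::{finite,linorder}) sqmat set" where
  "Borel = {A \<in> carrier GL. \<forall>r c. c < r \<longrightarrow> A $ r $ c = 0}"

definition B_H :: "('k::{field,finite}, 'n::{finite,linorder}) dbl set" where
  "B_H = Borel \<times> Borel"

definition Mat_O2 :: "('k::field loc2, 'n::finite) sqmat set" where
  "Mat_O2 = {A. \<forall>r c. A $ r $ c \<in> O2}"

definition GL_O2 :: "('k::field loc2, 'n::finite) sqmat set" where
  "GL_O2 = {A \<in> Mat_O2. \<exists>A' \<in> Mat_O2. A ** A' = mat 1 \<and> A' ** A = mat 1}"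

definition H0 :: "('k::{field,finite}, 'n::{finite,linorder}) dbl set" where
  "H0 = GL_O2 \<times> GL_O2"

definition Q0 :: "('k::{field,finite}, 'n::{finite,linorder}) dbl set" where
  "Q0 = B_H \<inter> H0"

definition K_lev :: "nat \<Rightarrow> nat \<Rightarrow> ('k::field loc2, 'n::finite) sqmat set" where
  "K_lev i j = {mat 1 + (\<chi> r c. u_par ^ i * t_par ^ j * M $ r $ c) | M. M \<in> Mat_O2}"

definition C_dbl :: "nat \<Rightarrow> nat \<Rightarrow> ('k::{field,finite}, 'n::{finite,linorder}) dbl set" where
  "C_dbl i j = K_lev i j \<times> K_lev i j"

text \<open>
  Finite intersections are over nonempty families, so that members of \<open>C_H0\<close> are subgroups of \<open>H0\<close>.
\<close>

definition C_H :: "('k::{field,finite}, 'n::{finite,linorder}) dbl set set" where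
  "C_H = {\<Inter>\<S> | \<S>. finite \<S> \<and> \<S> \<noteq> {} \<and>
     \<S> \<subseteq> {h <#\<^bsub>H_grp\<^esub> C_dbl i j #>\<^bsub>H_grp\<^esub> inv\<^bsub>H_grp\<^esub> h | h i j.
            h \<in> carrier H_grp \<and> 1 \<le> i \<and> 1 \<le> j}}"

definition C_H0 :: "('k::{field,finite}, 'n::{finite,linorder}) dbl set set" where
  "C_H0 = {\<Inter>\<S> | \<S>. finite \<S> \<and> \<S> \<noteq> {} \<and> \<S> \<subseteq> {C_dbl i j | i j. 1 \<le> i \<and> 1 \<le> j}}"

abbreviation S_sp :: "('k::{field,finite}, 'n::{finite,linorder}) dbl set \<Rightarrow> ('k, 'n) dbl set set" where
  "S_sp C \<equiv> lcosets\<^bsub>H_grp\<^esub> C"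

text \<open>
  The projection \<open>gD \<mapsto> gC\<close> for \<open>D \<subseteq> C\<close> is \<open>s \<mapsto> s C\<close>, and right translation
  \<open>gC \<mapsto> ghC\<close>, for h normalising C, is \<open>s \<mapsto> s h\<close>.
\<close>

definition proj :: "('k::{field,finite}, 'n::{finite,linorder}) dbl set \<Rightarrow> ('k, 'n) dbl set \<Rightarrow> ('k, 'n) dbl set" where
  "proj C s = s <#>\<^bsub>H_grp\<^esub> C"

definition rtrans :: "('k::{field,finite}, 'n::{finite,linorder}) dbl \<Rightarrow> ('k, 'n) dbl set \<Rightarrow> ('k, 'n) dbl set" where
  "rtrans h s = s #>\<^bsub>H_grp\<^esub> h"


section \<open>The cocycle\<close>

type_synonym lam = "complex fls"

abbreviation Lam :: "lam ring" where
  "Lam \<equiv> ring_of_type_algebra"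

definition sigma :: "('n::{finite,linorder} \<Rightarrow> lam) \<Rightarrow> ('k::{field,finite}, 'n) dbl \<Rightarrow> ('k, 'n) dbl \<Rightarrow> lam" where
  "sigma \<alpha> b b' = (\<Prod>r\<in>UNIV. \<alpha> r powi (- nu_F (fst b $ r $ r) (snd b' $ r $ r)))"


section \<open>Twisted representations of the action groupoid\<close>

definition lin_maps :: "(lam, 'v) module \<Rightarrow> (lam, 'w) module \<Rightarrow> ('v \<Rightarrow> 'w) set" where
  "lin_maps M N = {f \<in> carrier M \<rightarrow> carrier N.
     (\<forall>x\<in>carrier M. \<forall>y\<in>carrier M. f (x \<oplus>\<^bsub>M\<^esub> y) = f x \<oplus>\<^bsub>N\<^esub> f y) \<and>
     (\<forall>c. \<forall>x\<in>carrier M. f (c \<odot>\<^bsub>M\<^esub> x) = c \<odot>\<^bsub>N\<^esub> f x)}"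

text \<open>
  The fibers are vector spaces with carriers inside a type \<open>'v\<close>. A linear map out of
  \<open>L(b) \<otimes> V\<close>, where \<open>L(b) = \<Lambda> e_b\<close>, is given by the corresponding bilinear map out of
  \<open>L(b) \<times> V\<close>, and an element of \<open>L(b)\<close> by its coefficient: \<open>act V b s c v\<close> is the image
  of \<open>c e_b \<otimes> v\<close> under \<open>\<theta>_b(s)\<close>. As \<open>v \<mapsto> e_b \<otimes> v\<close> is an isomorphism from V to
  \<open>L(b) \<otimes> V\<close>, the map \<open>\<theta>_b(s)\<close> is an isomorphism iff \<open>act V b s 1\<close> is bijective.
\<close>

record ('h, 'v) twrep =
  fib :: "'h set \<Rightarrow> (lam, 'v) module"
  act :: "'h \<Rightarrow> 'h set \<Rightarrow> lam \<Rightarrow> 'v \<Rightarrow> 'v"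

definition line_mult ::
    "('n::{finite,linorder} \<Rightarrow> lam) \<Rightarrow> ('k::{field,finite}, 'n) dbl \<Rightarrow> ('k, 'n) dbl \<Rightarrow> lam \<Rightarrow> lam \<Rightarrow> lam"
  \<comment> \<open>\<open>c e_b \<otimes> c' e_b' \<mapsto> c c' \<sigma>(b,b') e_bb'\<close>\<close>
  where "line_mult \<alpha> b b' c c' = c * c' * sigma \<alpha> b b'"

definition twisted_rep ::
    "('n::{finite,linorder} \<Rightarrow> lam) \<Rightarrow> ('k::{field,finite}, 'n) dbl set \<Rightarrow> (('k, 'n) dbl, 'v) twrep \<Rightarrow> bool" where
  "twisted_rep \<alpha> C V \<longleftrightarrow>
     (\<forall>s\<in>S_sp C. module Lam (fib V s)) \<and>
     (\<forall>b\<in>B_H. \<forall>s\<in>S_sp C.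
        (\<forall>c. act V b s c \<in> lin_maps (fib V s) (fib V (b <#\<^bsub>H_grp\<^esub> s))) \<and>
        (\<forall>c c'. \<forall>v\<in>carrier (fib V s).
           act V b s (c + c') v = act V b s c v \<oplus>\<^bsub>fib V (b <#\<^bsub>H_grp\<^esub> s)\<^esub> act V b s c' v \<and>
           act V b s (c * c') v = c \<odot>\<^bsub>fib V (b <#\<^bsub>H_grp\<^esub> s)\<^esub> act V b s c' v) \<and>
        bij_betw (act V b s 1) (carrier (fib V s)) (carrier (fib V (b <#\<^bsub>H_grp\<^esub> s)))) \<and>
     (\<forall>b\<in>B_H. \<forall>b'\<in>B_H. \<forall>s\<in>S_sp C. \<forall>c c'. \<forall>v\<in>carrier (fib V s).
        act V (b \<otimes>\<^bsub>H_grp\<^esub> b') s (line_mult \<alpha> b b' c c') v =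
        act V b (b' <#\<^bsub>H_grp\<^esub> s) c (act V b' s c' v)) \<and>
     (\<forall>s\<in>S_sp C. \<forall>v\<in>carrier (fib V s). act V \<one>\<^bsub>H_grp\<^esub> s 1 v = v)"

text \<open>
  Morphisms are made extensional (fixed to \<open>undefined\<close> outside the base set and the fibers) so
  that equality of morphisms is equality in HOL.
\<close>

definition tw_hom ::
    "('k::{field,finite}, 'n::{finite,linorder}) dbl set \<Rightarrow> (('k, 'n) dbl, 'v) twrep \<Rightarrow> (('k, 'n) dbl, 'v) twrep \<Rightarrow>
     (('k, 'n) dbl set \<Rightarrow> 'v \<Rightarrow> 'v) set" where
  "tw_hom C V W = {f \<in> (\<Pi>\<^sub>E s\<in>S_sp C. lin_maps (fib V s) (fib W s) \<inter> extensional (carrier (fib V s))).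
     \<forall>b\<in>B_H. \<forall>s\<in>S_sp C. \<forall>c. \<forall>v\<in>carrier (fib V s).
       f (b <#\<^bsub>H_grp\<^esub> s) (act V b s c v) = act W b s c (f s v)}"

definition tw_id ::
    "('k::{field,finite}, 'n::{finite,linorder}) dbl set \<Rightarrow> (('k, 'n) dbl, 'v) twrep \<Rightarrow>
     (('k, 'n) dbl set \<Rightarrow> 'v \<Rightarrow> 'v)" where
  "tw_id C V = (\<lambda>s\<in>S_sp C. \<lambda>v\<in>carrier (fib V s). v)"

definition tw_comp ::
    "('k::{field,finite}, 'n::{finite,linorder}) dbl set \<Rightarrow> (('k, 'n) dbl, 'v) twrep \<Rightarrow>
     (('k, 'n) dbl set \<Rightarrow> 'v \<Rightarrow> 'v) \<Rightarrow> (('k, 'n) dbl set \<Rightarrow> 'v \<Rightarrow> 'v) \<Rightarrow> (('k, 'n) dbl set \<Rightarrow> 'v \<Rightarrow> 'v)"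
  \<comment> \<open>the composite \<open>g \<circ> f\<close> of morphisms with f starting at V\<close>
  where "tw_comp C V g f = (\<lambda>s\<in>S_sp C. compose (carrier (fib V s)) (g s) (f s))"

definition tw_iso ::
    "('k::{field,finite}, 'n::{finite,linorder}) dbl set \<Rightarrow> (('k, 'n) dbl, 'v) twrep \<Rightarrow> (('k, 'n) dbl, 'v) twrep \<Rightarrow>
     (('k, 'n) dbl set \<Rightarrow> 'v \<Rightarrow> 'v) set" where
  "tw_iso C V W = {f \<in> tw_hom C V W.
     \<exists>g\<in>tw_hom C W V. tw_comp C V g f = tw_id C V \<and> tw_comp C W f g = tw_id C W}"

definition pull_rep :: "('h set \<Rightarrow> 'h set) \<Rightarrow> ('h, 'v) twrep \<Rightarrow> ('h, 'v) twrep" where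
  "pull_rep p V = \<lparr>fib = (\<lambda>s. fib V (p s)), act = (\<lambda>b s. act V b (p s))\<rparr>"

definition pull_mor ::
    "('k::{field,finite}, 'n::{finite,linorder}) dbl set \<Rightarrow> (('k, 'n) dbl set \<Rightarrow> ('k, 'n) dbl set) \<Rightarrow>
     (('k, 'n) dbl set \<Rightarrow> 'v \<Rightarrow> 'v) \<Rightarrow> (('k, 'n) dbl set \<Rightarrow> 'v \<Rightarrow> 'v)" where
  "pull_mor D p f = (\<lambda>s\<in>S_sp D. f (p s))"

definition right_equivariant ::
    "('k::{field,finite}, 'n::{finite,linorder}) dbl set \<Rightarrow> (('k, 'n) dbl, 'v) twrep \<Rightarrow>
     (('k, 'n) dbl \<Rightarrow> ('k, 'n) dbl set \<Rightarrow> 'v \<Rightarrow> 'v) \<Rightarrow> bool" where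
  "right_equivariant C V \<phi> \<longleftrightarrow>
     (\<forall>h\<in>H0. \<phi> h \<in> tw_iso C (pull_rep (rtrans h) V) V) \<and>
     (\<forall>h1\<in>H0. \<forall>h2\<in>H0. \<phi> (h1 \<otimes>\<^bsub>H_grp\<^esub> h2) =
        tw_comp C (pull_rep (rtrans (h1 \<otimes>\<^bsub>H_grp\<^esub> h2)) V) (\<phi> h1) (pull_mor C (rtrans h1) (\<phi> h2)))"


section \<open>The u-smooth category\<close>

text \<open>
  A morphism from P to R is an equivalence class of pairs (D, f), where f is a morphism between
  the pullbacks to level D; this is the filtered colimit over D.
\<close>

type_synonym ('k, 'n, 'v) uobj = "('k, 'n) dbl set \<times> (('k, 'n) dbl, 'v) twrep"
type_synonym ('k, 'n, 'v) umor =
  "(('k, 'n) dbl set \<times> (('k, 'n) dbl set \<Rightarrow> 'v \<Rightarrow> 'v)) set"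

definition u_obj :: "('n::{finite,linorder} \<Rightarrow> lam) \<Rightarrow> ('k::{field,finite}, 'n, 'v) uobj set" where
  "u_obj \<alpha> = {(C, V). C \<in> C_H \<and> twisted_rep \<alpha> C V}"

definition at_level :: "('k::{field,finite}, 'n::{finite,linorder}, 'v) uobj \<Rightarrow> (('k, 'n) dbl, 'v) twrep"
  \<comment> \<open>the pullback along \<open>gD \<mapsto> gC\<close>, given by the same formula at every level D\<close>
  where "at_level P = pull_rep (proj (fst P)) (snd P)"

definition u_germs ::
    "('k::{field,finite}, 'n::{finite,linorder}, 'v) uobj \<Rightarrow> ('k, 'n, 'v) uobj \<Rightarrow> ('k, 'n, 'v) umor" where
  "u_germs P R = {(D, f). D \<in> C_H \<and> D \<subseteq> fst P \<inter> fst R \<and> f \<in> tw_hom D (at_level P) (at_level R)}"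

definition u_eq ::
    "('k::{field,finite}, 'n::{finite,linorder}, 'v) uobj \<Rightarrow> ('k, 'n, 'v) uobj \<Rightarrow>
     (('k, 'n) dbl set \<times> (('k, 'n) dbl set \<Rightarrow> 'v \<Rightarrow> 'v)) rel" where
  "u_eq P R = {((D, f), (D', f')). (D, f) \<in> u_germs P R \<and> (D', f') \<in> u_germs P R \<and>
     (\<exists>E\<in>C_H. E \<subseteq> D \<inter> D' \<and> pull_mor E (proj D) f = pull_mor E (proj D') f')}"

definition u_hom ::
    "('k::{field,finite}, 'n::{finite,linorder}, 'v) uobj \<Rightarrow> ('k, 'n, 'v) uobj \<Rightarrow> ('k, 'n, 'v) umor set" where
  "u_hom P R = u_germs P R // u_eq P R"

definition u_id :: "('k::{field,finite}, 'n::{finite,linorder}, 'v) uobj \<Rightarrow> ('k, 'n, 'v) umor" where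
  "u_id P = u_eq P P `` {(fst P, tw_id (fst P) (at_level P))}"

definition u_comp ::
    "('k::{field,finite}, 'n::{finite,linorder}, 'v) uobj \<Rightarrow> ('k, 'n, 'v) uobj \<Rightarrow>
     ('k, 'n, 'v) umor \<Rightarrow> ('k, 'n, 'v) umor \<Rightarrow> ('k, 'n, 'v) umor"
  \<comment> \<open>the composite \<open>\<psi> \<circ> \<phi>\<close>, from P to T, formed at any common refinement of levels of representatives\<close>
  where "u_comp P T \<psi> \<phi> = u_eq P T ``
     {(D, tw_comp D (at_level P) (pull_mor D (proj D2) g) (pull_mor D (proj D1) f)) | D D1 f D2 g.
        (D1, f) \<in> \<phi> \<and> (D2, g) \<in> \<psi> \<and> D \<in> C_H \<and> D \<subseteq> D1 \<inter> D2}"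

definition u_iso ::
    "('k::{field,finite}, 'n::{finite,linorder}, 'v) uobj \<Rightarrow> ('k, 'n, 'v) uobj \<Rightarrow> ('k, 'n, 'v) umor set" where
  "u_iso P R = {\<phi> \<in> u_hom P R. \<exists>\<psi>\<in>u_hom R P. u_comp P P \<psi> \<phi> = u_id P \<and> u_comp R R \<phi> \<psi> = u_id R}"


section \<open>The spherical object\<close>

definition O_sp :: "('k::{field,finite}, 'n::{finite,linorder}) dbl set \<Rightarrow> ('k, 'n) dbl set set" where
  "O_sp C = {(b \<otimes>\<^bsub>H_grp\<^esub> k) <#\<^bsub>H_grp\<^esub> C | b k. b \<in> B_H \<and> k \<in> H0}"

text \<open>
  A triple (b, k, x) with \<open>bkC = s\<close> stands for the vector \<open>e_b \<otimes> x\<close> of the representation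
  \<open>L(b) \<otimes> \<Lambda>\<close> of the fiber at s attached to (b, k). In \<open>sph_rel\<close>, with
  \<open>q = b'\<^sup>-\<^sup>1 b\<close>, the element \<open>e_b' \<otimes> e_q \<otimes> y\<close> is sent to
  \<open>e_b \<otimes> \<sigma>(b',q) y\<close> by \<open>m \<otimes> id\<close> and to \<open>e_b' \<otimes> y\<close> by \<open>id \<otimes> \<theta>_q\<close>.
\<close>

type_synonym ('k, 'n) sph_vec = "(('k, 'n) dbl \<times> ('k, 'n) dbl \<times> lam) set"

definition sph_reps ::
    "('k::{field,finite}, 'n::{finite,linorder}) dbl set \<Rightarrow> ('k, 'n) dbl set \<Rightarrow> ('k, 'n) sph_vec" where
  "sph_reps C s = {(b, k, x). b \<in> B_H \<and> k \<in> H0 \<and> (b \<otimes>\<^bsub>H_grp\<^esub> k) <#\<^bsub>H_grp\<^esub> C = s}"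

definition sph_rel ::
    "('n::{finite,linorder} \<Rightarrow> lam) \<Rightarrow> ('k::{field,finite}, 'n) dbl set \<Rightarrow> ('k, 'n) dbl set \<Rightarrow>
     (('k, 'n) dbl \<times> ('k, 'n) dbl \<times> lam) rel" where
  "sph_rel \<alpha> C s = {((b, k, x), (b', k', y)).
     (b, k, x) \<in> sph_reps C s \<and> (b', k', y) \<in> sph_reps C s \<and>
     x = sigma \<alpha> b' (inv\<^bsub>H_grp\<^esub> b' \<otimes>\<^bsub>H_grp\<^esub> b) * y}"

definition sph_class ::
    "('n::{finite,linorder} \<Rightarrow> lam) \<Rightarrow> ('k::{field,finite}, 'n) dbl set \<Rightarrow> ('k, 'n) dbl \<Rightarrow> ('k, 'n) dbl \<Rightarrow> lam \<Rightarrow> ('k, 'n) sph_vec" where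
  "sph_class \<alpha> C b k x = sph_rel \<alpha> C ((b \<otimes>\<^bsub>H_grp\<^esub> k) <#\<^bsub>H_grp\<^esub> C) `` {(b, k, x)}"

text \<open>
  The operations on classes are performed representative by representative, within each
  \<open>L(b) \<otimes> \<Lambda>\<close>. Off \<open>O_sp C\<close> the fiber is the zero space, with the empty set as its only
  element. The ring fields \<open>mult\<close> and \<open>one\<close> of a module record are irrelevant.
\<close>

definition sph_fib ::
    "('n::{finite,linorder} \<Rightarrow> lam) \<Rightarrow> ('k::{field,finite}, 'n) dbl set \<Rightarrow> ('k, 'n) dbl set \<Rightarrow> (lam, ('k, 'n) sph_vec) module" where
  "sph_fib \<alpha> C s = \<lparr>
     carrier = (if s \<in> O_sp C then sph_reps C s // sph_rel \<alpha> C s else {{}}),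
     monoid.mult = (\<lambda>_ _. {}), one = {},
     ring.zero = {(b, k, x). (b, k, x) \<in> sph_reps C s \<and> x = 0},
     add = (\<lambda>v w. {(b, k, x + y) | b k x y. (b, k, x) \<in> v \<and> (b, k, y) \<in> w}),
     module.smult = (\<lambda>c v. {(b, k, c * x) | b k x. (b, k, x) \<in> v})\<rparr>"

text \<open>
  The structure map is \<open>c e_b0 \<otimes> (e_b \<otimes> x) \<mapsto> m(c e_b0 \<otimes> e_b) \<otimes> x\<close>.
\<close>

definition sph ::
    "('n::{finite,linorder} \<Rightarrow> lam) \<Rightarrow> ('k::{field,finite}, 'n) dbl set \<Rightarrow> (('k, 'n) dbl, ('k, 'n) sph_vec) twrep" where
  "sph \<alpha> C = \<lparr>
     fib = sph_fib \<alpha> C,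
     act = (\<lambda>b0 s c v. {(b0 \<otimes>\<^bsub>H_grp\<^esub> b, k, line_mult \<alpha> b0 b c 1 * x) | b k x. (b, k, x) \<in> v})\<rparr>"

text \<open>
  The fiber of the right translate by h at \<open>bkC\<close> is the fiber at \<open>bkhC\<close>; there the
  equivariance isomorphism sends the class of (b, kh, x) to the class of (b, k, x).
\<close>

definition sph_equiv ::
    "('n::{finite,linorder} \<Rightarrow> lam) \<Rightarrow> ('k::{field,finite}, 'n) dbl set \<Rightarrow> ('k, 'n) dbl \<Rightarrow>
     ('k, 'n) dbl set \<Rightarrow> ('k, 'n) sph_vec \<Rightarrow> ('k, 'n) sph_vec" where
  "sph_equiv \<alpha> C h = (\<lambda>s\<in>S_sp C. \<lambda>v\<in>carrier (fib (sph \<alpha> C) (rtrans h s)).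
     {(b, k \<otimes>\<^bsub>H_grp\<^esub> inv\<^bsub>H_grp\<^esub> h, x) | b k x. (b, k, x) \<in> v})"

text \<open>
  Refinement from C to D sends the class of (b, k, x) at level C to its class at level D, that is,
  it discards the representatives of \<open>gC\<close> that do not represent \<open>gD\<close>.
\<close>

definition sph_refine ::
    "('n::{finite,linorder} \<Rightarrow> lam) \<Rightarrow> ('k::{field,finite}, 'n) dbl set \<Rightarrow> ('k, 'n) dbl set \<Rightarrow>
     ('k, 'n) dbl set \<Rightarrow> ('k, 'n) sph_vec \<Rightarrow> ('k, 'n) sph_vec" where
  "sph_refine \<alpha> D C = (\<lambda>s\<in>S_sp D. \<lambda>v\<in>carrier (fib (sph \<alpha> C) (proj C s)). v \<inter> sph_reps D s)"

definition sph_obj ::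
    "('n::{finite,linorder} \<Rightarrow> lam) \<Rightarrow> ('k::{field,finite}, 'n) dbl set \<Rightarrow> ('k, 'n, ('k, 'n) sph_vec) uobj" where
  "sph_obj \<alpha> C = (C, sph \<alpha> C)"

definition u_refine ::
    "('n::{finite,linorder} \<Rightarrow> lam) \<Rightarrow> ('k::{field,finite}, 'n) dbl set \<Rightarrow> ('k, 'n) dbl set \<Rightarrow>
     ('k, 'n, ('k, 'n) sph_vec) umor" where
  "u_refine \<alpha> D C = u_eq (sph_obj \<alpha> C) (sph_obj \<alpha> D) `` {(D, sph_refine \<alpha> D C)}"

text \<open>
  An isomorphism between the spherical objects at levels C and C' is canonical if it is the
  one induced by the refinement isomorphisms to every common refinement.
\<close>

definition canonical_iso ::
    "('n::{finite,linorder} \<Rightarrow> lam) \<Rightarrow> ('k::{field,finite}, 'n) dbl set \<Rightarrow> ('k, 'n) dbl set \<Rightarrow>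
     ('k, 'n, ('k, 'n) sph_vec) umor \<Rightarrow> bool" where
  "canonical_iso \<alpha> C C' \<kappa> \<longleftrightarrow>
     \<kappa> \<in> u_iso (sph_obj \<alpha> C) (sph_obj \<alpha> C') \<and>
     (\<forall>D\<in>C_H0. D \<subseteq> C \<inter> C' \<longrightarrow>
        u_comp (sph_obj \<alpha> C) (sph_obj \<alpha> D) (u_refine \<alpha> D C') \<kappa> = u_refine \<alpha> D C)"


section \<open>Well-definedness, fibers, and compatibility\<close>

text \<open>
  The relation identifying the representations of a fiber is an equivalence relation, each
  representation is carried isomorphically onto the fiber, the outcome is an object of the
  category at level C, and its restriction along the inclusion of groupoids
  \<open>Q0 \<ltimes> H0/C \<rightarrow> B_H \<ltimes> O_C\<close> is the constant line.
\<close>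

definition sph_well_defined ::
    "('n::{finite,linorder} \<Rightarrow> lam) \<Rightarrow> ('k::{field,finite}, 'n) dbl set \<Rightarrow> bool" where
  "sph_well_defined \<alpha> C \<longleftrightarrow>
     (\<forall>s\<in>O_sp C. equiv (sph_reps C s) (sph_rel \<alpha> C s)) \<and>
     twisted_rep \<alpha> C (sph \<alpha> C) \<and>
     (\<forall>b\<in>B_H. \<forall>k\<in>H0. let V = fib (sph \<alpha> C) ((b \<otimes>\<^bsub>H_grp\<^esub> k) <#\<^bsub>H_grp\<^esub> C) in
        bij_betw (sph_class \<alpha> C b k) UNIV (carrier V) \<and>
        (\<forall>x y. sph_class \<alpha> C b k (x + y) = sph_class \<alpha> C b k x \<oplus>\<^bsub>V\<^esub> sph_class \<alpha> C b k y) \<and>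
        (\<forall>c x. sph_class \<alpha> C b k (c * x) = c \<odot>\<^bsub>V\<^esub> sph_class \<alpha> C b k x)) \<and>
     (\<forall>k\<in>H0. \<forall>k'\<in>H0. k <#\<^bsub>H_grp\<^esub> C = k' <#\<^bsub>H_grp\<^esub> C \<longrightarrow>
        (\<forall>x. sph_class \<alpha> C \<one>\<^bsub>H_grp\<^esub> k x = sph_class \<alpha> C \<one>\<^bsub>H_grp\<^esub> k' x)) \<and>
     (\<forall>q\<in>Q0. \<forall>k\<in>H0. \<forall>c x.
        act (sph \<alpha> C) q (k <#\<^bsub>H_grp\<^esub> C) c (sph_class \<alpha> C \<one>\<^bsub>H_grp\<^esub> k x) =
        sph_class \<alpha> C \<one>\<^bsub>H_grp\<^esub> (q \<otimes>\<^bsub>H_grp\<^esub> k) (c * x))"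

definition one_dimensional :: "(lam, 'v) module \<Rightarrow> bool"
  \<comment> \<open>there is a basis with one element\<close>
  where "one_dimensional M \<longleftrightarrow> (\<exists>e\<in>carrier M. \<forall>v\<in>carrier M. \<exists>!c. v = c \<odot>\<^bsub>M\<^esub> e)"

definition sph_equivariant ::
    "('n::{finite,linorder} \<Rightarrow> lam) \<Rightarrow> ('k::{field,finite}, 'n) dbl set \<Rightarrow> bool" where
  "sph_equivariant \<alpha> C \<longleftrightarrow>
     right_equivariant C (sph \<alpha> C) (sph_equiv \<alpha> C) \<and>
     (\<forall>h\<in>H0. \<forall>k\<in>H0. \<forall>x. sph_equiv \<alpha> C h (k <#\<^bsub>H_grp\<^esub> C) (sph_class \<alpha> C \<one>\<^bsub>H_grp\<^esub> (k \<otimes>\<^bsub>H_grp\<^esub> h) x) =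
        sph_class \<alpha> C \<one>\<^bsub>H_grp\<^esub> k x)"

text \<open>
  For \<open>D \<subseteq> C\<close>: the refinement map is an isomorphism; it is the identity on each
  \<open>L(b) \<otimes> \<Lambda>\<close> (for b = 1: on the constant line); and it intertwines the
  equivariant structures.
\<close>

definition refinement_compatible ::
    "('n::{finite,linorder} \<Rightarrow> lam) \<Rightarrow> ('k::{field,finite}, 'n) dbl set \<Rightarrow> ('k, 'n) dbl set \<Rightarrow> bool" where
  "refinement_compatible \<alpha> D C \<longleftrightarrow>
     sph_refine \<alpha> D C \<in> tw_iso D (pull_rep (proj C) (sph \<alpha> C)) (sph \<alpha> D) \<and>
     (\<forall>b\<in>B_H. \<forall>k\<in>H0. \<forall>x.
        sph_refine \<alpha> D C ((b \<otimes>\<^bsub>H_grp\<^esub> k) <#\<^bsub>H_grp\<^esub> D) (sph_class \<alpha> C b k x) = sph_class \<alpha> D b k x) \<and>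
     (\<forall>h\<in>H0.
        tw_comp D (pull_rep (rtrans h) (pull_rep (proj C) (sph \<alpha> C)))
          (sph_refine \<alpha> D C) (pull_mor D (proj C) (sph_equiv \<alpha> C h)) =
        tw_comp D (pull_rep (rtrans h) (pull_rep (proj C) (sph \<alpha> C)))
          (sph_equiv \<alpha> D h) (pull_mor D (rtrans h) (sph_refine \<alpha> D C)))"

end

theory Submission
  imports Defs "HOL-Analysis.Determinants"
begin

text \<open>
  The exponent in the cocycle is bimultiplicative: if \<open>v\<close> is the t-adic valuation and
  \<open>w(a)\<close> the u-adic valuation of the leading coefficient of \<open>a\<close>, then
  \<open>\<nu>(a,b) = v(b) w(a) - v(a) w(b)\<close>. Since diagonal entries of upper triangular matrices multiply,
  \<open>\<sigma>\<close> is bimultiplicative on \<open>B_H\<close>; since diagonal entries of elements of \<open>Q0\<close> are units of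
  \<open>O2\<close>, which have t-adic valuation 0, it is trivial on \<open>Q0\<close>. If \<open>bkC = b'k'C\<close>, then
  \<open>q = b\<^sup>-\<^sup>1 b'\<close> lies in \<open>Q0\<close>, because C is contained in \<open>H0\<close>. The factors \<open>\<sigma>(b,q)\<close> by which
  the representations \<open>L(b)\<close> and \<open>L(b')\<close> of the same fiber are compared then satisfy a cocycle identity
  (\<open>transition_cocycle\<close>). So the fiber is a well defined line, in which every pair (b, k) with
  \<open>bkC = s\<close> singles out a basis vector.

  Everything else follows from keeping track of these basis vectors. Call a representation framed if it
  vanishes off the orbit and has on the orbit a basis vector for each (b, k), with the same transition factors
  and the same action as above. Two framed representations over the same base admit exactly one family of
  fiberwise maps that matches their frames, and this family is an isomorphism of twisted representations
  (\<open>frame_map_eqI\<close>, \<open>frame_map_iso\<close>). The spherical object, its right translates and its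
  pullbacks to finer levels are all framed, and the equivariance and refinement maps match frames.
  Each coherence law then holds because both of its sides match the same frames.

  In the u-smooth category the frame maps between the spherical objects at two levels C and C', formed over
  varying D contained in both, are restrictions of one another, so they define a single morphism
  (\<open>transfer_class\<close>). These morphisms compose like the frame maps, and include the identities and the
  refinement isomorphisms. A canonical isomorphism has to be one of them: over a small enough level it becomes
  an honest morphism, and there the refinement maps can be cancelled (\<open>transfer_class_unique\<close>).

  That levels are subgroups, normalised by \<open>H0\<close> when they are intersections of the standard congruence
  subgroups, rests on the fact that a matrix over \<open>O2\<close> congruent to 1 modulo t has a determinant in
  \<open>1 + tE[[t]]\<close>, whose elements are units of \<open>O2\<close>.
\<close>

(* A single dollar sign is kept for matrix entries only. *)
unbundle no Formal_Power_Series.fps_syntax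
unbundle Formal_Laurent_Series.fps_syntax

section \<open>The ring of integers of rank two\<close>

text \<open>
  In this form closure under the ring operations is immediate, because the constant term of a power
  series depends on it as a ring homomorphism.
\<close>

lemma O2_iff: "x \<in> O2 \<longleftrightarrow> (\<exists>f a. x = fps_to_fls f \<and> fps_nth f 0 = fps_to_fls a)"
proof
  assume "x \<in> O2"
  then obtain a b where x: "x = fls_const (fps_to_fls a) + t_par * fps_to_fls b"
    by (auto simp: O2_def)
  have "x = fps_to_fls (fps_const (fps_to_fls a) + fps_X * b)"
    unfolding x t_par_def by (simp add: fls_times_fps_to_fls)
  moreover have "fps_nth (fps_const (fps_to_fls a) + fps_X * b) 0 = fps_to_fls a"
    by simp
  ultimately show "\<exists>f a. x = fps_to_fls f \<and> fps_nth f 0 = fps_to_fls a" by blast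
next
  assume "\<exists>f a. x = fps_to_fls f \<and> fps_nth f 0 = fps_to_fls a"
  then obtain f a where x: "x = fps_to_fls f" "fps_nth f 0 = fps_to_fls a" by blast
  have "f = fps_const (fps_nth f 0) + fps_X * fps_shift 1 f"
    by (rule fps_ext) auto
  then have "x = fls_const (fps_to_fls a) + t_par * fps_to_fls (fps_shift 1 f)"
    unfolding x(1) t_par_def
    by (metis fps_X_to_fls fps_const_to_fls fps_to_fls_plus fls_times_fps_to_fls x(2))
  then show "x \<in> O2" by (auto simp: O2_def)
qed

lemma O2_I: "fps_nth f 0 = fps_to_fls a \<Longrightarrow> fps_to_fls f \<in> O2"
  by (auto simp: O2_iff)

lemma O2_0 [simp]: "0 \<in> O2" using O2_I[of 0 0] by simp
lemma O2_1 [simp]: "1 \<in> O2" using O2_I[of 1 1] by simp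

lemma O2_add: assumes "x \<in> O2" "y \<in> O2" shows "x + y \<in> O2"
proof -
  obtain f a g b where "x = fps_to_fls f" "fps_nth f 0 = fps_to_fls a" "y = fps_to_fls g" "fps_nth g 0 = fps_to_fls b"
    using assms by (auto simp: O2_iff)
  then show ?thesis using O2_I[of "f + g" "a + b"] by simp
qed

lemma O2_mult: assumes "x \<in> O2" "y \<in> O2" shows "x * y \<in> O2"
proof -
  obtain f a g b where "x = fps_to_fls f" "fps_nth f 0 = fps_to_fls a" "y = fps_to_fls g" "fps_nth g 0 = fps_to_fls b"
    using assms by (auto simp: O2_iff)
  then show ?thesis using O2_I[of "f * g" "a * b"] by (simp add: fls_times_fps_to_fls)
qed

lemma O2_uminus: assumes "x \<in> O2" shows "- x \<in> O2"
proof -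
  obtain f a where "x = fps_to_fls f" "fps_nth f 0 = fps_to_fls a" using assms by (auto simp: O2_iff)
  then show ?thesis using O2_I[of "- f" "- a"] by simp
qed

lemma O2_sum: "(\<And>i. i \<in> I \<Longrightarrow> f i \<in> O2) \<Longrightarrow> sum f I \<in> O2"
  by (induction I rule: infinite_finite_induct) (auto intro: O2_add)

lemma O2_prod: "(\<And>i. i \<in> I \<Longrightarrow> f i \<in> O2) \<Longrightarrow> prod f I \<in> O2"
  by (induction I rule: infinite_finite_induct) (auto intro: O2_mult)

lemma O2_pow: "x \<in> O2 \<Longrightarrow> x ^ n \<in> O2"
  by (induction n) (auto intro: O2_mult)

lemma u_par_in_O2: "u_par \<in> O2"
  using O2_I[of "fps_const fls_X" fps_X] by (simp add: u_par_def)

lemma t_par_in_O2: "t_par \<in> O2"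
  using O2_I[of fps_X 0] by (simp add: t_par_def)

text \<open>
  Two nonnegative valuations that add up to 0 both vanish.
\<close>

lemma O2_units_subdegree:
  assumes "x \<in> O2" "y \<in> O2" "x * y = 1"
  shows "fls_subdegree x = 0"
proof -
  have "fls_subdegree x \<ge> 0" "fls_subdegree y \<ge> 0"
    using assms fls_subdegree_fls_to_fps_gt0 by (auto simp: O2_iff)
  moreover have "fls_subdegree x + fls_subdegree y = 0"
  proof -
    have "x \<noteq> 0" "y \<noteq> 0" using assms(3) by auto
    then show ?thesis using fls_subdegree_mult[of x y] assms(3) by simp
  qed
  ultimately show ?thesis by linarith
qed

section \<open>Congruence subgroups of the general linear group\<close>

text \<open>
  For a matrix congruent to 1 modulo t, this is applied to the embedding of \<open>E[[t]]\<close> into F and to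
  the reduction modulo t.
\<close>

lemma det_map_ring_hom:
  fixes \<phi> :: "'a::comm_ring_1 \<Rightarrow> 'b::comm_ring_1" and A :: "'a^'n^'n"
  assumes add: "\<And>x y. \<phi> (x + y) = \<phi> x + \<phi> y" and mult: "\<And>x y. \<phi> (x * y) = \<phi> x * \<phi> y"
    and one: "\<phi> 1 = 1"
  shows "det (\<chi> i j. \<phi> (A $ i $ j)) = \<phi> (det A)"
proof -
  have zero: "\<phi> 0 = 0" using add[of 0 0] by simp
  have neg: "\<phi> (- x) = - \<phi> x" for x using add[of x "- x"] zero by (simp add: eq_neg_iff_add_eq_0 add.commute)
  have sum: "\<phi> (sum f I) = (\<Sum>i\<in>I. \<phi> (f i))" for f :: "('n \<Rightarrow> 'n) \<Rightarrow> 'a" and I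
    by (induction I rule: infinite_finite_induct) (auto simp: add zero)
  have prod: "\<phi> (prod f I) = (\<Prod>i\<in>I. \<phi> (f i))" for f :: "'n \<Rightarrow> 'a" and I
    by (induction I rule: infinite_finite_induct) (auto simp: mult one)
  have sign: "\<phi> (of_int (sign p)) = of_int (sign p)" for p :: "'n \<Rightarrow> 'n"
    by (cases "sign p = 1") (auto simp: one neg sign_def)
  show ?thesis by (simp add: det_def sum mult prod sign)
qed

lemma det_in_O2:
  fixes A :: "('k::field loc2, 'n::finite) sqmat"
  assumes "A \<in> Mat_O2"
  shows "det A \<in> O2"
proof -
  have sign: "of_int (sign p) \<in> O2" for p :: "'n \<Rightarrow> 'n"
    by (auto simp: sign_def intro: O2_uminus)
  show ?thesis
    using assms unfolding det_def Mat_O2_def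
    by (intro O2_sum O2_mult sign O2_prod) auto
qed

lemma Mat_O2_mult: "A \<in> Mat_O2 \<Longrightarrow> B \<in> Mat_O2 \<Longrightarrow> A ** B \<in> Mat_O2"
  unfolding Mat_O2_def matrix_matrix_mult_def by (auto intro!: O2_sum O2_mult)

lemma Mat_O2_add: "A \<in> Mat_O2 \<Longrightarrow> B \<in> Mat_O2 \<Longrightarrow> A + B \<in> Mat_O2"
  unfolding Mat_O2_def by (auto intro!: O2_add)

lemma Mat_O2_uminus: "A \<in> Mat_O2 \<Longrightarrow> - A \<in> Mat_O2"
  unfolding Mat_O2_def by (auto intro!: O2_uminus)

lemma Mat_O2_one [simp]: "mat 1 \<in> Mat_O2"
  unfolding Mat_O2_def by (auto simp: mat_def)

text \<open>
  By Cramer's rule each entry of the inverse is the determinant of a matrix over \<open>O2\<close>, divided by the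
  determinant of A.
\<close>

lemma inverse_in_Mat_O2:
  fixes A :: "('k::field loc2, 'n::finite) sqmat"
  assumes A: "A \<in> Mat_O2" and d: "det A \<noteq> 0" "inverse (det A) \<in> O2" and AB: "A ** B = mat 1"
  shows "B \<in> Mat_O2"
  unfolding Mat_O2_def
proof (intro CollectI allI)
  fix r c
  define M where "M = (\<chi> i j. if j = r then (mat 1 :: ('k loc2, 'n) sqmat) $ i $ c else A $ i $ j)"
  have col: "A *v (\<chi> j. B $ j $ c) = (\<chi> i. mat 1 $ i $ c)"
    unfolding AB[symmetric] by (simp add: matrix_vector_mult_def matrix_matrix_mult_def)
  have "det M = B $ r $ c * det A"
    using cramer_lemma[of r A "\<chi> j. B $ j $ c"] unfolding M_def col by (simp cong: if_cong)
  then have "B $ r $ c = det M * inverse (det A)"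
    using d(1) by (simp add: field_simps)
  moreover have "M \<in> Mat_O2" using A by (auto simp: M_def Mat_O2_def mat_def)
  ultimately show "B $ r $ c \<in> O2" using d(2) by (auto intro: O2_mult det_in_O2)
qed

text \<open>
  The determinant is a power series in t that reduces to \<open>det 1 = 1\<close> modulo t. Its inverse is again a
  power series in t with constant term 1, and \<open>O2\<close> contains all of these.
\<close>

lemma det_cong_one_unit:
  fixes M :: "('k::field loc2, 'n::finite) sqmat"
  assumes "M \<in> Mat_O2"
  shows "det (mat 1 + (\<chi> r c. t_par * M $ r $ c)) \<noteq> 0"
    "inverse (det (mat 1 + (\<chi> r c. t_par * M $ r $ c))) \<in> O2"
proof -
  define N where "N = (\<chi> r c. (if r = c then 1 else 0) + fps_X * fls_regpart (M $ r $ c))"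
  have M: "fps_to_fls (fls_regpart (M $ r $ c)) = M $ r $ c" for r c
    using assms by (auto simp: Mat_O2_def O2_iff) (metis fls_regpart_fps_trivial)
  have "(\<chi> r c. fps_to_fls (N $ r $ c)) = mat 1 + (\<chi> r c. t_par * M $ r $ c)"
    by (auto simp: N_def vec_eq_iff mat_def fls_times_fps_to_fls M t_par_def)
  then have det: "det (mat 1 + (\<chi> r c. t_par * M $ r $ c)) = fps_to_fls (det N)"
    using det_map_ring_hom[of fps_to_fls N] by (simp add: fls_times_fps_to_fls)
  have "(\<chi> r c. fps_nth (N $ r $ c) 0) = mat 1"
    by (auto simp: N_def vec_eq_iff mat_def)
  then have N0: "fps_nth (det N) 0 = 1"
    using det_map_ring_hom[of "\<lambda>f. fps_nth f 0" N] by simp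
  have "det N \<noteq> 0" using N0 by auto
  then show "det (mat 1 + (\<chi> r c. t_par * M $ r $ c)) \<noteq> 0" unfolding det by simp
  have "inverse (fps_to_fls (det N)) = fps_to_fls (inverse (det N))"
    by (rule fls_inverse_fps_to_fls) (simp add: N0 subdegree_eq_0)
  then show "inverse (det (mat 1 + (\<chi> r c. t_par * M $ r $ c))) \<in> O2"
    unfolding det using O2_I[of "inverse (det N)" 1] N0 by simp
qed

lemma invertible_mat_1: "invertible (mat 1)"
  by (auto simp: invertible_def)

lemma GL_group: "group (GL :: ('a::semiring_1, 'n::finite) sqmat monoid)"
proof (rule groupI)
  show "\<exists>y\<in>carrier GL. y \<otimes>\<^bsub>GL\<^esub> x = \<one>\<^bsub>GL\<^esub>" if "x \<in> carrier GL" for x :: "('a, 'n) sqmat"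
    using that by (auto simp: GL_def invertible_def)
qed (auto simp: GL_def invertible_mult invertible_mat_1 matrix_mul_assoc)

lemma GL_simps [simp]:
  "carrier GL = {A. invertible A}" "A \<otimes>\<^bsub>GL\<^esub> B = A ** B" "\<one>\<^bsub>GL\<^esub> = mat 1"
  by (auto simp: GL_def)

lemma GL_inv:
  assumes "invertible A"
  shows "A ** inv\<^bsub>GL\<^esub> A = mat 1" "inv\<^bsub>GL\<^esub> A ** A = mat 1"
  using group.r_inv[OF GL_group, of A] group.l_inv[OF GL_group, of A] assms by auto

lemma GL_inv_eq: "A ** B = mat 1 \<Longrightarrow> B ** A = mat 1 \<Longrightarrow> inv\<^bsub>GL\<^esub> A = B"
  by (rule group.inv_equality[OF GL_group]) (auto simp: invertible_def)

lemma GL_O2_subgroup: "subgroup (GL_O2 :: ('k::field loc2, 'n::finite) sqmat set) GL"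
proof (rule group.subgroupI[OF GL_group])
  show "GL_O2 \<subseteq> carrier GL" by (auto simp: GL_O2_def invertible_def)
  show "GL_O2 \<noteq> ({} :: ('k::field loc2, 'n::finite) sqmat set)"
    using Mat_O2_one matrix_mul_lid unfolding GL_O2_def by blast
  show "inv\<^bsub>GL\<^esub> A \<in> GL_O2" if "A \<in> GL_O2" for A :: "('k loc2, 'n) sqmat"
    using that GL_inv_eq by (auto simp: GL_O2_def)
  show "A \<otimes>\<^bsub>GL\<^esub> B \<in> GL_O2" if AB: "A \<in> GL_O2" "B \<in> GL_O2" for A B :: "('k loc2, 'n) sqmat"
  proof -
    obtain A' B' where *: "A' \<in> Mat_O2" "A ** A' = mat 1" "A' ** A = mat 1"
        "B' \<in> Mat_O2" "B ** B' = mat 1" "B' ** B = mat 1"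
      using AB by (auto simp: GL_O2_def)
    have "(A ** B) ** (B' ** A') = A ** (B ** B') ** A'" by (simp add: matrix_mul_assoc)
    moreover have "(B' ** A') ** (A ** B) = B' ** (A' ** A) ** B" by (simp add: matrix_mul_assoc)
    ultimately have "(A ** B) ** (B' ** A') = mat 1" "(B' ** A') ** (A ** B) = mat 1" using * by simp_all
    then show ?thesis using AB * by (auto simp: GL_O2_def intro!: Mat_O2_mult bexI[of _ "B' ** A'"])
  qed
qed

abbreviation (input) scale :: "'a::times \<Rightarrow> ('a, 'n::finite) sqmat \<Rightarrow> ('a, 'n) sqmat" where
  "scale s M \<equiv> (\<chi> r c. s * M $ r $ c)"

lemma scale_mult:
  fixes M N :: "('a::comm_ring_1, 'n::finite) sqmat"
  shows "N ** scale s M = scale s (N ** M)" "scale s M ** N = scale s (M ** N)"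
  by (auto simp: vec_eq_iff matrix_matrix_mult_def sum_distrib_left ac_simps)

lemma matrix_add_distrib_right:
  fixes L M N :: "('a::semiring_1, 'n::finite) sqmat"
  shows "(L + M) ** N = L ** N + M ** N"
  by (simp add: vec_eq_iff matrix_matrix_mult_def sum.distrib distrib_right)

text \<open>
  Write \<open>s = u\<^sup>i t\<^sup>j\<close>. An element \<open>1 + sM\<close> is congruent to 1 modulo t as j is positive, so it
  has an inverse B over \<open>O2\<close>; the equation \<open>B (1 + sM) = 1\<close> reads \<open>B = 1 - s BM\<close>, so B is again
  congruent to 1 modulo s. Conjugation by g replaces M by its conjugate.
\<close>

lemma K_lev_subgroup_normal:
  fixes g :: "('k::field loc2, 'n::finite) sqmat"
  assumes "1 \<le> j"
  shows K_lev_subset_GL_O2: "(K_lev i j :: ('k loc2, 'n) sqmat set) \<subseteq> GL_O2"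
    and K_lev_subgroup: "subgroup (K_lev i j :: ('k loc2, 'n) sqmat set) GL"
    and K_lev_normal: "g \<in> GL_O2 \<Longrightarrow> A \<in> K_lev i j \<Longrightarrow> g ** A ** inv\<^bsub>GL\<^esub> g \<in> K_lev i j"
proof -
  define s :: "'k loc2" where "s = u_par ^ i * t_par ^ j"
  \<comment> \<open>Splitting off one factor t from s exhibits the congruence modulo t.\<close>
  obtain j' where j: "j = Suc j'" using assms by (cases j) auto
  define s' :: "'k loc2" where "s' = u_par ^ i * t_par ^ j'"
  have s: "s = t_par * s'" by (simp add: s_def s'_def j)
  have s'O2: "s' \<in> O2" unfolding s'_def by (intro O2_mult O2_pow u_par_in_O2 t_par_in_O2)
  have sO2: "s \<in> O2" unfolding s by (intro O2_mult t_par_in_O2 s'O2)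
  have K: "K_lev i j = {mat 1 + scale s M | M :: ('k loc2, 'n) sqmat. M \<in> Mat_O2}"
    by (simp add: K_lev_def s_def)
  have scO2: "scale s M \<in> Mat_O2" if "M \<in> Mat_O2" for M :: "('k loc2, 'n) sqmat"
    using that sO2 by (auto simp: Mat_O2_def intro: O2_mult)
  have inv: "\<exists>B\<in>Mat_O2. (mat 1 + scale s M) ** B = mat 1 \<and> B ** (mat 1 + scale s M) = mat 1
      \<and> B \<in> K_lev i j"
    if M: "M \<in> Mat_O2" for M :: "('k loc2, 'n) sqmat"
  proof -
    define A where "A = mat 1 + scale s M"
    have M': "scale s' M \<in> Mat_O2" using M s'O2 by (auto simp: Mat_O2_def intro: O2_mult)
    have A: "A = mat 1 + (\<chi> r c. t_par * scale s' M $ r $ c)"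
      unfolding A_def s by (simp add: mult.assoc)
    have d: "det A \<noteq> 0" "inverse (det A) \<in> O2"
      using det_cong_one_unit[OF M'] unfolding A by auto
    obtain B where B: "A ** B = mat 1" "B ** A = mat 1"
      using d(1) unfolding invertible_det_nz[symmetric] invertible_def by blast
    have "A \<in> Mat_O2" unfolding A_def using M by (intro Mat_O2_add scO2 Mat_O2_one)
    then have BO2: "B \<in> Mat_O2" using inverse_in_Mat_O2 d B(1) by blast
    have "mat 1 = B ** A" using B by simp
    also have "\<dots> = B + scale s (B ** M)" unfolding A_def by (simp add: matrix_add_ldistrib scale_mult)
    finally have "B = mat 1 - scale s (B ** M)" by (simp add: algebra_simps)
    also have "\<dots> = mat 1 + scale s (- (B ** M))" by (simp add: vec_eq_iff)
    finally have "B \<in> K_lev i j" unfolding K using BO2 M Mat_O2_mult Mat_O2_uminus by blast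
    then show ?thesis using B BO2 A_def by blast
  qed
  show sub: "(K_lev i j :: ('k loc2, 'n) sqmat set) \<subseteq> GL_O2"
  proof
    fix A :: "('k loc2, 'n) sqmat" assume "A \<in> K_lev i j"
    then obtain M where "A = mat 1 + scale s M" "M \<in> Mat_O2" unfolding K by blast
    then show "A \<in> GL_O2" using inv[of M] by (auto simp: GL_O2_def intro: Mat_O2_add scO2)
  qed
  show "subgroup (K_lev i j :: ('k loc2, 'n) sqmat set) GL"
  proof (rule group.subgroupI[OF GL_group])
    show "(K_lev i j :: ('k loc2, 'n) sqmat set) \<subseteq> carrier GL"
      by (rule order_trans[OF sub subgroup.subset[OF GL_O2_subgroup]])
    have "(0 :: ('k loc2, 'n) sqmat) \<in> Mat_O2" by (simp add: Mat_O2_def)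
    then show "K_lev i j \<noteq> ({} :: ('k loc2, 'n) sqmat set)" unfolding K by blast
    show "inv\<^bsub>GL\<^esub> A \<in> K_lev i j" if A: "A \<in> K_lev i j" for A :: "('k loc2, 'n) sqmat"
    proof -
      obtain M where "A = mat 1 + scale s M" "M \<in> Mat_O2" using A unfolding K by blast
      then show ?thesis using inv[of M] GL_inv_eq by auto
    qed
    show "A \<otimes>\<^bsub>GL\<^esub> B \<in> K_lev i j" if AB: "A \<in> K_lev i j" "B \<in> K_lev i j" for A B :: "('k loc2, 'n) sqmat"
    proof -
      obtain M N where M: "A = mat 1 + scale s M" "M \<in> Mat_O2" and N: "B = mat 1 + scale s N" "N \<in> Mat_O2"
        using AB unfolding K by blast
      have "A ** B = A + scale s (A ** N)" by (simp add: N(1) matrix_add_ldistrib scale_mult)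
      also have "\<dots> = mat 1 + scale s (M + A ** N)" by (simp add: M(1) vec_eq_iff algebra_simps)
      finally have "A ** B = mat 1 + scale s (M + A ** N)" .
      moreover have "M + A ** N \<in> Mat_O2"
        unfolding M(1) using M N by (intro Mat_O2_add Mat_O2_mult scO2 Mat_O2_one)
      ultimately show ?thesis unfolding K GL_simps by blast
    qed
  qed
  show "g ** A ** inv\<^bsub>GL\<^esub> g \<in> K_lev i j" if g: "g \<in> GL_O2" and A: "A \<in> K_lev i j"
  proof -
    obtain M where M: "A = mat 1 + scale s M" "M \<in> Mat_O2" using A unfolding K by blast
    have g': "inv\<^bsub>GL\<^esub> g \<in> GL_O2" using subgroup.m_inv_closed[OF GL_O2_subgroup g] .
    have "invertible g" using g by (auto simp: GL_O2_def invertible_def)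
    then have "g ** A ** inv\<^bsub>GL\<^esub> g = mat 1 + scale s (g ** M ** inv\<^bsub>GL\<^esub> g)"
      by (simp add: M(1) matrix_add_ldistrib matrix_add_distrib_right scale_mult GL_inv)
    then show ?thesis unfolding K using g g' M(2) by (auto simp: GL_O2_def intro!: Mat_O2_mult)
  qed
qed

section \<open>The Borel subgroup\<close>

text \<open>
  In column c of \<open>Y A = 1\<close> only the rows \<open>j \<le> c\<close> of A contribute; below the diagonal the entries of Y in
  the columns \<open>j < c\<close> vanish by induction, so a single term remains. The induction is on the number of indices
  below c, since the index type is a finite linear order without a successor function.
\<close>

lemma upper_triangular_left_inverse:
  fixes A Y :: "('a::ring_1_no_zero_divisors, 'n::{finite,linorder}) sqmat"
  assumes A: "\<And>r c. c < r \<Longrightarrow> A $ r $ c = 0" and YA: "Y ** A = mat 1"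
  shows "\<forall>r>c. Y $ r $ c = 0" "Y $ c $ c * A $ c $ c = 1"
proof -
  have "(\<forall>r>c. Y $ r $ c = 0) \<and> Y $ c $ c * A $ c $ c = 1" for c
  proof (induction "card {j. j < c}" arbitrary: c rule: less_induct)
    case less
    have IH: "Y $ r $ j = 0" if "j < c" "j < r" for j r
    proof -
      have "{i. i < j} \<subset> {i. i < c}" using that by auto
      then show ?thesis using less[of j] that by (simp add: psubset_card_mono)
    qed
    have entry: "Y $ r $ c * A $ c $ c = mat 1 $ r $ c" if "c \<le> r" for r
    proof -
      have "mat 1 $ r $ c = (\<Sum>j\<in>UNIV. Y $ r $ j * A $ j $ c)"
        by (simp add: YA[symmetric] matrix_matrix_mult_def)
      also have "\<dots> = (\<Sum>j\<in>UNIV. if j = c then Y $ r $ c * A $ c $ c else 0)"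
      proof (rule sum.cong)
        fix j :: 'n
        show "Y $ r $ j * A $ j $ c = (if j = c then Y $ r $ c * A $ c $ c else 0)"
          using IH[of j r] A[of c j] that by (cases j c rule: linorder_cases) auto
      qed simp
      finally show ?thesis by simp
    qed
    have one: "Y $ c $ c * A $ c $ c = 1" using entry[of c] by (simp add: mat_def)
    then have "A $ c $ c \<noteq> 0" by auto
    moreover have "Y $ r $ c * A $ c $ c = 0" if "c < r" for r
      using entry[of r] that by (simp add: mat_def)
    ultimately show ?case using one by simp
  qed
  then show "\<forall>r>c. Y $ r $ c = 0" "Y $ c $ c * A $ c $ c = 1" by auto
qed

lemma Borel_diag_mult:
  assumes "A \<in> Borel" "B \<in> Borel"
  shows "(A ** B) $ r $ r = A $ r $ r * B $ r $ r"
proof -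
  have "(A ** B) $ r $ r = (\<Sum>j\<in>UNIV. A $ r $ j * B $ j $ r)"
    by (simp add: matrix_matrix_mult_def)
  also have "\<dots> = (\<Sum>j\<in>UNIV. if j = r then A $ r $ r * B $ r $ r else 0)"
  proof (rule sum.cong)
    fix j
    show "A $ r $ j * B $ j $ r = (if j = r then A $ r $ r * B $ r $ r else 0)"
      using assms by (cases j r rule: linorder_cases) (auto simp: Borel_def)
  qed simp
  finally show ?thesis by simp
qed

lemma Borel_diag_nonzero:
  fixes A :: "('a::ring_1_no_zero_divisors, 'n::{finite,linorder}) sqmat"
  assumes "A \<in> Borel"
  shows "A $ r $ r \<noteq> 0"
proof -
  have "inv\<^bsub>GL\<^esub> A ** A = mat 1" using assms GL_inv by (auto simp: Borel_def)
  then show ?thesis using upper_triangular_left_inverse(2)[of A "inv\<^bsub>GL\<^esub> A" r] assms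
    by (auto simp: Borel_def)
qed

lemma Borel_subgroup:
  "subgroup (Borel :: ('a::ring_1_no_zero_divisors, 'n::{finite,linorder}) sqmat set) GL"
proof (rule group.subgroupI[OF GL_group])
  show "Borel \<subseteq> carrier GL" by (auto simp: Borel_def)
  have "(mat 1 :: ('a, 'n) sqmat) \<in> Borel"
    using invertible_mat_1 by (auto simp: Borel_def) (auto simp: mat_def)
  then show "Borel \<noteq> ({} :: ('a, 'n) sqmat set)" by blast
  show "inv\<^bsub>GL\<^esub> A \<in> Borel" if "A \<in> Borel" for A :: "('a, 'n) sqmat"
  proof -
    have "invertible A" using that by (auto simp: Borel_def)
    then have "inv\<^bsub>GL\<^esub> A ** A = mat 1" "invertible (inv\<^bsub>GL\<^esub> A)"
      using GL_inv by (auto simp: invertible_def)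
    then show ?thesis using upper_triangular_left_inverse(1)[of A "inv\<^bsub>GL\<^esub> A"] that
      by (auto simp: Borel_def)
  qed
  show "A \<otimes>\<^bsub>GL\<^esub> B \<in> Borel" if "A \<in> Borel" "B \<in> Borel" for A B :: "('a, 'n) sqmat"
  proof -
    have "(A ** B) $ r $ c = 0" if "c < r" for r c
    proof -
      have "A $ r $ j * B $ j $ c = 0" for j
        using \<open>A \<in> Borel\<close> \<open>B \<in> Borel\<close> that by (cases "j < r") (auto simp: Borel_def)
      then show ?thesis unfolding matrix_matrix_mult_def by (simp add: sum.neutral)
    qed
    then show ?thesis using that by (auto simp: Borel_def invertible_mult)
  qed
qed

section \<open>The tame symbol\<close>

text \<open>
  The second component of the rank two valuation of F that has the t-adic valuation as its first
  component.
\<close>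

abbreviation (input) w_F :: "'k::field loc2 \<Rightarrow> int" where
  "w_F a \<equiv> fls_subdegree (a $$ fls_subdegree a)"

lemma fls_lead_powi:
  fixes a :: "'k::field fls"
  assumes "a \<noteq> 0"
  shows "(a powi m) $$ (m * fls_subdegree a) = (a $$ fls_subdegree a) powi m"
proof (cases "m \<ge> 0")
  case True
  then show ?thesis using fls_pow_base[of a "nat m"]
    by (simp add: power_int_def fls_subdegree_pow)
next
  case False
  define n where "n = nat (- m)"
  have "(a ^ n) $$ (int n * fls_subdegree a) * (inverse (a ^ n)) $$ (- (int n * fls_subdegree a)) = 1"
  proof -
    have "a ^ n * inverse (a ^ n) = 1" using assms by simp
    moreover have "fls_subdegree (inverse (a ^ n)) = - (int n * fls_subdegree a)"
      using assms by (simp add: fls_subdegree_pow fls_inverse_subdegree)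
    ultimately show ?thesis
      using fls_times_base[of "a ^ n" "inverse (a ^ n)"] assms by (simp add: fls_subdegree_pow)
  qed
  moreover have "(a ^ n) $$ (int n * fls_subdegree a) = (a $$ fls_subdegree a) ^ n"
    using fls_pow_base[of a n] by (simp add: fls_subdegree_pow)
  ultimately have "inverse (a ^ n) $$ (- (int n * fls_subdegree a)) = inverse ((a $$ fls_subdegree a) ^ n)"
    by (metis inverse_unique)
  moreover have "m = - int n" using False by (simp add: n_def)
  ultimately show ?thesis using False by (simp add: power_int_def power_inverse)
qed

text \<open>
  The element \<open>a\<^bsup>v(b)\<^esup> b\<^bsup>-v(a)\<^esup>\<close> has t-adic valuation 0, so its reduction modulo t is its leading
  coefficient, and leading coefficients are multiplicative. The sign has u-adic valuation 0.
\<close>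

lemma nu_F_eq:
  fixes a b :: "'k::field loc2"
  assumes "a \<noteq> 0" "b \<noteq> 0"
  shows "nu_F a b = fls_subdegree b * w_F a - fls_subdegree a * w_F b"
proof -
  define p where "p = a powi fls_subdegree b"
  define q where "q = b powi (- fls_subdegree a)"
  have pq: "p \<noteq> 0" "q \<noteq> 0" using assms by (simp_all add: p_def q_def)
  have "(p * q) $$ 0 = p $$ fls_subdegree p * q $$ fls_subdegree q"
    using fls_times_base[of p q] by (simp add: p_def q_def)
  also have "\<dots> = (a $$ fls_subdegree a) powi fls_subdegree b * (b $$ fls_subdegree b) powi (- fls_subdegree a)"
    using fls_lead_powi[OF assms(1), of "fls_subdegree b"] fls_lead_powi[OF assms(2), of "- fls_subdegree a"]
    by (simp add: p_def q_def)
  finally have "tame a b = (- 1) powi (fls_subdegree a * fls_subdegree b) *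
      ((a $$ fls_subdegree a) powi fls_subdegree b * (b $$ fls_subdegree b) powi (- fls_subdegree a))"
    by (simp add: tame_def p_def q_def)
  then show ?thesis using assms by (simp add: nu_F_def algebra_simps)
qed

lemma w_F_mult: "a \<noteq> 0 \<Longrightarrow> b \<noteq> 0 \<Longrightarrow> w_F (a * b :: 'k::field loc2) = w_F a + w_F b"
  using fls_times_base[of a b] by simp

lemma nu_F_mult:
  fixes a b c :: "'k::field loc2"
  assumes "a \<noteq> 0" "b \<noteq> 0" "c \<noteq> 0"
  shows "nu_F (a * b) c = nu_F a c + nu_F b c" "nu_F a (b * c) = nu_F a b + nu_F a c"
  using assms by (simp_all add: nu_F_eq w_F_mult algebra_simps)

lemma nu_F_units: "fls_subdegree a = 0 \<Longrightarrow> fls_subdegree b = 0 \<Longrightarrow> nu_F a b = 0"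
  by (simp add: nu_F_def tame_def)

section \<open>Cosets\<close>

lemma (in group) inv_cancel_left:
  assumes "a \<in> carrier G" "b \<in> carrier G"
  shows "a \<otimes> (inv a \<otimes> b) = b" "inv a \<otimes> (a \<otimes> b) = b"
  using assms by (simp_all flip: m_assoc)

lemma (in group) l_coset_eq_iff:
  assumes "subgroup C G" "a \<in> carrier G" "b \<in> carrier G"
  shows "a <# C = b <# C \<longleftrightarrow> inv a \<otimes> b \<in> C"
proof
  assume "a <# C = b <# C"
  then have "b \<in> a <# C" using lcos_self[OF assms(3,1)] by simp
  then show "inv a \<otimes> b \<in> C" by (rule subgroup.lcos_module_imp[OF assms(1) is_group assms(2)])
next
  assume "inv a \<otimes> b \<in> C"
  then have "b \<in> a <# C" by (rule subgroup.lcos_module_rev[OF assms(1) is_group assms(2,3)])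
  then show "a <# C = b <# C" by (rule l_repr_independence[OF _ assms(2,1)])
qed

lemma (in group) l_coset_set_mult:
  assumes "subgroup C G" "subgroup D G" "D \<subseteq> C" "g \<in> carrier G"
  shows "(g <# D) <#> C = g <# C"
proof -
  have C: "C \<subseteq> carrier G" by (rule subgroup.subset[OF assms(1)])
  have D: "D \<subseteq> carrier G" by (rule subgroup.subset[OF assms(2)])
  have "D <#> C = C"
  proof
    show "D <#> C \<subseteq> C" using assms(3) subgroup.m_closed[OF assms(1)] by (auto simp: set_mult_def)
    show "C \<subseteq> D <#> C"
      using subgroup.one_closed[OF assms(2)] C by (force simp: set_mult_def)
  qed
  then show ?thesis using setmult_lcos_assoc[OF D C assms(4)] by simp
qed

lemma (in group) l_coset_r_coset:
  assumes "C \<subseteq> carrier G" "h \<in> carrier G" "g \<in> carrier G"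
    and "\<And>c. c \<in> C \<Longrightarrow> h \<otimes> c \<otimes> inv h \<in> C" "\<And>c. c \<in> C \<Longrightarrow> inv h \<otimes> c \<otimes> h \<in> C"
  shows "(g <# C) #> h = (g \<otimes> h) <# C"
proof
  show "(g <# C) #> h \<subseteq> (g \<otimes> h) <# C"
  proof
    fix y assume "y \<in> (g <# C) #> h"
    then obtain c where c: "c \<in> C" "y = g \<otimes> c \<otimes> h" by (auto simp: l_coset_def r_coset_def)
    then have "c \<in> carrier G" using assms(1) by blast
    then have "y = g \<otimes> h \<otimes> (inv h \<otimes> c \<otimes> h)" using c assms(2,3) by (simp add: m_assoc inv_cancel_left)
    then show "y \<in> (g \<otimes> h) <# C" using assms(5)[OF c(1)] by (auto simp: l_coset_def)
  qed
  show "(g \<otimes> h) <# C \<subseteq> (g <# C) #> h"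
  proof
    fix y assume "y \<in> (g \<otimes> h) <# C"
    then obtain c where c: "c \<in> C" "y = g \<otimes> h \<otimes> c" by (auto simp: l_coset_def)
    then have "c \<in> carrier G" using assms(1) by blast
    then have "y = g \<otimes> (h \<otimes> c \<otimes> inv h) \<otimes> h" using c assms(2,3) by (simp add: m_assoc)
    then show "y \<in> (g <# C) #> h" using assms(4)[OF c(1)] by (auto simp: l_coset_def r_coset_def)
  qed
qed

lemma (in group) conjugate_subgroup:
  assumes C: "subgroup C G" and h: "h \<in> carrier G"
  shows "subgroup (h <# C #> inv h) G"
proof -
  have sub: "C \<subseteq> carrier G" using subgroup.subset[OF C] .
  have mem: "y \<in> h <# C #> inv h \<longleftrightarrow> (\<exists>c\<in>C. y = h \<otimes> c \<otimes> inv h)" for y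
    by (auto simp: l_coset_def r_coset_def)
  show ?thesis
  proof (rule subgroupI)
    show "h <# C #> inv h \<subseteq> carrier G" using sub h by (auto simp: mem subset_iff)
    show "h <# C #> inv h \<noteq> {}" using subgroup.one_closed[OF C] mem by blast
    fix y z assume y: "y \<in> h <# C #> inv h" and z: "z \<in> h <# C #> inv h"
    obtain c where c: "c \<in> C" "y = h \<otimes> c \<otimes> inv h" using y mem by blast
    obtain d where d: "d \<in> C" "z = h \<otimes> d \<otimes> inv h" using z mem by blast
    have car: "c \<in> carrier G" "d \<in> carrier G" using c d sub by auto
    have "inv y = h \<otimes> inv c \<otimes> inv h" using c car h by (simp add: inv_mult_group m_assoc)
    then show "inv y \<in> h <# C #> inv h" using mem subgroup.m_inv_closed[OF C c(1)] by blast
    have "y \<otimes> z = h \<otimes> c \<otimes> (inv h \<otimes> h) \<otimes> d \<otimes> inv h"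
      unfolding c(2) d(2) using car h by (simp add: m_assoc inv_cancel_left)
    then have "y \<otimes> z = h \<otimes> (c \<otimes> d) \<otimes> inv h" using car h by (simp add: m_assoc)
    then show "y \<otimes> z \<in> h <# C #> inv h" using mem subgroup.m_closed[OF C c(1) d(1)] by blast
  qed
qed

section \<open>The groups and the level subgroups\<close>

lemma H_grp_group: "group (H_grp :: ('k::{field,finite}, 'n::{finite,linorder}) dbl monoid)"
  unfolding H_grp_def by (intro DirProd_group GL_group)

interpretation H: group "H_grp :: ('k::{field,finite}, 'n::{finite,linorder}) dbl monoid"
  by (rule H_grp_group)

lemma B_H_subgroup: "subgroup (B_H :: ('k::{field,finite}, 'n::{finite,linorder}) dbl set) H_grp"
  unfolding B_H_def H_grp_def by (intro DirProd_subgroups GL_group Borel_subgroup)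

lemma H0_subgroup: "subgroup (H0 :: ('k::{field,finite}, 'n::{finite,linorder}) dbl set) H_grp"
  unfolding H0_def H_grp_def by (intro DirProd_subgroups GL_group GL_O2_subgroup)

lemmas B_H_closed [simp, intro] =
  subgroup.m_closed[OF B_H_subgroup] subgroup.m_inv_closed[OF B_H_subgroup] subgroup.one_closed[OF B_H_subgroup]
lemmas H0_closed [simp, intro] =
  subgroup.m_closed[OF H0_subgroup] subgroup.m_inv_closed[OF H0_subgroup] subgroup.one_closed[OF H0_subgroup]

lemma B_H_carrier [simp, intro]: "b \<in> B_H \<Longrightarrow> b \<in> carrier H_grp"
  using subgroup.mem_carrier[OF B_H_subgroup] .

lemma H0_carrier [simp, intro]: "b \<in> H0 \<Longrightarrow> b \<in> carrier H_grp"
  using subgroup.mem_carrier[OF H0_subgroup] .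

lemma C_dbl_normal:
  fixes h :: "('k::{field,finite}, 'n::{finite,linorder}) dbl"
  assumes "1 \<le> j"
  shows C_dbl_subgroup: "subgroup (C_dbl i j :: ('k, 'n) dbl set) H_grp"
    and C_dbl_subset_H0: "(C_dbl i j :: ('k, 'n) dbl set) \<subseteq> H0"
    and C_dbl_conj: "h \<in> H0 \<Longrightarrow> c \<in> C_dbl i j \<Longrightarrow> h \<otimes>\<^bsub>H_grp\<^esub> c \<otimes>\<^bsub>H_grp\<^esub> inv\<^bsub>H_grp\<^esub> h \<in> C_dbl i j"
proof -
  show "subgroup (C_dbl i j :: ('k, 'n) dbl set) H_grp"
    unfolding C_dbl_def H_grp_def by (intro DirProd_subgroups GL_group K_lev_subgroup assms)
  show "(C_dbl i j :: ('k, 'n) dbl set) \<subseteq> H0"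
    unfolding C_dbl_def H0_def by (intro Sigma_mono K_lev_subset_GL_O2 assms)
  show "h \<otimes>\<^bsub>H_grp\<^esub> c \<otimes>\<^bsub>H_grp\<^esub> inv\<^bsub>H_grp\<^esub> h \<in> C_dbl i j" if h: "h \<in> H0" and c: "c \<in> C_dbl i j"
  proof -
    obtain h1 h2 c1 c2 where *: "h = (h1, h2)" "c = (c1, c2)" by (metis surj_pair)
    have m: "h1 \<in> GL_O2" "h2 \<in> GL_O2" "c1 \<in> K_lev i j" "c2 \<in> K_lev i j"
      using h c * by (auto simp: H0_def C_dbl_def)
    then have "h1 \<in> carrier GL" "h2 \<in> carrier GL" using subgroup.mem_carrier[OF GL_O2_subgroup] by blast+
    then have "inv\<^bsub>H_grp\<^esub> h = (inv\<^bsub>GL\<^esub> h1, inv\<^bsub>GL\<^esub> h2)"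
      unfolding H_grp_def *(1) by (rule inv_DirProd[OF GL_group GL_group])
    then show ?thesis
      using m by (simp add: * H_grp_def C_dbl_def K_lev_normal[OF assms])
  qed
qed

lemma C_H0_cases:
  assumes "C \<in> C_H0"
  obtains \<S> where "C = \<Inter>\<S>" "finite \<S>" "\<S> \<noteq> {}" "\<And>S. S \<in> \<S> \<Longrightarrow> \<exists>i j. S = C_dbl i j \<and> 1 \<le> i \<and> 1 \<le> j"
  using assms unfolding C_H0_def by blast

lemma C_H0_subgroup: assumes "C \<in> C_H0" shows "subgroup C H_grp"
proof -
  obtain \<S> where S: "C = \<Inter>\<S>" "\<S> \<noteq> {}" "\<And>S. S \<in> \<S> \<Longrightarrow> \<exists>i j. S = C_dbl i j \<and> 1 \<le> i \<and> 1 \<le> j"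
    using C_H0_cases[OF assms] by metis
  have "subgroup S H_grp" if "S \<in> \<S>" for S
    using S(3)[OF that] by (auto simp: C_dbl_subgroup)
  then show ?thesis unfolding S(1) using S(2) by (intro H.subgroups_Inter)
qed

lemma C_H0_subset: assumes "C \<in> C_H0" shows "C \<subseteq> H0"
proof -
  obtain \<S> where S: "C = \<Inter>\<S>" "\<S> \<noteq> {}" "\<And>S. S \<in> \<S> \<Longrightarrow> \<exists>i j. S = C_dbl i j \<and> 1 \<le> i \<and> 1 \<le> j"
    using C_H0_cases[OF assms] by metis
  then obtain i j where "C \<subseteq> C_dbl i j" "1 \<le> j" by blast
  then show ?thesis using order_trans[OF _ C_dbl_subset_H0] by blast
qed

lemma C_H0_conj:
  assumes "C \<in> C_H0" "h \<in> H0" "c \<in> C"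
  shows "h \<otimes>\<^bsub>H_grp\<^esub> c \<otimes>\<^bsub>H_grp\<^esub> inv\<^bsub>H_grp\<^esub> h \<in> C"
proof -
  obtain \<S> where S: "C = \<Inter>\<S>" "\<S> \<noteq> {}" "\<And>S. S \<in> \<S> \<Longrightarrow> \<exists>i j. S = C_dbl i j \<and> 1 \<le> i \<and> 1 \<le> j"
    using C_H0_cases[OF assms(1)] by metis
  have "h \<otimes>\<^bsub>H_grp\<^esub> c \<otimes>\<^bsub>H_grp\<^esub> inv\<^bsub>H_grp\<^esub> h \<in> S" if "S \<in> \<S>" for S
  proof -
    obtain i j where "S = C_dbl i j" "1 \<le> j" using S(3)[OF \<open>S \<in> \<S>\<close>] by blast
    then show ?thesis using C_dbl_conj[of j h c i] assms(2,3) S(1) that by blast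
  qed
  then show ?thesis unfolding S(1) by blast
qed

text \<open>
  This makes both families of levels directed: any two members have a common refinement.
\<close>

lemma finite_Inter_family_Int:
  assumes "C \<in> {\<Inter>\<S> | \<S>. finite \<S> \<and> \<S> \<noteq> {} \<and> \<S> \<subseteq> F}"
    and "D \<in> {\<Inter>\<S> | \<S>. finite \<S> \<and> \<S> \<noteq> {} \<and> \<S> \<subseteq> F}"
  shows "C \<inter> D \<in> {\<Inter>\<S> | \<S>. finite \<S> \<and> \<S> \<noteq> {} \<and> \<S> \<subseteq> F}"
proof -
  obtain \<S> \<T> where S: "C = \<Inter>\<S>" "finite \<S>" "\<S> \<noteq> {}" "\<S> \<subseteq> F"
    and T: "D = \<Inter>\<T>" "finite \<T>" "\<T> \<noteq> {}" "\<T> \<subseteq> F"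
    using assms by auto
  have "C \<inter> D = \<Inter>(\<S> \<union> \<T>) \<and> finite (\<S> \<union> \<T>) \<and> \<S> \<union> \<T> \<noteq> {} \<and> \<S> \<union> \<T> \<subseteq> F"
    using S T by (simp add: Inter_Un_distrib)
  then show ?thesis by blast
qed

lemma C_H0_Int: "C \<in> C_H0 \<Longrightarrow> D \<in> C_H0 \<Longrightarrow> C \<inter> D \<in> C_H0"
  unfolding C_H0_def by (rule finite_Inter_family_Int)

lemma C_H_Int: "C \<in> C_H \<Longrightarrow> D \<in> C_H \<Longrightarrow> C \<inter> D \<in> C_H"
  unfolding C_H_def by (rule finite_Inter_family_Int)

lemma C_H0_subset_C_H: "C_H0 \<subseteq> (C_H :: ('k::{field,finite}, 'n::{finite,linorder}) dbl set set)"
proof -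
  have "(C_dbl i j :: ('k, 'n) dbl set) = \<one>\<^bsub>H_grp\<^esub> <#\<^bsub>H_grp\<^esub> C_dbl i j #>\<^bsub>H_grp\<^esub> inv\<^bsub>H_grp\<^esub> \<one>\<^bsub>H_grp\<^esub>"
    if "1 \<le> j" for i j :: nat
    by (simp add: H.lcos_mult_one[OF subgroup.subset[OF C_dbl_subgroup[OF that]]]
        H.coset_mult_one[OF subgroup.subset[OF C_dbl_subgroup[OF that]]])
  then have "{C_dbl i j | i j. 1 \<le> i \<and> 1 \<le> j} \<subseteq>
      {h <#\<^bsub>H_grp\<^esub> (C_dbl i j :: ('k, 'n) dbl set) #>\<^bsub>H_grp\<^esub> inv\<^bsub>H_grp\<^esub> h | h i j.
        h \<in> carrier H_grp \<and> 1 \<le> i \<and> 1 \<le> j}"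
    using H.one_closed by blast
  then show ?thesis unfolding C_H0_def C_H_def by blast
qed

lemma C_H_subgroup: assumes "C \<in> C_H" shows "subgroup C H_grp"
proof -
  obtain \<S> where S: "C = \<Inter>\<S>" "\<S> \<noteq> {}"
    "\<S> \<subseteq> {h <#\<^bsub>H_grp\<^esub> C_dbl i j #>\<^bsub>H_grp\<^esub> inv\<^bsub>H_grp\<^esub> h | h i j. h \<in> carrier H_grp \<and> 1 \<le> i \<and> 1 \<le> j}"
    using assms unfolding C_H_def by blast
  have "subgroup S H_grp" if S': "S \<in> \<S>" for S
  proof -
    obtain h i j where "S = h <#\<^bsub>H_grp\<^esub> C_dbl i j #>\<^bsub>H_grp\<^esub> inv\<^bsub>H_grp\<^esub> h" "h \<in> carrier H_grp" "1 \<le> j"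
      using S(3) S' by blast
    then show ?thesis by (simp add: H.conjugate_subgroup C_dbl_subgroup)
  qed
  then show ?thesis unfolding S(1) using S(2) by (intro H.subgroups_Inter)
qed

section \<open>The cocycle on the Borel subgroup\<close>

lemma B_H_entries:
  assumes "b \<in> B_H"
  shows "fst b $ r $ r \<noteq> 0" "snd b $ r $ r \<noteq> 0"
  using assms by (auto simp: B_H_def Borel_diag_nonzero)

lemma B_H_mult_entries:
  assumes "b \<in> B_H" "b' \<in> B_H"
  shows "fst (b \<otimes>\<^bsub>H_grp\<^esub> b') $ r $ r = fst b $ r $ r * fst b' $ r $ r"
    "snd (b \<otimes>\<^bsub>H_grp\<^esub> b') $ r $ r = snd b $ r $ r * snd b' $ r $ r"
  using assms by (auto simp: B_H_def H_grp_def mult_DirProd' Borel_diag_mult)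

lemma Q0_entries:
  fixes q :: "('k::{field,finite}, 'n::{finite,linorder}) dbl"
  assumes "q \<in> Q0"
  shows "fls_subdegree (fst q $ r $ r) = 0" "fls_subdegree (snd q $ r $ r) = 0"
proof -
  have *: "fls_subdegree (A $ r $ r) = 0" if "A \<in> Borel" "A \<in> GL_O2" for A :: "('k loc2, 'n) sqmat"
  proof -
    let ?B = "inv\<^bsub>GL\<^esub> A"
    have B: "?B \<in> Borel" "?B \<in> GL_O2"
      using subgroup.m_inv_closed[OF Borel_subgroup] subgroup.m_inv_closed[OF GL_O2_subgroup] that by blast+
    have "A ** ?B = mat 1" using that by (intro GL_inv) (auto simp: Borel_def)
    then have "A $ r $ r * ?B $ r $ r = 1"
      using Borel_diag_mult[OF that(1) B(1), of r] by (simp add: mat_def)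
    then show ?thesis using that B
      by (intro O2_units_subdegree[of _ "?B $ r $ r"]) (auto simp: GL_O2_def Mat_O2_def)
  qed
  show "fls_subdegree (fst q $ r $ r) = 0" "fls_subdegree (snd q $ r $ r) = 0"
    using assms * by (auto simp: Q0_def B_H_def H0_def)
qed

text \<open>
  The diagonal entries of q and q' are units of \<open>O2\<close>, so both t-adic valuations in the tame symbol are 0.
\<close>

lemma sigma_Q0:
  assumes "q \<in> Q0" "q' \<in> Q0"
  shows "sigma \<alpha> q q' = 1"
  using Q0_entries[OF assms(1)] Q0_entries[OF assms(2)] by (simp add: sigma_def nu_F_units)

locale multiplier =
  fixes \<alpha> :: "'n::{finite,linorder} \<Rightarrow> lam"
  assumes nonzero: "\<alpha> r \<noteq> 0"
begin

lemma sigma_nonzero: "sigma \<alpha> b b' \<noteq> 0"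
  by (simp add: sigma_def nonzero)

lemma sigma_mult:
  assumes "b \<in> B_H" "b' \<in> B_H" "b'' \<in> B_H"
  shows "sigma \<alpha> (b \<otimes>\<^bsub>H_grp\<^esub> b') b'' = sigma \<alpha> b b'' * sigma \<alpha> b' b''"
    "sigma \<alpha> b (b' \<otimes>\<^bsub>H_grp\<^esub> b'') = sigma \<alpha> b b' * sigma \<alpha> b b''"
  using assms
  by (simp_all add: sigma_def B_H_mult_entries B_H_entries nu_F_mult nonzero power_int_diff
        power_int_minus field_simps flip: prod.distrib power_int_add)

lemma sigma_one:
  assumes "b \<in> B_H"
  shows "sigma \<alpha> \<one>\<^bsub>H_grp\<^esub> b = 1" "sigma \<alpha> b \<one>\<^bsub>H_grp\<^esub> = 1"
  using sigma_mult(1)[of "\<one>\<^bsub>H_grp\<^esub>" "\<one>\<^bsub>H_grp\<^esub>" b] sigma_mult(2)[of b "\<one>\<^bsub>H_grp\<^esub>" "\<one>\<^bsub>H_grp\<^esub>"] assms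
  by (simp_all add: sigma_nonzero)

text \<open>
  The change of coordinates between two representations of a fiber: \<open>e_b \<otimes> x\<close> is identified with
  \<open>e_b' \<otimes> transition b b' x\<close>.
\<close>

definition transition :: "('k::{field,finite}, 'n) dbl \<Rightarrow> ('k, 'n) dbl \<Rightarrow> lam" where
  "transition b b' = sigma \<alpha> b (inv\<^bsub>H_grp\<^esub> b \<otimes>\<^bsub>H_grp\<^esub> b')"

lemma transition_self: "b \<in> B_H \<Longrightarrow> transition b b = 1"
  by (simp add: transition_def sigma_one)

text \<open>
  With \<open>q = b\<^sup>-\<^sup>1 b'\<close> and \<open>q' = b'\<^sup>-\<^sup>1 b''\<close>, bimultiplicativity turns the claim into
  \<open>\<sigma>(b,q) \<sigma>(b,q') \<sigma>(q,q') = \<sigma>(b,q) \<sigma>(b,q')\<close>, which is triviality of \<open>\<sigma>\<close> on \<open>Q0\<close>.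
\<close>

lemma transition_cocycle:
  assumes "b \<in> B_H" "b' \<in> B_H" "b'' \<in> B_H"
    and "inv\<^bsub>H_grp\<^esub> b \<otimes>\<^bsub>H_grp\<^esub> b' \<in> Q0" "inv\<^bsub>H_grp\<^esub> b' \<otimes>\<^bsub>H_grp\<^esub> b'' \<in> Q0"
  shows "transition b b' * transition b' b'' = transition b b''"
proof -
  define q where "q = inv\<^bsub>H_grp\<^esub> b \<otimes>\<^bsub>H_grp\<^esub> b'"
  define q' where "q' = inv\<^bsub>H_grp\<^esub> b' \<otimes>\<^bsub>H_grp\<^esub> b''"
  have q: "q \<in> B_H" "q' \<in> B_H" "q \<in> Q0" "q' \<in> Q0" using assms by (auto simp: q_def q'_def)
  have b': "b' = b \<otimes>\<^bsub>H_grp\<^esub> q" using assms by (simp add: q_def flip: H.m_assoc)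
  have "b'' = b' \<otimes>\<^bsub>H_grp\<^esub> q'" using assms by (simp add: q'_def flip: H.m_assoc)
  then have "inv\<^bsub>H_grp\<^esub> b \<otimes>\<^bsub>H_grp\<^esub> b'' = q \<otimes>\<^bsub>H_grp\<^esub> q'"
    using assms q by (simp add: q_def H.m_assoc)
  then have "transition b b'' = sigma \<alpha> b q * sigma \<alpha> b q'"
    using assms q by (simp add: transition_def sigma_mult)
  moreover have "transition b' b'' = sigma \<alpha> b q' * sigma \<alpha> q q'"
    using sigma_mult(1)[OF assms(1) q(1,2)] b' by (simp only: transition_def q'_def)
  ultimately show ?thesis using sigma_Q0[OF q(3,4), of \<alpha>] by (simp add: transition_def q_def)
qed

text \<open>
  The action of \<open>b0\<close> respects the identifications: with \<open>q = b\<^sup>-\<^sup>1 b'\<close>, both sides are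
  \<open>\<sigma>(b0,b) \<sigma>(b0,q) \<sigma>(b,q)\<close>.
\<close>

lemma transition_left_mult:
  assumes "b0 \<in> B_H" "b \<in> B_H" "b' \<in> B_H"
  shows "sigma \<alpha> b0 b' * transition b b' = transition (b0 \<otimes>\<^bsub>H_grp\<^esub> b) (b0 \<otimes>\<^bsub>H_grp\<^esub> b') * sigma \<alpha> b0 b"
proof -
  define q where "q = inv\<^bsub>H_grp\<^esub> b \<otimes>\<^bsub>H_grp\<^esub> b'"
  have q: "q \<in> B_H" and b': "b' = b \<otimes>\<^bsub>H_grp\<^esub> q" using assms by (auto simp: q_def simp flip: H.m_assoc)
  have "inv\<^bsub>H_grp\<^esub> (b0 \<otimes>\<^bsub>H_grp\<^esub> b) \<otimes>\<^bsub>H_grp\<^esub> (b0 \<otimes>\<^bsub>H_grp\<^esub> b') = q"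
    using assms by (simp add: q_def H.inv_mult_group H.m_assoc H.inv_cancel_left)
  then show ?thesis unfolding transition_def q_def[symmetric]
    using assms q by (simp add: b' sigma_mult ac_simps)
qed

end

text \<open>
  Here C has to be contained in \<open>H0\<close>: then \<open>k\<^sup>-\<^sup>1 b\<^sup>-\<^sup>1 b' k'\<close> lies in \<open>H0\<close>, and so does \<open>b\<^sup>-\<^sup>1 b'\<close>.
\<close>

lemma same_coset_Q0:
  assumes C: "subgroup C H_grp" "C \<subseteq> H0"
    and "b \<in> B_H" "b' \<in> B_H" "k \<in> H0" "k' \<in> H0"
    and "(b \<otimes>\<^bsub>H_grp\<^esub> k) <#\<^bsub>H_grp\<^esub> C = (b' \<otimes>\<^bsub>H_grp\<^esub> k') <#\<^bsub>H_grp\<^esub> C"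
  shows "inv\<^bsub>H_grp\<^esub> b \<otimes>\<^bsub>H_grp\<^esub> b' \<in> Q0"
proof -
  have "inv\<^bsub>H_grp\<^esub> (b \<otimes>\<^bsub>H_grp\<^esub> k) \<otimes>\<^bsub>H_grp\<^esub> (b' \<otimes>\<^bsub>H_grp\<^esub> k') \<in> H0"
    using H.l_coset_eq_iff[OF C(1)] assms by auto
  then have "k \<otimes>\<^bsub>H_grp\<^esub> (inv\<^bsub>H_grp\<^esub> (b \<otimes>\<^bsub>H_grp\<^esub> k) \<otimes>\<^bsub>H_grp\<^esub> (b' \<otimes>\<^bsub>H_grp\<^esub> k')) \<otimes>\<^bsub>H_grp\<^esub> inv\<^bsub>H_grp\<^esub> k' \<in> H0"
    using assms by auto
  also have "k \<otimes>\<^bsub>H_grp\<^esub> (inv\<^bsub>H_grp\<^esub> (b \<otimes>\<^bsub>H_grp\<^esub> k) \<otimes>\<^bsub>H_grp\<^esub> (b' \<otimes>\<^bsub>H_grp\<^esub> k')) \<otimes>\<^bsub>H_grp\<^esub> inv\<^bsub>H_grp\<^esub> k'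
      = inv\<^bsub>H_grp\<^esub> b \<otimes>\<^bsub>H_grp\<^esub> b'"
  proof -
    have k: "k \<in> carrier H_grp" "k' \<in> carrier H_grp" "b \<in> carrier H_grp" "b' \<in> carrier H_grp"
      using assms by auto
    have "k \<otimes>\<^bsub>H_grp\<^esub> (inv\<^bsub>H_grp\<^esub> (b \<otimes>\<^bsub>H_grp\<^esub> k) \<otimes>\<^bsub>H_grp\<^esub> (b' \<otimes>\<^bsub>H_grp\<^esub> k')) \<otimes>\<^bsub>H_grp\<^esub> inv\<^bsub>H_grp\<^esub> k'
      = inv\<^bsub>H_grp\<^esub> b \<otimes>\<^bsub>H_grp\<^esub> b'"
      using k by (simp add: H.inv_mult_group H.m_assoc H.inv_cancel_left)
    then show ?thesis .
  qed
  finally show ?thesis using assms by (auto simp: Q0_def)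
qed

section \<open>Lines over the coefficient field\<close>

definition line_iso :: "(lam, 'v) module \<Rightarrow> (lam \<Rightarrow> 'v) \<Rightarrow> bool" where
  "line_iso M \<phi> \<longleftrightarrow> bij_betw \<phi> UNIV (carrier M) \<and> \<phi> 0 = \<zero>\<^bsub>M\<^esub> \<and>
     (\<forall>x y. \<phi> (x + y) = \<phi> x \<oplus>\<^bsub>M\<^esub> \<phi> y) \<and> (\<forall>c x. \<phi> (c * x) = c \<odot>\<^bsub>M\<^esub> \<phi> x)"

text \<open>
  Recording that zero absorbs both operations makes the module laws a consequence.
\<close>

definition null_space :: "(lam, 'v) module \<Rightarrow> bool" where
  "null_space M \<longleftrightarrow> carrier M = {\<zero>\<^bsub>M\<^esub>} \<and> \<zero>\<^bsub>M\<^esub> \<oplus>\<^bsub>M\<^esub> \<zero>\<^bsub>M\<^esub> = \<zero>\<^bsub>M\<^esub> \<and> (\<forall>c. c \<odot>\<^bsub>M\<^esub> \<zero>\<^bsub>M\<^esub> = \<zero>\<^bsub>M\<^esub>)"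

lemma Lam_simps [simp]:
  "carrier Lam = UNIV" "x \<oplus>\<^bsub>Lam\<^esub> y = x + y" "x \<otimes>\<^bsub>Lam\<^esub> y = x * y" "\<one>\<^bsub>Lam\<^esub> = 1" "\<zero>\<^bsub>Lam\<^esub> = 0"
  by (simp_all add: ring_of_type_algebra_def)

lemma cring_Lam: "cring Lam"
  by (rule cring_from_type_algebra)

text \<open>
  The module laws are inherited from \<open>\<Lambda>\<close> along a surjection that respects the operations. This covers
  the lines on the orbit and, with a constant map, the zero spaces off the orbit.
\<close>

lemma module_quotient_of_Lam:
  assumes carrier: "carrier M = range \<phi>" and zero: "\<zero>\<^bsub>M\<^esub> = \<phi> 0"
    and add: "\<And>x y. \<phi> x \<oplus>\<^bsub>M\<^esub> \<phi> y = \<phi> (x + y)" and smult: "\<And>c x. c \<odot>\<^bsub>M\<^esub> \<phi> x = \<phi> (c * x)"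
  shows "module Lam M"
proof (rule moduleI[OF cring_Lam])
  show "abelian_group M"
  proof (rule abelian_groupI)
    show "\<exists>y\<in>carrier M. y \<oplus>\<^bsub>M\<^esub> x = \<zero>\<^bsub>M\<^esub>" if "x \<in> carrier M" for x
    proof -
      obtain a where "x = \<phi> a" using \<open>x \<in> carrier M\<close> carrier by auto
      then have "\<phi> (- a) \<in> carrier M" "\<phi> (- a) \<oplus>\<^bsub>M\<^esub> x = \<zero>\<^bsub>M\<^esub>" using carrier by (simp_all add: add zero)
      then show ?thesis by blast
    qed
  qed (auto simp: carrier zero add ac_simps)
qed (auto simp: carrier add smult algebra_simps)

lemma line_iso_module: "line_iso M \<phi> \<Longrightarrow> module Lam M"
  by (rule module_quotient_of_Lam[of M \<phi>]) (auto simp: line_iso_def bij_betw_def)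

lemma null_space_module: "null_space M \<Longrightarrow> module Lam M"
  by (rule module_quotient_of_Lam[of M "\<lambda>_. \<zero>\<^bsub>M\<^esub>"]) (auto simp: null_space_def)

lemma line_iso_one_dimensional:
  assumes "line_iso M \<phi>"
  shows "one_dimensional M"
proof -
  have \<phi>: "bij_betw \<phi> UNIV (carrier M)" "\<And>c. c \<odot>\<^bsub>M\<^esub> \<phi> 1 = \<phi> c"
    using assms unfolding line_iso_def by (auto, metis mult.right_neutral)
  then have "\<exists>!c. v = c \<odot>\<^bsub>M\<^esub> \<phi> 1" if "v \<in> carrier M" for v
    using that unfolding bij_betw_def inj_on_def by auto
  moreover have "\<phi> 1 \<in> carrier M" using \<phi>(1) by (auto simp: bij_betw_def)
  ultimately show ?thesis unfolding one_dimensional_def by blast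
qed

lemma line_iso_lin_maps:
  assumes "line_iso M \<phi>" "line_iso N \<psi>" and h: "\<And>x. h (\<phi> x) = \<psi> (a * x)"
  shows "h \<in> lin_maps M N"
proof -
  have M: "carrier M = range \<phi>" "\<And>x y. \<phi> x \<oplus>\<^bsub>M\<^esub> \<phi> y = \<phi> (x + y)" "\<And>c x. c \<odot>\<^bsub>M\<^esub> \<phi> x = \<phi> (c * x)"
    and N: "carrier N = range \<psi>" "\<And>x y. \<psi> x \<oplus>\<^bsub>N\<^esub> \<psi> y = \<psi> (x + y)" "\<And>c x. c \<odot>\<^bsub>N\<^esub> \<psi> x = \<psi> (c * x)"
    using assms(1,2) by (auto simp: line_iso_def bij_betw_def)
  show ?thesis unfolding lin_maps_def
    by (auto simp: M N h algebra_simps)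
qed

lemma null_space_lin_maps:
  assumes "null_space M" "null_space N" "h \<zero>\<^bsub>M\<^esub> = \<zero>\<^bsub>N\<^esub>"
  shows "h \<in> lin_maps M N"
  using assms by (auto simp: null_space_def lin_maps_def)

lemma line_iso_bij_betw:
  assumes "line_iso M \<phi>" "line_iso N \<psi>" "a \<noteq> 0" and h: "\<And>x. h (\<phi> x) = \<psi> (a * x)"
  shows "bij_betw h (carrier M) (carrier N)"
proof -
  have M: "carrier M = range \<phi>" and N: "carrier N = range \<psi>" "\<And>x y. \<psi> x = \<psi> y \<Longrightarrow> x = y"
    using assms(1,2) by (auto simp: line_iso_def bij_betw_def inj_def)
  have "inj_on h (carrier M)"
  proof (rule inj_onI)
    fix v w assume "v \<in> carrier M" "w \<in> carrier M" "h v = h w"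
    then obtain x y where "v = \<phi> x" "w = \<phi> y" "\<psi> (a * x) = \<psi> (a * y)" using M h by auto
    then show "v = w" using N(2) assms(3) by fastforce
  qed
  moreover have "h ` carrier M = carrier N"
  proof -
    have "\<psi> y = h (\<phi> (inverse a * y))" for y using h assms(3) by (simp add: mult.assoc[symmetric])
    then have "range \<psi> \<subseteq> h ` range \<phi>" by blast
    then show ?thesis unfolding M N(1) using h by auto
  qed
  ultimately show ?thesis by (simp add: bij_betw_def)
qed

section \<open>Left translation of cosets\<close>

lemma S_sp_iff: "s \<in> S_sp D \<longleftrightarrow> (\<exists>g\<in>carrier H_grp. s = g <#\<^bsub>H_grp\<^esub> D)"
  by (auto simp: LCOSETS_def)

lemma S_sp_translate:
  assumes "subgroup D H_grp" "b \<in> carrier H_grp" "s \<in> S_sp D"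
  shows "b <#\<^bsub>H_grp\<^esub> s \<in> S_sp D"
proof -
  obtain g where g: "g \<in> carrier H_grp" "s = g <#\<^bsub>H_grp\<^esub> D" using assms(3) S_sp_iff by blast
  then have "b <#\<^bsub>H_grp\<^esub> s = (b \<otimes>\<^bsub>H_grp\<^esub> g) <#\<^bsub>H_grp\<^esub> D"
    using H.lcos_m_assoc subgroup.subset[OF assms(1)] assms(2) by simp
  then show ?thesis using g assms(2) by (auto simp: S_sp_iff)
qed

lemma translate_translate:
  assumes "subgroup D H_grp" "a \<in> carrier H_grp" "b \<in> carrier H_grp" "s \<in> S_sp D"
  shows "a <#\<^bsub>H_grp\<^esub> (b <#\<^bsub>H_grp\<^esub> s) = (a \<otimes>\<^bsub>H_grp\<^esub> b) <#\<^bsub>H_grp\<^esub> s"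
  using assms(2-4) subgroup.lcosets_carrier[OF assms(1) H_grp_group]
  by (intro H.lcos_m_assoc) auto

lemma one_translate:
  assumes "subgroup D H_grp" "s \<in> S_sp D"
  shows "\<one>\<^bsub>H_grp\<^esub> <#\<^bsub>H_grp\<^esub> s = s"
  using assms(2) subgroup.lcosets_carrier[OF assms(1) H_grp_group] by (intro H.lcos_mult_one) auto

lemma translate_orbit_point:
  assumes "subgroup D H_grp" "b0 \<in> B_H" "b \<in> B_H" "k \<in> H0"
  shows "b0 <#\<^bsub>H_grp\<^esub> ((b \<otimes>\<^bsub>H_grp\<^esub> k) <#\<^bsub>H_grp\<^esub> D) = (b0 \<otimes>\<^bsub>H_grp\<^esub> b \<otimes>\<^bsub>H_grp\<^esub> k) <#\<^bsub>H_grp\<^esub> D"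
  using assms by (simp add: H.lcos_m_assoc[OF subgroup.subset] H.m_assoc)

lemma O_sp_point [intro]: "b \<in> B_H \<Longrightarrow> k \<in> H0 \<Longrightarrow> (b \<otimes>\<^bsub>H_grp\<^esub> k) <#\<^bsub>H_grp\<^esub> D \<in> O_sp D"
  unfolding O_sp_def by blast

lemma O_sp_cases:
  assumes "s \<in> O_sp D"
  obtains b k where "b \<in> B_H" "k \<in> H0" "s = (b \<otimes>\<^bsub>H_grp\<^esub> k) <#\<^bsub>H_grp\<^esub> D"
  using assms unfolding O_sp_def by blast

lemma O_sp_subset: "O_sp D \<subseteq> S_sp D"
proof
  fix s assume "s \<in> O_sp D"
  then obtain b k where "b \<in> B_H" "k \<in> H0" "s = (b \<otimes>\<^bsub>H_grp\<^esub> k) <#\<^bsub>H_grp\<^esub> D" by (rule O_sp_cases)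
  moreover from this have "b \<otimes>\<^bsub>H_grp\<^esub> k \<in> carrier H_grp" by simp
  ultimately show "s \<in> S_sp D" unfolding S_sp_iff by blast
qed

lemma S_sp_point: "b \<in> B_H \<Longrightarrow> k \<in> H0 \<Longrightarrow> (b \<otimes>\<^bsub>H_grp\<^esub> k) <#\<^bsub>H_grp\<^esub> D \<in> S_sp D"
  using O_sp_subset by blast

lemma O_sp_translate_iff:
  assumes "subgroup D H_grp" "b \<in> B_H" "s \<in> S_sp D"
  shows "b <#\<^bsub>H_grp\<^esub> s \<in> O_sp D \<longleftrightarrow> s \<in> O_sp D"
proof -
  have *: "b <#\<^bsub>H_grp\<^esub> s \<in> O_sp D" if s: "s \<in> O_sp D" and b: "b \<in> B_H" for b s
  proof -
    obtain b' k where "b' \<in> B_H" "k \<in> H0" "s = (b' \<otimes>\<^bsub>H_grp\<^esub> k) <#\<^bsub>H_grp\<^esub> D"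
      using O_sp_cases[OF s] .
    then show ?thesis using b by (auto simp: translate_orbit_point[OF assms(1)])
  qed
  have "inv\<^bsub>H_grp\<^esub> b <#\<^bsub>H_grp\<^esub> (b <#\<^bsub>H_grp\<^esub> s) = s"
    using assms by (simp add: translate_translate one_translate)
  then show ?thesis using *[of s b] *[of "b <#\<^bsub>H_grp\<^esub> s" "inv\<^bsub>H_grp\<^esub> b"] assms by auto
qed

section \<open>Framed representations\<close>

lemma pull_rep_simps [simp]:
  "fib (pull_rep p V) s = fib V (p s)" "act (pull_rep p V) b s = act V b (p s)"
  by (simp_all add: pull_rep_def)

context multiplier
begin

text \<open>
  A frame f of V over the level D consists of a linear coordinate \<open>f b k\<close> on the fiber at \<open>bkD\<close> for each
  pair (b, k). The second condition says that the coordinates at a point change by the transition factors,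
  and the third that V acts like \<open>c e_b0 \<otimes> (e_b \<otimes> x) \<mapsto> c \<sigma>(b0,b) e_{b0 b} \<otimes> x\<close>. Off the orbit V is zero.
\<close>

definition framed ::
    "('k::{field,finite}, 'n) dbl set \<Rightarrow> (('k, 'n) dbl, 'v) twrep \<Rightarrow>
     (('k, 'n) dbl \<Rightarrow> ('k, 'n) dbl \<Rightarrow> lam \<Rightarrow> 'v) \<Rightarrow> bool" where
  "framed D V f \<longleftrightarrow>
     (\<forall>b\<in>B_H. \<forall>k\<in>H0. line_iso (fib V ((b \<otimes>\<^bsub>H_grp\<^esub> k) <#\<^bsub>H_grp\<^esub> D)) (f b k)) \<and>
     (\<forall>b\<in>B_H. \<forall>k\<in>H0. \<forall>b'\<in>B_H. \<forall>k'\<in>H0.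
        (b \<otimes>\<^bsub>H_grp\<^esub> k) <#\<^bsub>H_grp\<^esub> D = (b' \<otimes>\<^bsub>H_grp\<^esub> k') <#\<^bsub>H_grp\<^esub> D \<longrightarrow>
        (\<forall>x. f b k x = f b' k' (transition b b' * x))) \<and>
     (\<forall>b0\<in>B_H. \<forall>b\<in>B_H. \<forall>k\<in>H0. \<forall>c x.
        act V b0 ((b \<otimes>\<^bsub>H_grp\<^esub> k) <#\<^bsub>H_grp\<^esub> D) c (f b k x) =
        f (b0 \<otimes>\<^bsub>H_grp\<^esub> b) k (c * sigma \<alpha> b0 b * x)) \<and>
     (\<forall>s\<in>S_sp D - O_sp D. null_space (fib V s) \<and>
        (\<forall>b\<in>B_H. \<forall>c. act V b s c \<zero>\<^bsub>fib V s\<^esub> = \<zero>\<^bsub>fib V (b <#\<^bsub>H_grp\<^esub> s)\<^esub>))"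

lemma framed_line:
  assumes "framed D V f" "b \<in> B_H" "k \<in> H0"
  shows "line_iso (fib V ((b \<otimes>\<^bsub>H_grp\<^esub> k) <#\<^bsub>H_grp\<^esub> D)) (f b k)"
  using assms unfolding framed_def by blast

lemma framed_carrier:
  assumes "framed D V f" "b \<in> B_H" "k \<in> H0"
  shows "carrier (fib V ((b \<otimes>\<^bsub>H_grp\<^esub> k) <#\<^bsub>H_grp\<^esub> D)) = range (f b k)"
  using framed_line[OF assms] by (simp add: line_iso_def bij_betw_def)

lemma framed_inj:
  assumes "framed D V f" "b \<in> B_H" "k \<in> H0" "f b k x = f b k y"
  shows "x = y"
  using framed_line[OF assms(1-3)] assms(4) by (auto simp: line_iso_def bij_betw_def inj_def)

lemma framed_transition:
  assumes "framed D V f" "b \<in> B_H" "k \<in> H0" "b' \<in> B_H" "k' \<in> H0"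
    "(b \<otimes>\<^bsub>H_grp\<^esub> k) <#\<^bsub>H_grp\<^esub> D = (b' \<otimes>\<^bsub>H_grp\<^esub> k') <#\<^bsub>H_grp\<^esub> D"
  shows "f b k x = f b' k' (transition b b' * x)"
  using assms unfolding framed_def by blast

lemma framed_act:
  assumes "framed D V f" "b0 \<in> B_H" "b \<in> B_H" "k \<in> H0"
  shows "act V b0 ((b \<otimes>\<^bsub>H_grp\<^esub> k) <#\<^bsub>H_grp\<^esub> D) c (f b k x) = f (b0 \<otimes>\<^bsub>H_grp\<^esub> b) k (c * sigma \<alpha> b0 b * x)"
  using assms unfolding framed_def by blast

lemma framed_null:
  assumes "framed D V f" "s \<in> S_sp D" "s \<notin> O_sp D"
  shows "null_space (fib V s)"
    "b \<in> B_H \<Longrightarrow> act V b s c \<zero>\<^bsub>fib V s\<^esub> = \<zero>\<^bsub>fib V (b <#\<^bsub>H_grp\<^esub> s)\<^esub>"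
    "carrier (fib V s) = {\<zero>\<^bsub>fib V s\<^esub>}"
  using assms unfolding framed_def null_space_def by blast+

lemma framed_cases:
  assumes "framed D V f" "s \<in> S_sp D" "v \<in> carrier (fib V s)"
  obtains (orbit) b k x where "b \<in> B_H" "k \<in> H0" "s = (b \<otimes>\<^bsub>H_grp\<^esub> k) <#\<^bsub>H_grp\<^esub> D" "v = f b k x"
  | (off) "s \<notin> O_sp D" "v = \<zero>\<^bsub>fib V s\<^esub>"
proof (cases "s \<in> O_sp D")
  case True
  then obtain b k where b: "b \<in> B_H" "k \<in> H0" "s = (b \<otimes>\<^bsub>H_grp\<^esub> k) <#\<^bsub>H_grp\<^esub> D"
    by (rule O_sp_cases)
  then obtain x where "v = f b k x" using framed_carrier[OF assms(1) b(1,2)] assms(3) by auto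
  then show thesis using orbit b by blast
next
  case False
  then show thesis using off framed_null(3)[OF assms(1,2)] assms(3) by auto
qed

lemma framed_module:
  assumes "framed D V f" "s \<in> S_sp D"
  shows "module Lam (fib V s)"
proof (cases "s \<in> O_sp D")
  case True
  then obtain b k where "b \<in> B_H" "k \<in> H0" "s = (b \<otimes>\<^bsub>H_grp\<^esub> k) <#\<^bsub>H_grp\<^esub> D" by (rule O_sp_cases)
  then show ?thesis using line_iso_module[OF framed_line[OF assms(1)]] by blast
next
  case False
  then show ?thesis using framed_null(1)[OF assms] null_space_module by blast
qed

lemma framed_act_lin:
  assumes D: "subgroup D H_grp" and V: "framed D V f" and b: "b \<in> B_H" and s: "s \<in> S_sp D"
  shows "act V b s c \<in> lin_maps (fib V s) (fib V (b <#\<^bsub>H_grp\<^esub> s))"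
    and "bij_betw (act V b s 1) (carrier (fib V s)) (carrier (fib V (b <#\<^bsub>H_grp\<^esub> s)))"
proof -
  consider (on) b' k where "b' \<in> B_H" "k \<in> H0" "s = (b' \<otimes>\<^bsub>H_grp\<^esub> k) <#\<^bsub>H_grp\<^esub> D" | (off) "s \<notin> O_sp D"
    using O_sp_cases by blast
  then have "act V b s c \<in> lin_maps (fib V s) (fib V (b <#\<^bsub>H_grp\<^esub> s)) \<and>
      bij_betw (act V b s 1) (carrier (fib V s)) (carrier (fib V (b <#\<^bsub>H_grp\<^esub> s)))"
  proof cases
    case on
    have bs: "b <#\<^bsub>H_grp\<^esub> s = (b \<otimes>\<^bsub>H_grp\<^esub> b' \<otimes>\<^bsub>H_grp\<^esub> k) <#\<^bsub>H_grp\<^esub> D"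
      using translate_orbit_point[OF D b on(1,2)] on(3) by simp
    have M: "line_iso (fib V s) (f b' k)" using framed_line[OF V on(1,2)] on(3) by simp
    have N: "line_iso (fib V (b <#\<^bsub>H_grp\<^esub> s)) (f (b \<otimes>\<^bsub>H_grp\<^esub> b') k)"
      unfolding bs using framed_line[OF V] b on by auto
    have h: "act V b s c (f b' k x) = f (b \<otimes>\<^bsub>H_grp\<^esub> b') k (c * sigma \<alpha> b b' * x)" for c x
      using framed_act[OF V b on(1,2)] on(3) by simp
    show ?thesis
      using line_iso_lin_maps[OF M N h] line_iso_bij_betw[OF M N _ h[of 1]] by (simp add: sigma_nonzero)
  next
    case off
    then have "b <#\<^bsub>H_grp\<^esub> s \<notin> O_sp D" "b <#\<^bsub>H_grp\<^esub> s \<in> S_sp D"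
      using O_sp_translate_iff[OF D b s] S_sp_translate[OF D _ s] b by auto
    then have bs: "null_space (fib V (b <#\<^bsub>H_grp\<^esub> s))"
        "carrier (fib V (b <#\<^bsub>H_grp\<^esub> s)) = {\<zero>\<^bsub>fib V (b <#\<^bsub>H_grp\<^esub> s)\<^esub>}"
      using framed_null(1,3)[OF V] by auto
    have zero: "act V b s c \<zero>\<^bsub>fib V s\<^esub> = \<zero>\<^bsub>fib V (b <#\<^bsub>H_grp\<^esub> s)\<^esub>" for c
      by (rule framed_null(2)[OF V s off b])
    have "act V b s c \<in> lin_maps (fib V s) (fib V (b <#\<^bsub>H_grp\<^esub> s))"
      by (intro null_space_lin_maps framed_null(1)[OF V s off] bs(1) zero)
    then show ?thesis
      by (simp add: bij_betw_def framed_null(3)[OF V s off] bs(2) zero)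
  qed
  then show "act V b s c \<in> lin_maps (fib V s) (fib V (b <#\<^bsub>H_grp\<^esub> s))"
    "bij_betw (act V b s 1) (carrier (fib V s)) (carrier (fib V (b <#\<^bsub>H_grp\<^esub> s)))" by auto
qed

text \<open>
  In coordinates the associativity of the structure maps is the cocycle identity for \<open>\<sigma>\<close>, and their
  bijectivity is \<open>\<sigma> \<noteq> 0\<close>.
\<close>

lemma framed_twisted_rep:
  fixes D :: "('k::{field,finite}, 'n) dbl set"
  assumes D: "subgroup D H_grp" and V: "framed D V f"
  shows "twisted_rep \<alpha> D V"
proof -
  have linear: "act V b s (c + c') v = act V b s c v \<oplus>\<^bsub>fib V (b <#\<^bsub>H_grp\<^esub> s)\<^esub> act V b s c' v \<and>
      act V b s (c * c') v = c \<odot>\<^bsub>fib V (b <#\<^bsub>H_grp\<^esub> s)\<^esub> act V b s c' v"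
    if b: "b \<in> B_H" and s: "s \<in> S_sp D" and v: "v \<in> carrier (fib V s)" for b s c c' v
    using V s v
  proof (cases rule: framed_cases)
    case (orbit b' k x)
    have "line_iso (fib V (b <#\<^bsub>H_grp\<^esub> s)) (f (b \<otimes>\<^bsub>H_grp\<^esub> b') k)"
      unfolding orbit(3) translate_orbit_point[OF D b orbit(1,2)]
      using framed_line[OF V] b orbit by auto
    then have N: "\<And>x y. f (b \<otimes>\<^bsub>H_grp\<^esub> b') k x \<oplus>\<^bsub>fib V (b <#\<^bsub>H_grp\<^esub> s)\<^esub> f (b \<otimes>\<^bsub>H_grp\<^esub> b') k y = f (b \<otimes>\<^bsub>H_grp\<^esub> b') k (x + y)"
      "\<And>c x. c \<odot>\<^bsub>fib V (b <#\<^bsub>H_grp\<^esub> s)\<^esub> f (b \<otimes>\<^bsub>H_grp\<^esub> b') k x = f (b \<otimes>\<^bsub>H_grp\<^esub> b') k (c * x)"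
      by (simp_all add: line_iso_def)
    have "act V b s c v = f (b \<otimes>\<^bsub>H_grp\<^esub> b') k (c * sigma \<alpha> b b' * x)" for c
      using framed_act[OF V b orbit(1,2)] orbit(3,4) by simp
    then show ?thesis by (simp add: N distrib_right mult.assoc)
  next
    case off
    then have "b <#\<^bsub>H_grp\<^esub> s \<notin> O_sp D" "b <#\<^bsub>H_grp\<^esub> s \<in> S_sp D"
      using O_sp_translate_iff[OF D b s] S_sp_translate[OF D _ s] b by auto
    then show ?thesis
      using framed_null[OF V s off(1)] framed_null(1)[OF V, of "b <#\<^bsub>H_grp\<^esub> s"] b off(2)
      by (simp add: null_space_def)
  qed
  have cocycle: "act V (b \<otimes>\<^bsub>H_grp\<^esub> b') s (line_mult \<alpha> b b' c c') v =
      act V b (b' <#\<^bsub>H_grp\<^esub> s) c (act V b' s c' v)"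
    if b: "b \<in> B_H" "b' \<in> B_H" and s: "s \<in> S_sp D" and v: "v \<in> carrier (fib V s)" for b b' s c c' v
    using V s v
  proof (cases rule: framed_cases)
    case (orbit b1 k x)
    have "act V b (b' <#\<^bsub>H_grp\<^esub> s) c (act V b' s c' v) =
        f (b \<otimes>\<^bsub>H_grp\<^esub> (b' \<otimes>\<^bsub>H_grp\<^esub> b1)) k (c * sigma \<alpha> b (b' \<otimes>\<^bsub>H_grp\<^esub> b1) * (c' * sigma \<alpha> b' b1 * x))"
      using orbit b by (simp add: framed_act[OF V] translate_orbit_point[OF D])
    moreover have "act V (b \<otimes>\<^bsub>H_grp\<^esub> b') s (line_mult \<alpha> b b' c c') v =
        f (b \<otimes>\<^bsub>H_grp\<^esub> b' \<otimes>\<^bsub>H_grp\<^esub> b1) k (c * c' * sigma \<alpha> b b' * sigma \<alpha> (b \<otimes>\<^bsub>H_grp\<^esub> b') b1 * x)"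
      using orbit b by (simp add: framed_act[OF V] line_mult_def)
    ultimately show ?thesis using orbit b by (simp add: sigma_mult H.m_assoc ac_simps)
  next
    case off
    have "b' <#\<^bsub>H_grp\<^esub> s \<notin> O_sp D" "b' <#\<^bsub>H_grp\<^esub> s \<in> S_sp D"
      using O_sp_translate_iff[OF D b(2) s] S_sp_translate[OF D _ s] b off by auto
    then show ?thesis
      using framed_null(2)[OF V s off(1)] framed_null(2)[OF V, of "b' <#\<^bsub>H_grp\<^esub> s"] b off(2)
      by (simp add: translate_translate[OF D _ _ s])
  qed
  have unit: "act V \<one>\<^bsub>H_grp\<^esub> s 1 v = v" if s: "s \<in> S_sp D" and v: "v \<in> carrier (fib V s)" for s v
    using V s v
  proof (cases rule: framed_cases)
    case (orbit b k x)
    then show ?thesis by (simp add: framed_act[OF V] sigma_one)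
  next
    case off
    then show ?thesis using framed_null(2)[OF V s off(1)] by (simp add: one_translate[OF D s])
  qed
  show ?thesis
    unfolding twisted_rep_def
    by (intro conjI ballI allI framed_module[OF V] framed_act_lin[OF D V]
        linear[THEN conjunct1] linear[THEN conjunct2] cocycle unit; assumption)
qed

text \<open>
  The map that carries the coordinates f to the coordinates g. The value does not depend on the chosen
  representative (b, k, x) because both frames change by the same transition factors.
\<close>

definition frame_map where
  "frame_map D V f W g = (\<lambda>s\<in>S_sp D. \<lambda>v\<in>carrier (fib V s).
     if s \<in> O_sp D
     then SOME w. \<exists>b\<in>B_H. \<exists>k\<in>H0. \<exists>x. s = (b \<otimes>\<^bsub>H_grp\<^esub> k) <#\<^bsub>H_grp\<^esub> D \<and> v = f b k x \<and> w = g b k x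
     else \<zero>\<^bsub>fib W s\<^esub>)"

lemma frame_map_point:
  assumes V: "framed D V f" and W: "framed D W g" and bk: "b \<in> B_H" "k \<in> H0"
  shows "frame_map D V f W g ((b \<otimes>\<^bsub>H_grp\<^esub> k) <#\<^bsub>H_grp\<^esub> D) (f b k x) = g b k x"
proof -
  let ?s = "(b \<otimes>\<^bsub>H_grp\<^esub> k) <#\<^bsub>H_grp\<^esub> D"
  have "f b k x \<in> carrier (fib V ?s)" using framed_carrier[OF V bk] by auto
  moreover have "(SOME w. \<exists>b'\<in>B_H. \<exists>k'\<in>H0. \<exists>y. ?s = (b' \<otimes>\<^bsub>H_grp\<^esub> k') <#\<^bsub>H_grp\<^esub> D \<and> f b k x = f b' k' y \<and> w = g b' k' y)
      = g b k x"
  proof (rule some_equality)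
    fix w
    assume "\<exists>b'\<in>B_H. \<exists>k'\<in>H0. \<exists>y. ?s = (b' \<otimes>\<^bsub>H_grp\<^esub> k') <#\<^bsub>H_grp\<^esub> D \<and> f b k x = f b' k' y \<and> w = g b' k' y"
    then obtain b' k' y where *: "b' \<in> B_H" "k' \<in> H0" "?s = (b' \<otimes>\<^bsub>H_grp\<^esub> k') <#\<^bsub>H_grp\<^esub> D" "f b k x = f b' k' y" "w = g b' k' y"
      by blast
    then have "f b' k' y = f b' k' (transition b b' * x)" using framed_transition[OF V bk *(1-3), of x] by simp
    then have "y = transition b b' * x" by (rule framed_inj[OF V *(1,2)])
    then show "w = g b k x" using framed_transition[OF W bk *(1-3), of x] *(5) by simp
  qed (use bk in blast)
  ultimately show ?thesis using S_sp_point[OF bk] O_sp_point[OF bk] by (simp add: frame_map_def)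
qed

lemma frame_map_off:
  assumes "framed D V f" "s \<in> S_sp D" "s \<notin> O_sp D"
  shows "frame_map D V f W g s \<zero>\<^bsub>fib V s\<^esub> = \<zero>\<^bsub>fib W s\<^esub>"
  using framed_null(3)[OF assms] assms by (simp add: frame_map_def)

text \<open>
  The coordinates of a frame exhaust the fibers, so a family of maps is determined by its effect on them.
  All coherence laws below are obtained from this uniqueness.
\<close>

lemma frame_map_eqI:
  assumes V: "framed D V f" and W: "framed D W g"
    and ext: "\<phi> \<in> extensional (S_sp D)" "\<And>s. s \<in> S_sp D \<Longrightarrow> \<phi> s \<in> extensional (carrier (fib V s))"
    and on: "\<And>b k x. b \<in> B_H \<Longrightarrow> k \<in> H0 \<Longrightarrow> \<phi> ((b \<otimes>\<^bsub>H_grp\<^esub> k) <#\<^bsub>H_grp\<^esub> D) (f b k x) = g b k x"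
    and off: "\<And>s. s \<in> S_sp D \<Longrightarrow> s \<notin> O_sp D \<Longrightarrow> \<phi> s \<zero>\<^bsub>fib V s\<^esub> = \<zero>\<^bsub>fib W s\<^esub>"
  shows "\<phi> = frame_map D V f W g"
proof (rule extensionalityI[OF ext(1)])
  show "frame_map D V f W g \<in> extensional (S_sp D)" by (simp add: frame_map_def)
  fix s assume s: "s \<in> S_sp D"
  show "\<phi> s = frame_map D V f W g s"
  proof (rule extensionalityI[OF ext(2)[OF s]])
    show "frame_map D V f W g s \<in> extensional (carrier (fib V s))" using s by (simp add: frame_map_def)
    fix v assume "v \<in> carrier (fib V s)"
    with V s show "\<phi> s v = frame_map D V f W g s v"
      by (cases rule: framed_cases) (simp_all add: on frame_map_point[OF V W] off s frame_map_off[OF V s])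
  qed
qed

lemma frame_map_hom:
  assumes D: "subgroup D H_grp" and V: "framed D V f" and W: "framed D W g"
  shows "frame_map D V f W g \<in> tw_hom D V W"
proof -
  let ?F = "frame_map D V f W g"
  have lin: "?F s \<in> lin_maps (fib V s) (fib W s)" if s: "s \<in> S_sp D" for s
  proof (cases "s \<in> O_sp D")
    case True
    then obtain b k where b: "b \<in> B_H" "k \<in> H0" "s = (b \<otimes>\<^bsub>H_grp\<^esub> k) <#\<^bsub>H_grp\<^esub> D" by (rule O_sp_cases)
    show ?thesis unfolding b(3)
      by (rule line_iso_lin_maps[OF framed_line[OF V b(1,2)] framed_line[OF W b(1,2)], where a = 1])
        (simp add: frame_map_point[OF V W b(1,2)])
  next
    case False
    show ?thesis
      by (intro null_space_lin_maps framed_null(1)[OF V s False] framed_null(1)[OF W s False]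
          frame_map_off[OF V s False])
  qed
  have ext: "?F \<in> extensional (S_sp D)" "\<And>s. s \<in> S_sp D \<Longrightarrow> ?F s \<in> extensional (carrier (fib V s))"
    by (simp_all add: frame_map_def)
  have "?F (b <#\<^bsub>H_grp\<^esub> s) (act V b s c v) = act W b s c (?F s v)"
    if b: "b \<in> B_H" and s: "s \<in> S_sp D" and v: "v \<in> carrier (fib V s)" for b s c v
    using V s v
  proof (cases rule: framed_cases)
    case (orbit b' k x)
    then show ?thesis using b
      by (simp add: translate_orbit_point[OF D] framed_act[OF V] framed_act[OF W] frame_map_point[OF V W])
  next
    case off
    have "b <#\<^bsub>H_grp\<^esub> s \<notin> O_sp D" "b <#\<^bsub>H_grp\<^esub> s \<in> S_sp D"
      using O_sp_translate_iff[OF D b s] S_sp_translate[OF D _ s] b off by auto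
    then show ?thesis using off b s
      by (simp add: framed_null(2)[OF V s] framed_null(2)[OF W s] frame_map_off[OF V])
  qed
  then show ?thesis using lin ext unfolding tw_hom_def PiE_iff by blast
qed

lemma frame_map_id:
  assumes "framed D V f"
  shows "tw_id D V = frame_map D V f V f"
  by (rule frame_map_eqI[OF assms assms])
    (use framed_carrier[OF assms] framed_null(3)[OF assms] in \<open>auto simp: tw_id_def S_sp_point\<close>)

lemma frame_map_comp:
  fixes D :: "('k::{field,finite}, 'n) dbl set"
  assumes V: "framed D V f" and W: "framed D W g" and U: "framed D U h"
  shows "tw_comp D V (frame_map D W g U h) (frame_map D V f W g) = frame_map D V f U h"
proof (rule frame_map_eqI[OF V U])
  show "tw_comp D V (frame_map D W g U h) (frame_map D V f W g) \<in> extensional (S_sp D)"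
    by (simp add: tw_comp_def)
  show "tw_comp D V (frame_map D W g U h) (frame_map D V f W g) s \<in> extensional (carrier (fib V s))"
    if "s \<in> S_sp D" for s using that by (simp add: tw_comp_def compose_def)
  fix b k :: "('k, 'n) dbl" and x assume bk: "b \<in> B_H" "k \<in> H0"
  then have "f b k x \<in> carrier (fib V ((b \<otimes>\<^bsub>H_grp\<^esub> k) <#\<^bsub>H_grp\<^esub> D))" using framed_carrier[OF V bk] by auto
  then show "tw_comp D V (frame_map D W g U h) (frame_map D V f W g) ((b \<otimes>\<^bsub>H_grp\<^esub> k) <#\<^bsub>H_grp\<^esub> D) (f b k x) = h b k x"
    using bk by (simp add: tw_comp_def S_sp_point compose_eq frame_map_point[OF V W] frame_map_point[OF W U])
next
  fix s assume s: "s \<in> S_sp D" "s \<notin> O_sp D"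
  then show "tw_comp D V (frame_map D W g U h) (frame_map D V f W g) s \<zero>\<^bsub>fib V s\<^esub> = \<zero>\<^bsub>fib U s\<^esub>"
    using framed_null(3)[OF V s]
    by (simp add: tw_comp_def compose_eq frame_map_off[OF V s] frame_map_off[OF W s])
qed

lemma frame_map_iso:
  assumes D: "subgroup D H_grp" and V: "framed D V f" and W: "framed D W g"
  shows "frame_map D V f W g \<in> tw_iso D V W"
  unfolding tw_iso_def
  using frame_map_hom[OF D V W] frame_map_hom[OF D W V] frame_map_comp[OF V W V] frame_map_comp[OF W V W]
    frame_map_id[OF V] frame_map_id[OF W] by auto

text \<open>
  The map p is a projection between levels, where r is the identity, or a right translation by h, where
  r multiplies by h.
\<close>

lemma framed_pull:
  fixes D E :: "('k::{field,finite}, 'n) dbl set"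
  assumes V: "framed D V f" and E: "subgroup E H_grp"
    and pt: "\<And>b k. b \<in> B_H \<Longrightarrow> k \<in> H0 \<Longrightarrow> p ((b \<otimes>\<^bsub>H_grp\<^esub> k) <#\<^bsub>H_grp\<^esub> E) = (b \<otimes>\<^bsub>H_grp\<^esub> r k) <#\<^bsub>H_grp\<^esub> D"
    and r: "\<And>k. k \<in> H0 \<Longrightarrow> r k \<in> H0"
    and tr: "\<And>b s. b \<in> B_H \<Longrightarrow> s \<in> S_sp E \<Longrightarrow> p (b <#\<^bsub>H_grp\<^esub> s) = b <#\<^bsub>H_grp\<^esub> p s"
    and off: "\<And>s. s \<in> S_sp E \<Longrightarrow> s \<notin> O_sp E \<Longrightarrow> p s \<in> S_sp D - O_sp D"
  shows "framed E (pull_rep p V) (\<lambda>b k. f b (r k))"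
proof -
  have line: "line_iso (fib (pull_rep p V) ((b \<otimes>\<^bsub>H_grp\<^esub> k) <#\<^bsub>H_grp\<^esub> E)) (f b (r k))"
    if "b \<in> B_H" "k \<in> H0" for b k
    using framed_line[OF V] that r by (simp add: pt)
  have trans: "f b (r k) x = f b' (r k') (transition b b' * x)"
    if "b \<in> B_H" "k \<in> H0" "b' \<in> B_H" "k' \<in> H0"
      "(b \<otimes>\<^bsub>H_grp\<^esub> k) <#\<^bsub>H_grp\<^esub> E = (b' \<otimes>\<^bsub>H_grp\<^esub> k') <#\<^bsub>H_grp\<^esub> E" for b k b' k' x
    using pt[OF that(1,2)] pt[OF that(3,4)] that r by (intro framed_transition[OF V]) auto
  have act: "act (pull_rep p V) b0 ((b \<otimes>\<^bsub>H_grp\<^esub> k) <#\<^bsub>H_grp\<^esub> E) c (f b (r k) x) =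
      f (b0 \<otimes>\<^bsub>H_grp\<^esub> b) (r k) (c * sigma \<alpha> b0 b * x)"
    if "b0 \<in> B_H" "b \<in> B_H" "k \<in> H0" for b0 b k c x
    using that r by (simp add: pt framed_act[OF V])
  have null: "null_space (fib (pull_rep p V) s)"
    "b \<in> B_H \<Longrightarrow> act (pull_rep p V) b s c \<zero>\<^bsub>fib (pull_rep p V) s\<^esub> = \<zero>\<^bsub>fib (pull_rep p V) (b <#\<^bsub>H_grp\<^esub> s)\<^esub>"
    if "s \<in> S_sp E - O_sp E" for s b c
    using framed_null(1,2)[OF V, of "p s"] off[of s] that by (auto simp: tr)
  show ?thesis
    unfolding framed_def
    by (intro conjI ballI allI impI line trans act null; assumption)
qed

lemma frame_map_pull:
  fixes D E :: "('k::{field,finite}, 'n) dbl set"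
  assumes V: "framed D V f" and W: "framed D W g" and V': "framed E V' f" and W': "framed E W' g"
    and pt: "\<And>b k. b \<in> B_H \<Longrightarrow> k \<in> H0 \<Longrightarrow> p ((b \<otimes>\<^bsub>H_grp\<^esub> k) <#\<^bsub>H_grp\<^esub> E) = (b \<otimes>\<^bsub>H_grp\<^esub> k) <#\<^bsub>H_grp\<^esub> D"
    and off: "\<And>s. s \<in> S_sp E \<Longrightarrow> s \<notin> O_sp E \<Longrightarrow> p s \<in> S_sp D - O_sp D"
    and fib: "\<And>s. s \<in> S_sp E \<Longrightarrow> fib V' s = fib V (p s)" "\<And>s. s \<in> S_sp E \<Longrightarrow> fib W' s = fib W (p s)"
    and p: "\<And>s. s \<in> S_sp E \<Longrightarrow> p s \<in> S_sp D"
  shows "pull_mor E p (frame_map D V f W g) = frame_map E V' f W' g"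
proof (rule frame_map_eqI[OF V' W'])
  show "pull_mor E p (frame_map D V f W g) \<in> extensional (S_sp E)" by (simp add: pull_mor_def)
  show "pull_mor E p (frame_map D V f W g) s \<in> extensional (carrier (fib V' s))" if "s \<in> S_sp E" for s
    using that p[OF that] by (simp add: pull_mor_def fib frame_map_def)
  show "pull_mor E p (frame_map D V f W g) ((b \<otimes>\<^bsub>H_grp\<^esub> k) <#\<^bsub>H_grp\<^esub> E) (f b k x) = g b k x"
    if "b \<in> B_H" "k \<in> H0" for b k x
    using that by (simp add: pull_mor_def S_sp_point pt frame_map_point[OF V W])
  show "pull_mor E p (frame_map D V f W g) s \<zero>\<^bsub>fib V' s\<^esub> = \<zero>\<^bsub>fib W' s\<^esub>"
    if "s \<in> S_sp E" "s \<notin> O_sp E" for s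
    using that off[OF that] by (simp add: pull_mor_def fib frame_map_off[OF V])
qed

end

section \<open>Projections and right translations of cosets\<close>

lemma proj_point:
  assumes "subgroup C H_grp" "subgroup D H_grp" "D \<subseteq> C" "g \<in> carrier H_grp"
  shows "proj C (g <#\<^bsub>H_grp\<^esub> D) = g <#\<^bsub>H_grp\<^esub> C"
  unfolding proj_def by (rule H.l_coset_set_mult[OF assms])

lemma proj_in_S_sp:
  assumes "subgroup C H_grp" "subgroup D H_grp" "D \<subseteq> C" "s \<in> S_sp D"
  shows "proj C s \<in> S_sp C"
  using assms(4) proj_point[OF assms(1-3)] by (auto simp: S_sp_iff)

lemma proj_translate:
  assumes "subgroup C H_grp" "subgroup D H_grp" "D \<subseteq> C" "s \<in> S_sp D" "b \<in> carrier H_grp"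
  shows "proj C (b <#\<^bsub>H_grp\<^esub> s) = b <#\<^bsub>H_grp\<^esub> proj C s"
proof -
  obtain g where g: "g \<in> carrier H_grp" "s = g <#\<^bsub>H_grp\<^esub> D" using assms(4) S_sp_iff by blast
  then show ?thesis
    using assms(5) by (simp add: H.lcos_m_assoc[OF subgroup.subset[OF assms(1)]]
        H.lcos_m_assoc[OF subgroup.subset[OF assms(2)]] proj_point[OF assms(1-3)])
qed

lemma proj_proj:
  assumes "subgroup C H_grp" "subgroup D H_grp" "subgroup E H_grp" "D \<subseteq> C" "E \<subseteq> D" "s \<in> S_sp E"
  shows "proj C (proj D s) = proj C s"
proof -
  obtain g where g: "g \<in> carrier H_grp" "s = g <#\<^bsub>H_grp\<^esub> E" using assms(6) S_sp_iff by blast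
  then show ?thesis using assms by (simp add: proj_point)
qed

lemma proj_self:
  assumes "subgroup C H_grp" "s \<in> S_sp C"
  shows "proj C s = s"
proof -
  obtain g where g: "g \<in> carrier H_grp" "s = g <#\<^bsub>H_grp\<^esub> C" using assms(2) S_sp_iff by blast
  then show ?thesis using assms(1) by (simp add: proj_point)
qed

text \<open>
  As C is contained in \<open>H0\<close>, a factor from C can be absorbed into k. Hence the orbit at level D is the
  full preimage of the orbit at level C.
\<close>

lemma proj_off_orbit:
  fixes C D :: "('k::{field,finite}, 'n::{finite,linorder}) dbl set"
  assumes C: "subgroup C H_grp" "C \<subseteq> H0" and D: "subgroup D H_grp" "D \<subseteq> C"
    and s: "s \<in> S_sp D" "s \<notin> O_sp D"
  shows "proj C s \<notin> O_sp C"
proof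
  assume "proj C s \<in> O_sp C"
  then obtain b k where b: "b \<in> B_H" "k \<in> H0" "proj C s = (b \<otimes>\<^bsub>H_grp\<^esub> k) <#\<^bsub>H_grp\<^esub> C" by (rule O_sp_cases)
  obtain g where g: "g \<in> carrier H_grp" "s = g <#\<^bsub>H_grp\<^esub> D" using s(1) S_sp_iff by blast
  have "(b \<otimes>\<^bsub>H_grp\<^esub> k) <#\<^bsub>H_grp\<^esub> C = g <#\<^bsub>H_grp\<^esub> C" using b g proj_point[OF C(1) D] by simp
  then have c: "inv\<^bsub>H_grp\<^esub> (b \<otimes>\<^bsub>H_grp\<^esub> k) \<otimes>\<^bsub>H_grp\<^esub> g \<in> H0"
    using H.l_coset_eq_iff[OF C(1)] b g C(2) by auto
  have "g = b \<otimes>\<^bsub>H_grp\<^esub> (k \<otimes>\<^bsub>H_grp\<^esub> (inv\<^bsub>H_grp\<^esub> (b \<otimes>\<^bsub>H_grp\<^esub> k) \<otimes>\<^bsub>H_grp\<^esub> g))"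
    using b g by (simp add: H.inv_mult_group H.m_assoc H.inv_cancel_left)
  then have "s \<in> O_sp D" using O_sp_point[OF b(1) H0_closed(1)[OF b(2) c], of D] g(2) by simp
  then show False using s(2) by simp
qed

lemma rtrans_point:
  assumes "C \<in> C_H0" "h \<in> H0" "g \<in> carrier H_grp"
  shows "rtrans h (g <#\<^bsub>H_grp\<^esub> C) = (g \<otimes>\<^bsub>H_grp\<^esub> h) <#\<^bsub>H_grp\<^esub> C"
  unfolding rtrans_def
  using C_H0_conj[OF assms(1,2)] C_H0_conj[OF assms(1), of "inv\<^bsub>H_grp\<^esub> h"] assms
  by (intro H.l_coset_r_coset subgroup.subset[OF C_H0_subgroup]) auto

lemma rtrans_in_S_sp:
  assumes "C \<in> C_H0" "h \<in> H0" "s \<in> S_sp C"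
  shows "rtrans h s \<in> S_sp C"
proof -
  obtain g where g: "g \<in> carrier H_grp" "s = g <#\<^bsub>H_grp\<^esub> C" using assms(3) S_sp_iff by blast
  moreover have "g \<otimes>\<^bsub>H_grp\<^esub> h \<in> carrier H_grp" using g assms by simp
  ultimately show ?thesis using rtrans_point[OF assms(1,2)] S_sp_iff by metis
qed

lemma rtrans_translate:
  assumes "C \<in> C_H0" "h \<in> H0" "s \<in> S_sp C" "b \<in> carrier H_grp"
  shows "rtrans h (b <#\<^bsub>H_grp\<^esub> s) = b <#\<^bsub>H_grp\<^esub> rtrans h s"
proof -
  obtain g where g: "g \<in> carrier H_grp" "s = g <#\<^bsub>H_grp\<^esub> C" using assms(3) S_sp_iff by blast
  then show ?thesis
    using assms by (simp add: H.lcos_m_assoc[OF subgroup.subset[OF C_H0_subgroup[OF assms(1)]]]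
        rtrans_point[OF assms(1,2)] H.m_assoc)
qed

lemma rtrans_off_orbit:
  assumes C: "C \<in> C_H0" and h: "h \<in> H0" and s: "s \<in> S_sp C" "s \<notin> O_sp C"
  shows "rtrans h s \<notin> O_sp C"
proof
  assume "rtrans h s \<in> O_sp C"
  then obtain b k where b: "b \<in> B_H" "k \<in> H0" "rtrans h s = (b \<otimes>\<^bsub>H_grp\<^esub> k) <#\<^bsub>H_grp\<^esub> C" by (rule O_sp_cases)
  obtain g where g: "g \<in> carrier H_grp" "s = g <#\<^bsub>H_grp\<^esub> C" using s(1) S_sp_iff by blast
  have "s = rtrans (inv\<^bsub>H_grp\<^esub> h) (rtrans h s)"
    using g h by (simp add: rtrans_point[OF C] H.m_assoc)
  also have "\<dots> = (b \<otimes>\<^bsub>H_grp\<^esub> (k \<otimes>\<^bsub>H_grp\<^esub> inv\<^bsub>H_grp\<^esub> h)) <#\<^bsub>H_grp\<^esub> C"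
    using b h by (simp add: rtrans_point[OF C] H.m_assoc)
  also have "\<dots> \<in> O_sp C" using b h by (intro O_sp_point) auto
  finally show False using s(2) by simp
qed

section \<open>The spherical object\<close>

context multiplier
begin

lemma sph_rel_iff:
  "((b, k, x), (b', k', y)) \<in> sph_rel \<alpha> C s \<longleftrightarrow>
     b \<in> B_H \<and> k \<in> H0 \<and> (b \<otimes>\<^bsub>H_grp\<^esub> k) <#\<^bsub>H_grp\<^esub> C = s \<and>
     b' \<in> B_H \<and> k' \<in> H0 \<and> (b' \<otimes>\<^bsub>H_grp\<^esub> k') <#\<^bsub>H_grp\<^esub> C = s \<and> x = transition b' b * y"
  by (auto simp: sph_rel_def sph_reps_def transition_def)

lemma transition_inverse:
  assumes "C \<in> C_H0" "b \<in> B_H" "b' \<in> B_H" "k \<in> H0" "k' \<in> H0"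
    "(b \<otimes>\<^bsub>H_grp\<^esub> k) <#\<^bsub>H_grp\<^esub> C = (b' \<otimes>\<^bsub>H_grp\<^esub> k') <#\<^bsub>H_grp\<^esub> C"
  shows "x = transition b' b * y \<longleftrightarrow> y = transition b b' * x"
proof -
  note Q = same_coset_Q0[OF C_H0_subgroup[OF assms(1)] C_H0_subset[OF assms(1)]]
  have "transition b b' * transition b' b = 1"
    using transition_cocycle[OF assms(2,3,2) Q[OF assms(2-6)] Q[OF assms(3,2,5,4) assms(6)[symmetric]]]
    by (simp add: transition_self assms(2))
  then have inv: "transition b b' * (transition b' b * z) = z" "transition b' b * (transition b b' * z) = z" for z
    by (simp_all add: mult.assoc[symmetric] mult.commute[of "transition b' b"])
  show ?thesis using inv by auto
qed

lemma transition_trans: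
  assumes "C \<in> C_H0" "b \<in> B_H" "b' \<in> B_H" "b'' \<in> B_H" "k \<in> H0" "k' \<in> H0" "k'' \<in> H0"
    "(b \<otimes>\<^bsub>H_grp\<^esub> k) <#\<^bsub>H_grp\<^esub> C = (b' \<otimes>\<^bsub>H_grp\<^esub> k') <#\<^bsub>H_grp\<^esub> C"
    "(b' \<otimes>\<^bsub>H_grp\<^esub> k') <#\<^bsub>H_grp\<^esub> C = (b'' \<otimes>\<^bsub>H_grp\<^esub> k'') <#\<^bsub>H_grp\<^esub> C"
  shows "transition b' b'' * (transition b b' * x) = transition b b'' * x"
proof -
  note Q = same_coset_Q0[OF C_H0_subgroup[OF assms(1)] C_H0_subset[OF assms(1)]]
  have "transition b b' * transition b' b'' = transition b b''"
    by (rule transition_cocycle[OF assms(2-4) Q[OF assms(2,3,5,6,8)] Q[OF assms(3,4,6,7,9)]])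
  then show ?thesis by (simp add: mult.assoc[symmetric] mult.commute[of "transition b' b''"])
qed

lemma sph_rel_equiv:
  assumes C: "C \<in> C_H0"
  shows "equiv (sph_reps C s) (sph_rel \<alpha> C s)"
proof (rule equivI)
  show "sph_rel \<alpha> C s \<subseteq> sph_reps C s \<times> sph_reps C s"
    by (auto simp: sph_rel_def)
  show "refl_on (sph_reps C s) (sph_rel \<alpha> C s)"
    by (rule refl_onI) (auto simp: sph_reps_def sph_rel_iff transition_self)
  show "sym (sph_rel \<alpha> C s)"
  proof (rule symI)
    fix p q assume pq: "(p, q) \<in> sph_rel \<alpha> C s"
    obtain b k x b' k' y where [simp]: "p = (b, k, x)" "q = (b', k', y)"
      using prod_cases3 by metis
    show "(q, p) \<in> sph_rel \<alpha> C s"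
      using pq transition_inverse[OF C, of b b' k k' x y] by (auto simp only: sph_rel_iff \<open>p = _\<close> \<open>q = _\<close>)
  qed
  show "trans (sph_rel \<alpha> C s)"
  proof (rule transI)
    fix p q r assume pqr: "(p, q) \<in> sph_rel \<alpha> C s" "(q, r) \<in> sph_rel \<alpha> C s"
    obtain b k x b' k' y b'' k'' z where [simp]: "p = (b, k, x)" "q = (b', k', y)" "r = (b'', k'', z)"
      using prod_cases3 by metis
    show "(p, r) \<in> sph_rel \<alpha> C s"
      using pqr transition_trans[OF C, of b'' b' b k'' k' k z] by (simp add: sph_rel_iff)
  qed
qed

text \<open>
  The class of (b, k, x) contains exactly one vector over each pair (b', k') that represents the same
  coset, so classes can be compared and operated on pair by pair.
\<close>

lemma mem_sph_class:
  assumes "C \<in> C_H0" "b \<in> B_H" "k \<in> H0"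
  shows "(b', k', y) \<in> sph_class \<alpha> C b k x \<longleftrightarrow>
    b' \<in> B_H \<and> k' \<in> H0 \<and> (b' \<otimes>\<^bsub>H_grp\<^esub> k') <#\<^bsub>H_grp\<^esub> C = (b \<otimes>\<^bsub>H_grp\<^esub> k) <#\<^bsub>H_grp\<^esub> C \<and> y = transition b b' * x"
  using transition_inverse[OF assms(1,2) _ assms(3), of b' k' x y] assms
  by (auto simp: sph_class_def sph_rel_iff)

text \<open>
  Injectivity: the only vector over (b, k) in the class of (b, k, x) is x itself. Surjectivity: any vector
  over another pair can be moved to (b, k) by the transition factor.
\<close>

lemma sph_class_line:
  assumes C: "C \<in> C_H0" and b: "b \<in> B_H" "k \<in> H0"
  shows "line_iso (fib (sph \<alpha> C) ((b \<otimes>\<^bsub>H_grp\<^esub> k) <#\<^bsub>H_grp\<^esub> C)) (sph_class \<alpha> C b k)"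
proof -
  let ?s = "(b \<otimes>\<^bsub>H_grp\<^esub> k) <#\<^bsub>H_grp\<^esub> C"
  have s: "?s \<in> O_sp C" using b by blast
  note mem = mem_sph_class[OF C b]
  have "inj (sph_class \<alpha> C b k)"
  proof (rule injI)
    fix x y assume "sph_class \<alpha> C b k x = sph_class \<alpha> C b k y"
    then have "(b, k, x) \<in> sph_class \<alpha> C b k y" using mem[of b k x x] b by (simp add: transition_self)
    then show "x = y" using mem b by (simp add: transition_self)
  qed
  moreover have "range (sph_class \<alpha> C b k) = sph_reps C ?s // sph_rel \<alpha> C ?s"
  proof
    show "range (sph_class \<alpha> C b k) \<subseteq> sph_reps C ?s // sph_rel \<alpha> C ?s"
      using b by (auto simp: sph_class_def sph_reps_def intro!: quotientI)
    show "sph_reps C ?s // sph_rel \<alpha> C ?s \<subseteq> range (sph_class \<alpha> C b k)"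
    proof
      fix v assume "v \<in> sph_reps C ?s // sph_rel \<alpha> C ?s"
      then obtain b' k' y where v: "v = sph_rel \<alpha> C ?s `` {(b', k', y)}"
        and b': "b' \<in> B_H" "k' \<in> H0" "(b' \<otimes>\<^bsub>H_grp\<^esub> k') <#\<^bsub>H_grp\<^esub> C = ?s"
        by (auto simp: quotient_def sph_reps_def)
      have "((b, k, transition b' b * y), (b', k', y)) \<in> sph_rel \<alpha> C ?s"
        using b b' by (simp add: sph_rel_iff)
      then have "sph_class \<alpha> C b k (transition b' b * y) = v"
        unfolding v sph_class_def by (rule equiv_class_eq[OF sph_rel_equiv[OF C]])
      then show "v \<in> range (sph_class \<alpha> C b k)" by blast
    qed
  qed
  moreover have "sph_class \<alpha> C b k 0 = \<zero>\<^bsub>fib (sph \<alpha> C) ?s\<^esub>"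
    by (auto simp: set_eq_iff mem sph_def sph_fib_def sph_reps_def)
  moreover have "sph_class \<alpha> C b k (x + y) = sph_class \<alpha> C b k x \<oplus>\<^bsub>fib (sph \<alpha> C) ?s\<^esub> sph_class \<alpha> C b k y" for x y
    by (auto simp: set_eq_iff mem sph_def sph_fib_def distrib_left)
  moreover have "sph_class \<alpha> C b k (c * x) = c \<odot>\<^bsub>fib (sph \<alpha> C) ?s\<^esub> sph_class \<alpha> C b k x" for c x
    by (auto simp: set_eq_iff mem sph_def sph_fib_def ac_simps)
  ultimately show ?thesis
    using s by (simp add: line_iso_def bij_betw_def sph_def sph_fib_def)
qed

lemma sph_class_transition:
  assumes C: "C \<in> C_H0" and b: "b \<in> B_H" "k \<in> H0" "b' \<in> B_H" "k' \<in> H0"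
    and eq: "(b \<otimes>\<^bsub>H_grp\<^esub> k) <#\<^bsub>H_grp\<^esub> C = (b' \<otimes>\<^bsub>H_grp\<^esub> k') <#\<^bsub>H_grp\<^esub> C"
  shows "sph_class \<alpha> C b k x = sph_class \<alpha> C b' k' (transition b b' * x)"
  unfolding sph_class_def eq
  by (rule equiv_class_eq[OF sph_rel_equiv[OF C]])
    (use b eq transition_inverse[OF C b(1,3,2,4) eq, of x "transition b b' * x"] in \<open>simp add: sph_rel_iff\<close>)

lemma mem_sph_act:
  "(b, k, y) \<in> act (sph \<alpha> C) b0 s c v \<longleftrightarrow>
    (\<exists>b' x. b = b0 \<otimes>\<^bsub>H_grp\<^esub> b' \<and> y = line_mult \<alpha> b0 b' c 1 * x \<and> (b', k, x) \<in> v)"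
  by (simp only: sph_def twrep.select_convs mem_Collect_eq prod.inject) blast

lemma sph_class_act:
  fixes C :: "('k::{field,finite}, 'n) dbl set"
  assumes C: "C \<in> C_H0" and b: "b0 \<in> B_H" "b \<in> B_H" "k \<in> H0"
  shows "act (sph \<alpha> C) b0 s c (sph_class \<alpha> C b k x) = sph_class \<alpha> C (b0 \<otimes>\<^bsub>H_grp\<^esub> b) k (c * sigma \<alpha> b0 b * x)"
proof -
  have D: "subgroup C H_grp" by (rule C_H0_subgroup[OF C])
  note mem = mem_sph_class[OF C b(2,3)] mem_sph_class[OF C B_H_closed(1)[OF b(1,2)] b(3)]
  have coef: "c * sigma \<alpha> b0 b' * (transition b b' * x) =
      transition (b0 \<otimes>\<^bsub>H_grp\<^esub> b) (b0 \<otimes>\<^bsub>H_grp\<^esub> b') * (c * sigma \<alpha> b0 b * x)" if "b' \<in> B_H" for b'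
    using transition_left_mult[OF b(1,2) that] by (simp add: ac_simps)
  show ?thesis
  proof (rule Set.set_eqI)
    fix z :: "('k, 'n) dbl \<times> ('k, 'n) dbl \<times> lam"
    obtain b'' k' y where z: "z = (b'', k', y)" by (cases z rule: prod_cases3)
    have "z \<in> act (sph \<alpha> C) b0 s c (sph_class \<alpha> C b k x) \<longleftrightarrow>
      (\<exists>b' w. b'' = b0 \<otimes>\<^bsub>H_grp\<^esub> b' \<and> y = line_mult \<alpha> b0 b' c 1 * w \<and> (b', k', w) \<in> sph_class \<alpha> C b k x)"
      unfolding z by (rule mem_sph_act)
    also have "\<dots> \<longleftrightarrow> (\<exists>b'. b'' = b0 \<otimes>\<^bsub>H_grp\<^esub> b' \<and> b' \<in> B_H \<and> k' \<in> H0 \<and>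
         (b' \<otimes>\<^bsub>H_grp\<^esub> k') <#\<^bsub>H_grp\<^esub> C = (b \<otimes>\<^bsub>H_grp\<^esub> k) <#\<^bsub>H_grp\<^esub> C \<and>
         y = c * sigma \<alpha> b0 b' * (transition b b' * x))"
      unfolding mem line_mult_def mult_1_right by blast
    also have "\<dots> \<longleftrightarrow> b'' \<in> B_H \<and> k' \<in> H0 \<and>
         (b'' \<otimes>\<^bsub>H_grp\<^esub> k') <#\<^bsub>H_grp\<^esub> C = (b0 \<otimes>\<^bsub>H_grp\<^esub> b \<otimes>\<^bsub>H_grp\<^esub> k) <#\<^bsub>H_grp\<^esub> C \<and>
         y = transition (b0 \<otimes>\<^bsub>H_grp\<^esub> b) b'' * (c * sigma \<alpha> b0 b * x)" (is "?L \<longleftrightarrow> ?R")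
    proof
      assume ?L
      then obtain b' where b': "b'' = b0 \<otimes>\<^bsub>H_grp\<^esub> b'" "b' \<in> B_H" "k' \<in> H0"
         "(b' \<otimes>\<^bsub>H_grp\<^esub> k') <#\<^bsub>H_grp\<^esub> C = (b \<otimes>\<^bsub>H_grp\<^esub> k) <#\<^bsub>H_grp\<^esub> C"
         "y = c * sigma \<alpha> b0 b' * (transition b b' * x)" by blast
      show ?R using b' b coef[OF b'(2)]
        by (simp add: translate_orbit_point[OF D, symmetric])
    next
      assume R: ?R
      define b' where "b' = inv\<^bsub>H_grp\<^esub> b0 \<otimes>\<^bsub>H_grp\<^esub> b''"
      have b': "b' \<in> B_H" "b'' = b0 \<otimes>\<^bsub>H_grp\<^esub> b'" using R b by (auto simp: b'_def H.inv_cancel_left)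
      have b0': "inv\<^bsub>H_grp\<^esub> b0 \<in> B_H" using b by simp
      have "(b' \<otimes>\<^bsub>H_grp\<^esub> k') <#\<^bsub>H_grp\<^esub> C = inv\<^bsub>H_grp\<^esub> b0 <#\<^bsub>H_grp\<^esub> ((b'' \<otimes>\<^bsub>H_grp\<^esub> k') <#\<^bsub>H_grp\<^esub> C)"
        unfolding b'_def using translate_orbit_point[OF D b0'] R by metis
      also have "\<dots> = inv\<^bsub>H_grp\<^esub> b0 <#\<^bsub>H_grp\<^esub> ((b0 \<otimes>\<^bsub>H_grp\<^esub> b \<otimes>\<^bsub>H_grp\<^esub> k) <#\<^bsub>H_grp\<^esub> C)"
        using R by simp
      also have "\<dots> = (b \<otimes>\<^bsub>H_grp\<^esub> k) <#\<^bsub>H_grp\<^esub> C"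
        using translate_orbit_point[OF D b0' B_H_closed(1)[OF b(1,2)] b(3)] b by (simp add: H.inv_cancel_left)
      finally have "(b' \<otimes>\<^bsub>H_grp\<^esub> k') <#\<^bsub>H_grp\<^esub> C = (b \<otimes>\<^bsub>H_grp\<^esub> k) <#\<^bsub>H_grp\<^esub> C" .
      moreover have "y = c * sigma \<alpha> b0 b' * (transition b b' * x)"
        using R unfolding coef[OF b'(1)] b'(2) by blast
      ultimately show ?L using R b' by blast
    qed
    also have "\<dots> \<longleftrightarrow> z \<in> sph_class \<alpha> C (b0 \<otimes>\<^bsub>H_grp\<^esub> b) k (c * sigma \<alpha> b0 b * x)"
      by (simp add: z mem)
    finally show "z \<in> act (sph \<alpha> C) b0 s c (sph_class \<alpha> C b k x) \<longleftrightarrow>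
      z \<in> sph_class \<alpha> C (b0 \<otimes>\<^bsub>H_grp\<^esub> b) k (c * sigma \<alpha> b0 b * x)" .
  qed
qed

lemma sph_fib_off:
  assumes "s \<notin> O_sp C"
  shows "carrier (fib (sph \<alpha> C) s) = {{}}" "\<zero>\<^bsub>fib (sph \<alpha> C) s\<^esub> = {}" "null_space (fib (sph \<alpha> C) s)"
proof -
  show *: "carrier (fib (sph \<alpha> C) s) = {{}}" using assms by (simp add: sph_def sph_fib_def)
  have "sph_reps C s = {}" using assms unfolding sph_reps_def O_sp_def by blast
  then show "\<zero>\<^bsub>fib (sph \<alpha> C) s\<^esub> = {}" by (simp add: sph_def sph_fib_def)
  then show "null_space (fib (sph \<alpha> C) s)"
    using * by (simp add: null_space_def) (simp add: sph_def sph_fib_def)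
qed

lemma sph_framed:
  assumes C: "C \<in> C_H0"
  shows "framed C (sph \<alpha> C) (sph_class \<alpha> C)"
proof -
  have "act (sph \<alpha> C) b s c \<zero>\<^bsub>fib (sph \<alpha> C) s\<^esub> = \<zero>\<^bsub>fib (sph \<alpha> C) (b <#\<^bsub>H_grp\<^esub> s)\<^esub>"
    if "b \<in> B_H" "s \<in> S_sp C - O_sp C" for b s c
  proof -
    have "b <#\<^bsub>H_grp\<^esub> s \<notin> O_sp C" using O_sp_translate_iff[OF C_H0_subgroup[OF C]] that by blast
    then show ?thesis using that by (simp add: sph_fib_off) (simp add: sph_def)
  qed
  then show ?thesis
    unfolding framed_def
    by (intro conjI ballI allI impI sph_class_line[OF C] sph_class_transition[OF C] sph_class_act[OF C] sph_fib_off(3))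
      auto
qed

lemma sph_framed_proj:
  fixes C D :: "('k::{field,finite}, 'n) dbl set"
  assumes C: "C \<in> C_H0" and D: "subgroup D H_grp" "D \<subseteq> C"
  shows "framed D (pull_rep (proj C) (sph \<alpha> C)) (sph_class \<alpha> C)"
proof -
  note C' = C_H0_subgroup[OF C]
  show ?thesis
  proof (rule framed_pull[OF sph_framed[OF C] D(1), where r = "\<lambda>k. k"])
    show "proj C ((b \<otimes>\<^bsub>H_grp\<^esub> k) <#\<^bsub>H_grp\<^esub> D) = (b \<otimes>\<^bsub>H_grp\<^esub> k) <#\<^bsub>H_grp\<^esub> C"
      if "b \<in> B_H" "k \<in> H0" for b k using that by (simp add: proj_point[OF C' D])
    show "proj C (b <#\<^bsub>H_grp\<^esub> s) = b <#\<^bsub>H_grp\<^esub> proj C s" if "b \<in> B_H" "s \<in> S_sp D" for b s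
      using that by (simp add: proj_translate[OF C' D])
    show "proj C s \<in> S_sp C - O_sp C" if "s \<in> S_sp D" "s \<notin> O_sp D" for s
      using proj_in_S_sp[OF C' D that(1)] proj_off_orbit[OF C' C_H0_subset[OF C] D that] by blast
  qed
qed

lemma framed_rtrans:
  fixes D :: "('k::{field,finite}, 'n) dbl set"
  assumes D: "D \<in> C_H0" and h: "h \<in> H0" and V: "framed D V f"
  shows "framed D (pull_rep (rtrans h) V) (\<lambda>b k. f b (k \<otimes>\<^bsub>H_grp\<^esub> h))"
proof (rule framed_pull[OF V C_H0_subgroup[OF D]])
  show "rtrans h ((b \<otimes>\<^bsub>H_grp\<^esub> k) <#\<^bsub>H_grp\<^esub> D) = (b \<otimes>\<^bsub>H_grp\<^esub> (k \<otimes>\<^bsub>H_grp\<^esub> h)) <#\<^bsub>H_grp\<^esub> D"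
    if "b \<in> B_H" "k \<in> H0" for b k using that h by (simp add: rtrans_point[OF D h] H.m_assoc)
  show "rtrans h (b <#\<^bsub>H_grp\<^esub> s) = b <#\<^bsub>H_grp\<^esub> rtrans h s" if "b \<in> B_H" "s \<in> S_sp D" for b s
    using that by (simp add: rtrans_translate[OF D h])
  show "rtrans h s \<in> S_sp D - O_sp D" if "s \<in> S_sp D" "s \<notin> O_sp D" for s
    using rtrans_in_S_sp[OF D h that(1)] rtrans_off_orbit[OF D h that] by blast
qed (use h in auto)

end

section \<open>Morphisms at varying levels\<close>

lemma tw_homD:
  assumes "f \<in> tw_hom D V W"
  shows "f \<in> extensional (S_sp D)"
    and "s \<in> S_sp D \<Longrightarrow> f s \<in> lin_maps (fib V s) (fib W s)"
    and "s \<in> S_sp D \<Longrightarrow> f s \<in> extensional (carrier (fib V s))"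
    and "s \<in> S_sp D \<Longrightarrow> v \<in> carrier (fib V s) \<Longrightarrow> f s v \<in> carrier (fib W s)"
    and "b \<in> B_H \<Longrightarrow> s \<in> S_sp D \<Longrightarrow> v \<in> carrier (fib V s) \<Longrightarrow>
      f (b <#\<^bsub>H_grp\<^esub> s) (act V b s c v) = act W b s c (f s v)"
  using assms unfolding tw_hom_def PiE_iff lin_maps_def by blast+

lemma tw_homI:
  assumes "f \<in> extensional (S_sp D)"
    and "\<And>s. s \<in> S_sp D \<Longrightarrow> f s \<in> lin_maps (fib V s) (fib W s)"
    and "\<And>s. s \<in> S_sp D \<Longrightarrow> f s \<in> extensional (carrier (fib V s))"
    and "\<And>b s c v. b \<in> B_H \<Longrightarrow> s \<in> S_sp D \<Longrightarrow> v \<in> carrier (fib V s) \<Longrightarrow>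
      f (b <#\<^bsub>H_grp\<^esub> s) (act V b s c v) = act W b s c (f s v)"
  shows "f \<in> tw_hom D V W"
  using assms unfolding tw_hom_def PiE_iff by blast

lemma lin_maps_compose:
  assumes "f \<in> lin_maps M N" "g \<in> lin_maps N L"
    and M: "module Lam M"
  shows "compose (carrier M) g f \<in> lin_maps M L"
proof -
  interpret M: module Lam M by (rule M)
  have "x \<oplus>\<^bsub>M\<^esub> y \<in> carrier M" "c \<odot>\<^bsub>M\<^esub> x \<in> carrier M" if "x \<in> carrier M" "y \<in> carrier M" for x y c
    using that M.smult_closed[of c x] by auto
  then show ?thesis using assms(1,2) unfolding lin_maps_def by (auto simp: compose_eq Pi_iff)
qed

lemma tw_comp_apply:
  "s \<in> S_sp D \<Longrightarrow> v \<in> carrier (fib V s) \<Longrightarrow> tw_comp D V g f s v = g s (f s v)"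
  by (simp add: tw_comp_def compose_eq)

lemma tw_comp_extensional [simp]:
  "tw_comp D V g f \<in> extensional (S_sp D)"
  "s \<in> S_sp D \<Longrightarrow> tw_comp D V g f s \<in> extensional (carrier (fib V s))"
  by (simp_all add: tw_comp_def compose_def)

lemma twisted_repD:
  assumes "twisted_rep \<alpha> D V"
  shows "s \<in> S_sp D \<Longrightarrow> module Lam (fib V s)"
    and "b \<in> B_H \<Longrightarrow> s \<in> S_sp D \<Longrightarrow> v \<in> carrier (fib V s) \<Longrightarrow> act V b s c v \<in> carrier (fib V (b <#\<^bsub>H_grp\<^esub> s))"
  using assms unfolding twisted_rep_def lin_maps_def by blast+

lemma tw_comp_hom:
  assumes D: "subgroup D H_grp" and V: "twisted_rep \<alpha> D V" and f: "f \<in> tw_hom D V W" and g: "g \<in> tw_hom D W U"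
  shows "tw_comp D V g f \<in> tw_hom D V U"
proof (rule tw_homI)
  show "tw_comp D V g f s \<in> lin_maps (fib V s) (fib U s)" if "s \<in> S_sp D" for s
    using lin_maps_compose[OF tw_homD(2)[OF f that] tw_homD(2)[OF g that] twisted_repD(1)[OF V that]] that
    by (simp add: tw_comp_def)
  show "tw_comp D V g f (b <#\<^bsub>H_grp\<^esub> s) (act V b s c v) = act U b s c (tw_comp D V g f s v)"
    if "b \<in> B_H" "s \<in> S_sp D" "v \<in> carrier (fib V s)" for b s c v
    using that twisted_repD(2)[OF V that] tw_homD(4)[OF f that(2,3)]
    by (simp add: tw_comp_apply S_sp_translate[OF D] tw_homD(5)[OF f] tw_homD(5)[OF g])
qed simp_all

lemma tw_hom_eqI:
  assumes "f \<in> extensional (S_sp D)" "g \<in> extensional (S_sp D)"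
    and "\<And>s. s \<in> S_sp D \<Longrightarrow> f s \<in> extensional (carrier (fib V s))"
    and "\<And>s. s \<in> S_sp D \<Longrightarrow> g s \<in> extensional (carrier (fib V s))"
    and "\<And>s v. s \<in> S_sp D \<Longrightarrow> v \<in> carrier (fib V s) \<Longrightarrow> f s v = g s v"
  shows "f = g"
proof (rule extensionalityI[OF assms(1,2)])
  show "f s = g s" if s: "s \<in> S_sp D" for s
    by (rule extensionalityI[OF assms(3,4)[OF s] assms(5)[OF s]])
qed

lemma tw_comp_assoc:
  assumes f: "f \<in> tw_hom D V W"
  shows "tw_comp D V h (tw_comp D V g f) = tw_comp D V (tw_comp D W h g) f"
  by (rule tw_hom_eqI[where V = V and D = D]) (simp_all add: tw_comp_apply tw_homD(4)[OF f])

lemma tw_comp_id_left: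
  assumes f: "f \<in> tw_hom D V W"
  shows "tw_comp D V (tw_id D W) f = f"
  by (rule tw_hom_eqI[where V = V and D = D])
    (simp_all add: tw_comp_apply tw_homD[OF f] tw_id_def)

lemma pull_mor_apply: "s \<in> S_sp E \<Longrightarrow> pull_mor E p f s = f (p s)"
  by (simp add: pull_mor_def)

lemma pull_mor_extensional [simp]: "pull_mor E p f \<in> extensional (S_sp E)"
  by (simp add: pull_mor_def)

lemma pull_mor_pull_mor:
  assumes "subgroup C H_grp" "subgroup D H_grp" "subgroup E H_grp" "D \<subseteq> C" "E \<subseteq> D"
  shows "pull_mor E (proj D) (pull_mor D (proj C) f) = pull_mor E (proj C) f"
  using assms by (intro extensionalityI[of _ "S_sp E"])
    (simp_all add: pull_mor_apply proj_in_S_sp proj_proj)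

lemma pull_mor_self:
  assumes "subgroup D H_grp" "f \<in> extensional (S_sp D)"
  shows "pull_mor D (proj D) f = f"
  using assms by (intro extensionalityI[of _ "S_sp D"]) (simp_all add: pull_mor_apply proj_self)

lemma at_level_simps:
  "fib (at_level P) s = fib (snd P) (proj (fst P) s)" "act (at_level P) b s = act (snd P) b (proj (fst P) s)"
  by (simp_all add: at_level_def)

lemma at_level_proj:
  assumes "fst P \<in> C_H" "D \<in> C_H" "E \<in> C_H" "D \<subseteq> fst P" "E \<subseteq> D" "s \<in> S_sp E"
  shows "fib (at_level P) (proj D s) = fib (at_level P) s" "act (at_level P) b (proj D s) = act (at_level P) b s"
  using proj_proj[OF C_H_subgroup[OF assms(1)] C_H_subgroup[OF assms(2)] C_H_subgroup[OF assms(3)] assms(4-6)]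
  by (simp_all add: at_level_simps)

lemma pull_mor_tw_comp:
  assumes P: "fst P \<in> C_H" "D \<in> C_H" "E \<in> C_H" "D \<subseteq> fst P" "E \<subseteq> D"
  shows "pull_mor E (proj D) (tw_comp D (at_level P) g f) =
    tw_comp E (at_level P) (pull_mor E (proj D) g) (pull_mor E (proj D) f)"
proof (rule tw_hom_eqI[where V = "at_level P"])
  have p: "proj D s \<in> S_sp D" if "s \<in> S_sp E" for s
    by (rule proj_in_S_sp[OF C_H_subgroup[OF P(2)] C_H_subgroup[OF P(3)] P(5) that])
  show "pull_mor E (proj D) (tw_comp D (at_level P) g f) s \<in> extensional (carrier (fib (at_level P) s))"
    if "s \<in> S_sp E" for s
    using tw_comp_extensional(2)[OF p[OF that], of "at_level P" g f] that
    by (simp add: pull_mor_apply at_level_proj[OF P])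
  show "pull_mor E (proj D) (tw_comp D (at_level P) g f) s v =
      tw_comp E (at_level P) (pull_mor E (proj D) g) (pull_mor E (proj D) f) s v"
    if "s \<in> S_sp E" "v \<in> carrier (fib (at_level P) s)" for s v
    using that by (simp add: pull_mor_apply tw_comp_apply p at_level_proj[OF P])
qed simp_all

lemma pull_mor_hom:
  assumes P: "fst P \<in> C_H" and R: "fst R \<in> C_H" and D: "D \<in> C_H" "D \<subseteq> fst P \<inter> fst R"
    and E: "E \<in> C_H" "E \<subseteq> D" and f: "f \<in> tw_hom D (at_level P) (at_level R)"
  shows "pull_mor E (proj D) f \<in> tw_hom E (at_level P) (at_level R)"
proof (rule tw_homI)
  note PL = at_level_proj[OF P D(1) E(1) _ E(2)] and RL = at_level_proj[OF R D(1) E(1) _ E(2)]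
  have DP: "D \<subseteq> fst P" "D \<subseteq> fst R" using D(2) by auto
  have p: "proj D s \<in> S_sp D" if "s \<in> S_sp E" for s
    by (rule proj_in_S_sp[OF C_H_subgroup[OF D(1)] C_H_subgroup[OF E(1)] E(2) that])
  show "pull_mor E (proj D) f s \<in> lin_maps (fib (at_level P) s) (fib (at_level R) s)" if "s \<in> S_sp E" for s
    using tw_homD(2)[OF f p[OF that]] that by (simp add: pull_mor_apply PL RL DP)
  show "pull_mor E (proj D) f s \<in> extensional (carrier (fib (at_level P) s))" if "s \<in> S_sp E" for s
    using tw_homD(3)[OF f p[OF that]] that by (simp add: pull_mor_apply PL DP)
  show "pull_mor E (proj D) f (b <#\<^bsub>H_grp\<^esub> s) (act (at_level P) b s c v) =
      act (at_level R) b s c (pull_mor E (proj D) f s v)"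
    if b: "b \<in> B_H" and s: "s \<in> S_sp E" and v: "v \<in> carrier (fib (at_level P) s)" for b s c v
  proof -
    have bs: "b <#\<^bsub>H_grp\<^esub> s \<in> S_sp E" "proj D (b <#\<^bsub>H_grp\<^esub> s) = b <#\<^bsub>H_grp\<^esub> proj D s"
      using S_sp_translate[OF C_H_subgroup[OF E(1)] B_H_carrier[OF b] s]
        proj_translate[OF C_H_subgroup[OF D(1)] C_H_subgroup[OF E(1)] E(2) s B_H_carrier[OF b]] by auto
    show ?thesis
      using tw_homD(5)[OF f b p[OF s], of v c] v s bs by (simp add: pull_mor_apply PL RL DP)
  qed
qed simp

section \<open>Germs of morphisms\<close>

lemma u_germs_iff:
  "(D, f) \<in> u_germs P R \<longleftrightarrow> D \<in> C_H \<and> D \<subseteq> fst P \<inter> fst R \<and> f \<in> tw_hom D (at_level P) (at_level R)"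
  by (simp add: u_germs_def)

lemma u_eq_iff:
  "((D, f), (D', f')) \<in> u_eq P R \<longleftrightarrow> (D, f) \<in> u_germs P R \<and> (D', f') \<in> u_germs P R \<and>
     (\<exists>E\<in>C_H. E \<subseteq> D \<inter> D' \<and> pull_mor E (proj D) f = pull_mor E (proj D') f')"
  by (simp add: u_eq_def)

lemma pull_mor_eq_mono:
  assumes "D \<in> C_H" "D' \<in> C_H" "E \<in> C_H" "E' \<in> C_H" "E \<subseteq> D \<inter> D'" "E' \<subseteq> E"
    and "pull_mor E (proj D) f = pull_mor E (proj D') f'"
  shows "pull_mor E' (proj D) f = pull_mor E' (proj D') f'"
proof -
  have "pull_mor E' (proj D) f = pull_mor E' (proj E) (pull_mor E (proj D) f)"
    using assms by (intro pull_mor_pull_mor[symmetric] C_H_subgroup) auto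
  also have "\<dots> = pull_mor E' (proj E) (pull_mor E (proj D') f')" using assms by simp
  also have "\<dots> = pull_mor E' (proj D') f'"
    using assms by (intro pull_mor_pull_mor C_H_subgroup) auto
  finally show ?thesis .
qed

lemma u_eq_equiv:
  assumes "fst P \<in> C_H" "fst R \<in> C_H"
  shows "equiv (u_germs P R) (u_eq P R)"
proof (rule equivI)
  show "u_eq P R \<subseteq> u_germs P R \<times> u_germs P R" by (auto simp: u_eq_def)
  show "refl_on (u_germs P R) (u_eq P R)"
  proof (rule refl_onI)
    fix p assume "p \<in> u_germs P R"
    then show "(p, p) \<in> u_eq P R" by (cases p) (auto simp: u_eq_iff u_germs_iff)
  qed
  show "sym (u_eq P R)"
  proof (rule symI)
    fix p q assume pq: "(p, q) \<in> u_eq P R"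
    obtain D f where p: "p = (D, f)" by fastforce
    obtain D' f' where q: "q = (D', f')" by fastforce
    obtain E where "E \<in> C_H" "E \<subseteq> D' \<inter> D" "pull_mor E (proj D') f' = pull_mor E (proj D) f"
      using pq unfolding p q u_eq_iff by (metis Int_commute)
    then show "(q, p) \<in> u_eq P R" using pq unfolding p q u_eq_iff by blast
  qed
  show "trans (u_eq P R)"
  proof (rule transI)
    fix p q r assume pq: "(p, q) \<in> u_eq P R" and qr: "(q, r) \<in> u_eq P R"
    obtain D1 f1 where p: "p = (D1, f1)" by fastforce
    obtain D2 f2 where q: "q = (D2, f2)" by fastforce
    obtain D3 f3 where r: "r = (D3, f3)" by fastforce
    obtain E where E: "E \<in> C_H" "E \<subseteq> D1 \<inter> D2" "pull_mor E (proj D1) f1 = pull_mor E (proj D2) f2"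
      using pq unfolding p q u_eq_iff by blast
    obtain E' where E': "E' \<in> C_H" "E' \<subseteq> D2 \<inter> D3" "pull_mor E' (proj D2) f2 = pull_mor E' (proj D3) f3"
      using qr unfolding q r u_eq_iff by blast
    have D: "D1 \<in> C_H" "D2 \<in> C_H" "D3 \<in> C_H"
      using pq qr unfolding p q r u_eq_iff u_germs_iff by blast+
    have EE: "E \<inter> E' \<in> C_H" using E E' C_H_Int by blast
    have "pull_mor (E \<inter> E') (proj D1) f1 = pull_mor (E \<inter> E') (proj D2) f2"
      by (rule pull_mor_eq_mono[OF D(1,2) E(1) EE E(2) _ E(3)]) simp
    also have "\<dots> = pull_mor (E \<inter> E') (proj D3) f3"
      by (rule pull_mor_eq_mono[OF D(2,3) E'(1) EE E'(2) _ E'(3)]) simp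
    finally have "\<exists>E\<in>C_H. E \<subseteq> D1 \<inter> D3 \<and> pull_mor E (proj D1) f1 = pull_mor E (proj D3) f3"
      using EE E(2) E'(2) by blast
    then show "(p, r) \<in> u_eq P R"
      using pq qr unfolding p q r u_eq_iff by blast
  qed
qed

lemma u_eq_pull:
  assumes P: "fst P \<in> C_H" and R: "fst R \<in> C_H" and f: "(D, f) \<in> u_germs P R" and E: "E \<in> C_H" "E \<subseteq> D"
  shows "((D, f), (E, pull_mor E (proj D) f)) \<in> u_eq P R"
proof -
  have D: "D \<in> C_H" "D \<subseteq> fst P \<inter> fst R" "f \<in> tw_hom D (at_level P) (at_level R)"
    using f by (auto simp: u_germs_iff)
  have "(E, pull_mor E (proj D) f) \<in> u_germs P R"
    using pull_mor_hom[OF P R D(1,2) E D(3)] E D(2) by (auto simp: u_germs_iff)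
  moreover have "pull_mor E (proj D) f = pull_mor E (proj E) (pull_mor E (proj D) f)"
    using E by (simp add: pull_mor_self C_H_subgroup)
  ultimately show ?thesis unfolding u_eq_iff using f E by blast
qed

lemma u_class_pull:
  assumes P: "fst P \<in> C_H" and R: "fst R \<in> C_H" and f: "(D, f) \<in> u_germs P R" and E: "E \<in> C_H" "E \<subseteq> D"
  shows "u_eq P R `` {(D, f)} = u_eq P R `` {(E, pull_mor E (proj D) f)}"
  by (rule equiv_class_eq[OF u_eq_equiv[OF P R] u_eq_pull[OF assms]])

lemma twisted_rep_at_level:
  assumes P: "P \<in> u_obj \<alpha>" and D: "D \<in> C_H" "D \<subseteq> fst P"
  shows "twisted_rep \<alpha> D (at_level P)"
proof -
  have C: "subgroup (fst P) H_grp" and D': "subgroup D H_grp"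
    and V: "twisted_rep \<alpha> (fst P) (snd P)"
    using assms by (auto simp: u_obj_def C_H_subgroup)
  have p: "proj (fst P) s \<in> S_sp (fst P)" if "s \<in> S_sp D" for s
    by (rule proj_in_S_sp[OF C D' D(2) that])
  have pb: "proj (fst P) (b <#\<^bsub>H_grp\<^esub> s) = b <#\<^bsub>H_grp\<^esub> proj (fst P) s" if "b \<in> B_H" "s \<in> S_sp D" for b s
    using that by (intro proj_translate[OF C D' D(2)]) auto
  show ?thesis
    unfolding twisted_rep_def at_level_simps
    using V[unfolded twisted_rep_def] by (simp add: p pb cong: ball_cong)
qed

lemma Image_eq_class:
  assumes "x \<in> A" "\<And>z. z \<in> A \<Longrightarrow> r `` {z} = r `` {x}"
  shows "r `` A = r `` {x}"
  using assms by (fastforce simp: Image_def)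

text \<open>
  Composition can be computed with any representatives: two choices for each factor agree over some level,
  and the intersection of these levels is again a level.
\<close>

lemma u_comp_class:
  fixes P R T :: "('k::{field,finite}, 'n::{finite,linorder}, 'v) uobj"
  assumes P: "P \<in> u_obj \<alpha>" and R: "fst R \<in> C_H" and T: "fst T \<in> C_H"
    and f: "(D1, f) \<in> u_germs P R" and g: "(D2, g) \<in> u_germs R T"
    and D: "D \<in> C_H" "D \<subseteq> D1 \<inter> D2"
  shows "u_comp P T (u_eq R T `` {(D2, g)}) (u_eq P R `` {(D1, f)}) =
    u_eq P T `` {(D, tw_comp D (at_level P) (pull_mor D (proj D2) g) (pull_mor D (proj D1) f))}"
proof -
  let ?c = "\<lambda>D D1 f D2 g. tw_comp D (at_level P) (pull_mor D (proj D2) g) (pull_mor D (proj D1) f)"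
  have P': "fst P \<in> C_H" using P by (auto simp: u_obj_def)
  have germ: "(D, ?c D D1 f D2 g) \<in> u_germs P T"
    if f: "(D1, f) \<in> u_germs P R" and g: "(D2, g) \<in> u_germs R T" and D: "D \<in> C_H" "D \<subseteq> D1 \<inter> D2" for D D1 D2 f g
  proof -
    have sub: "D1 \<in> C_H" "D1 \<subseteq> fst P \<inter> fst R" "f \<in> tw_hom D1 (at_level P) (at_level R)"
      "D2 \<in> C_H" "D2 \<subseteq> fst R \<inter> fst T" "g \<in> tw_hom D2 (at_level R) (at_level T)"
      using f g by (auto simp: u_germs_iff)
    have "pull_mor D (proj D1) f \<in> tw_hom D (at_level P) (at_level R)"
      using D by (intro pull_mor_hom[OF P' R sub(1,2) D(1) _ sub(3)]) auto
    moreover have "pull_mor D (proj D2) g \<in> tw_hom D (at_level R) (at_level T)"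
      using D by (intro pull_mor_hom[OF R T sub(4,5) D(1) _ sub(6)]) auto
    moreover have DP: "D \<subseteq> fst P" "D \<subseteq> fst T" using D sub by auto
    ultimately have "?c D D1 f D2 g \<in> tw_hom D (at_level P) (at_level T)"
      by (intro tw_comp_hom[OF C_H_subgroup[OF D(1)] twisted_rep_at_level[OF P D(1) DP(1)]])
    then show ?thesis using D(1) DP by (simp add: u_germs_iff)
  qed
  have rel: "((D, ?c D D1 f D2 g), (D', ?c D' D1' f' D2' g')) \<in> u_eq P T"
    if f': "((D1, f), (D1', f')) \<in> u_eq P R" and g': "((D2, g), (D2', g')) \<in> u_eq R T"
      and D': "D' \<in> C_H" "D' \<subseteq> D1' \<inter> D2'" for D' D1' D2' f' g'
  proof -
    obtain E1 where E1: "E1 \<in> C_H" "E1 \<subseteq> D1 \<inter> D1'" "pull_mor E1 (proj D1) f = pull_mor E1 (proj D1') f'"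
      using f' unfolding u_eq_iff by blast
    obtain E2 where E2: "E2 \<in> C_H" "E2 \<subseteq> D2 \<inter> D2'" "pull_mor E2 (proj D2) g = pull_mor E2 (proj D2') g'"
      using g' unfolding u_eq_iff by blast
    have germs: "(D1', f') \<in> u_germs P R" "(D2', g') \<in> u_germs R T"
      using f' g' unfolding u_eq_iff by blast+
    have lev: "D1 \<in> C_H" "D2 \<in> C_H" "D1' \<in> C_H" "D2' \<in> C_H" "D1 \<subseteq> fst P" "D1' \<subseteq> fst P"
      using f g germs by (auto simp: u_germs_iff)
    define E where "E = E1 \<inter> E2 \<inter> (D \<inter> D')"
    have E: "E \<in> C_H" "E \<subseteq> D" "E \<subseteq> D'" "E \<subseteq> E1" "E \<subseteq> E2"
      unfolding E_def using E1(1) E2(1) D(1) D'(1) by (auto intro!: C_H_Int)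
    have "pull_mor E (proj D) (?c D D1 f D2 g) = ?c E D1 f D2 g"
      using D E(1,2) lev
      by (subst pull_mor_tw_comp) (auto simp: pull_mor_pull_mor C_H_subgroup P')
    also have "\<dots> = ?c E D1' f' D2' g'"
      using pull_mor_eq_mono[OF lev(1,3) E1(1) E(1) E1(2) E(4) E1(3)]
        pull_mor_eq_mono[OF lev(2,4) E2(1) E(1) E2(2) E(5) E2(3)] by simp
    also have "\<dots> = pull_mor E (proj D') (?c D' D1' f' D2' g')"
      using D' E(1,3) lev
      by (subst pull_mor_tw_comp) (auto simp: pull_mor_pull_mor C_H_subgroup P')
    finally show ?thesis
      unfolding u_eq_iff using germ[OF f g D] germ[OF germs D'] E by blast
  qed
  have self: "((D1, f), (D1, f)) \<in> u_eq P R" "((D2, g), (D2, g)) \<in> u_eq R T"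
    using equiv_class_self[OF u_eq_equiv[OF P' R] f] equiv_class_self[OF u_eq_equiv[OF R T] g] by auto
  let ?S = "{(D, ?c D D1' f' D2' g') | D D1' f' D2' g'.
      (D1', f') \<in> u_eq P R `` {(D1, f)} \<and> (D2', g') \<in> u_eq R T `` {(D2, g)} \<and> D \<in> C_H \<and> D \<subseteq> D1' \<inter> D2'}"
  note eq = u_eq_equiv[OF P' T]
  have "(D, ?c D D1 f D2 g) \<in> ?S" using self D by blast
  moreover have "u_eq P T `` {z} = u_eq P T `` {(D, ?c D D1 f D2 g)}" if z: "z \<in> ?S" for z
  proof -
    obtain D' D1' f' D2' g' where "z = (D', ?c D' D1' f' D2' g')"
      "((D1, f), (D1', f')) \<in> u_eq P R" "((D2, g), (D2', g')) \<in> u_eq R T" "D' \<in> C_H" "D' \<subseteq> D1' \<inter> D2'"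
      using z by auto
    then show ?thesis using equiv_class_eq[OF eq rel] by simp
  qed
  ultimately have "u_eq P T `` ?S = u_eq P T `` {(D, ?c D D1 f D2 g)}"
    by (rule Image_eq_class)
  then show ?thesis unfolding u_comp_def .
qed

lemma u_class_in_hom: "p \<in> u_germs P R \<Longrightarrow> u_eq P R `` {p} \<in> u_hom P R"
  unfolding u_hom_def by (rule quotientI)

lemma u_hom_cases:
  assumes "\<phi> \<in> u_hom P R"
  obtains D f where "(D, f) \<in> u_germs P R" "\<phi> = u_eq P R `` {(D, f)}"
  using assms unfolding u_hom_def by (auto elim!: quotientE)

section \<open>Structure maps of the spherical object\<close>

context multiplier
begin

text \<open>
  Right multiplication by h is a bijection between the pairs representing \<open>bkC\<close> and those representing
  \<open>bkhC\<close>, because h normalises C; it does not change b, and so preserves the transition factors.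
\<close>

lemma sph_equiv_class:
  fixes C :: "('k::{field,finite}, 'n) dbl set"
  assumes C: "C \<in> C_H0" and h: "h \<in> H0" and b: "b \<in> B_H" "k \<in> H0"
  shows "sph_equiv \<alpha> C h ((b \<otimes>\<^bsub>H_grp\<^esub> k) <#\<^bsub>H_grp\<^esub> C) (sph_class \<alpha> C b (k \<otimes>\<^bsub>H_grp\<^esub> h) x) = sph_class \<alpha> C b k x"
proof -
  let ?s = "(b \<otimes>\<^bsub>H_grp\<^esub> k) <#\<^bsub>H_grp\<^esub> C"
  have kh: "k \<otimes>\<^bsub>H_grp\<^esub> h \<in> H0" using b h by simp
  have rt: "rtrans h ((b' \<otimes>\<^bsub>H_grp\<^esub> k') <#\<^bsub>H_grp\<^esub> C) = (b' \<otimes>\<^bsub>H_grp\<^esub> (k' \<otimes>\<^bsub>H_grp\<^esub> h)) <#\<^bsub>H_grp\<^esub> C"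
    if "b' \<in> B_H" "k' \<in> H0" "h \<in> H0" for b' k' h
    using that by (simp add: rtrans_point[OF C] H.m_assoc)
  have carrier: "sph_class \<alpha> C b (k \<otimes>\<^bsub>H_grp\<^esub> h) x \<in> carrier (fib (sph \<alpha> C) (rtrans h ?s))"
    unfolding rt[OF b h] using framed_carrier[OF sph_framed[OF C] b(1) kh] by blast
  have eq: "(b' \<otimes>\<^bsub>H_grp\<^esub> (k' \<otimes>\<^bsub>H_grp\<^esub> h)) <#\<^bsub>H_grp\<^esub> C = (b \<otimes>\<^bsub>H_grp\<^esub> (k \<otimes>\<^bsub>H_grp\<^esub> h)) <#\<^bsub>H_grp\<^esub> C \<longleftrightarrow>
      (b' \<otimes>\<^bsub>H_grp\<^esub> k') <#\<^bsub>H_grp\<^esub> C = ?s" if "b' \<in> B_H" "k' \<in> H0" for b' k'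
  proof
    assume "(b' \<otimes>\<^bsub>H_grp\<^esub> (k' \<otimes>\<^bsub>H_grp\<^esub> h)) <#\<^bsub>H_grp\<^esub> C = (b \<otimes>\<^bsub>H_grp\<^esub> (k \<otimes>\<^bsub>H_grp\<^esub> h)) <#\<^bsub>H_grp\<^esub> C"
    then have "rtrans (inv\<^bsub>H_grp\<^esub> h) ((b' \<otimes>\<^bsub>H_grp\<^esub> (k' \<otimes>\<^bsub>H_grp\<^esub> h)) <#\<^bsub>H_grp\<^esub> C) =
        rtrans (inv\<^bsub>H_grp\<^esub> h) ((b \<otimes>\<^bsub>H_grp\<^esub> (k \<otimes>\<^bsub>H_grp\<^esub> h)) <#\<^bsub>H_grp\<^esub> C)" by simp
    then show "(b' \<otimes>\<^bsub>H_grp\<^esub> k') <#\<^bsub>H_grp\<^esub> C = ?s"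
      using rt[of b' "k' \<otimes>\<^bsub>H_grp\<^esub> h" "inv\<^bsub>H_grp\<^esub> h"] rt[of b "k \<otimes>\<^bsub>H_grp\<^esub> h" "inv\<^bsub>H_grp\<^esub> h"] that b h
      by (simp add: H.m_assoc)
  qed (use rt[OF that h] rt[OF b h] in metis)
  have "{(b', k' \<otimes>\<^bsub>H_grp\<^esub> inv\<^bsub>H_grp\<^esub> h, y) | b' k' y. (b', k', y) \<in> sph_class \<alpha> C b (k \<otimes>\<^bsub>H_grp\<^esub> h) x} = sph_class \<alpha> C b k x"
    (is "?L = _")
  proof (rule Set.set_eqI)
    fix z :: "('k, 'n) dbl \<times> ('k, 'n) dbl \<times> lam"
    obtain b' k1 y where z: "z = (b', k1, y)" by (cases z rule: prod_cases3)
    have "z \<in> ?L \<longleftrightarrow> (\<exists>k'. k1 = k' \<otimes>\<^bsub>H_grp\<^esub> inv\<^bsub>H_grp\<^esub> h \<and> (b', k', y) \<in> sph_class \<alpha> C b (k \<otimes>\<^bsub>H_grp\<^esub> h) x)"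
      unfolding z mem_Collect_eq prod.inject by blast
    also have "\<dots> \<longleftrightarrow> z \<in> sph_class \<alpha> C b k x"
    proof
      assume "\<exists>k'. k1 = k' \<otimes>\<^bsub>H_grp\<^esub> inv\<^bsub>H_grp\<^esub> h \<and> (b', k', y) \<in> sph_class \<alpha> C b (k \<otimes>\<^bsub>H_grp\<^esub> h) x"
      then obtain k' where k': "k1 = k' \<otimes>\<^bsub>H_grp\<^esub> inv\<^bsub>H_grp\<^esub> h" "(b', k', y) \<in> sph_class \<alpha> C b (k \<otimes>\<^bsub>H_grp\<^esub> h) x" by blast
      then have m: "b' \<in> B_H" "k' \<in> H0" "(b' \<otimes>\<^bsub>H_grp\<^esub> k') <#\<^bsub>H_grp\<^esub> C = (b \<otimes>\<^bsub>H_grp\<^esub> (k \<otimes>\<^bsub>H_grp\<^esub> h)) <#\<^bsub>H_grp\<^esub> C"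
        "y = transition b b' * x"
        unfolding mem_sph_class[OF C b(1) kh] by blast+
      have "k1 \<in> H0" "k1 \<otimes>\<^bsub>H_grp\<^esub> h = k'" using k'(1) m(2) h by (simp_all add: H.m_assoc)
      then show "z \<in> sph_class \<alpha> C b k x"
        unfolding z mem_sph_class[OF C b] using m eq[OF m(1), of k1] by simp
    next
      assume "z \<in> sph_class \<alpha> C b k x"
      then have m: "b' \<in> B_H" "k1 \<in> H0" "(b' \<otimes>\<^bsub>H_grp\<^esub> k1) <#\<^bsub>H_grp\<^esub> C = ?s" "y = transition b b' * x"
        unfolding z mem_sph_class[OF C b] by blast+
      have "(b', k1 \<otimes>\<^bsub>H_grp\<^esub> h, y) \<in> sph_class \<alpha> C b (k \<otimes>\<^bsub>H_grp\<^esub> h) x"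
        unfolding mem_sph_class[OF C b(1) kh] using m h eq[OF m(1,2)] by simp
      moreover have "k1 = k1 \<otimes>\<^bsub>H_grp\<^esub> h \<otimes>\<^bsub>H_grp\<^esub> inv\<^bsub>H_grp\<^esub> h" using m h by (simp add: H.m_assoc)
      ultimately show "\<exists>k'. k1 = k' \<otimes>\<^bsub>H_grp\<^esub> inv\<^bsub>H_grp\<^esub> h \<and> (b', k', y) \<in> sph_class \<alpha> C b (k \<otimes>\<^bsub>H_grp\<^esub> h) x" by blast
    qed
    finally show "z \<in> ?L \<longleftrightarrow> z \<in> sph_class \<alpha> C b k x" .
  qed
  then show ?thesis using carrier S_sp_point[OF b] by (simp add: sph_equiv_def)
qed

lemma sph_equiv_off:
  assumes "C \<in> C_H0" "h \<in> H0" "s \<in> S_sp C" "s \<notin> O_sp C"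
  shows "sph_equiv \<alpha> C h s {} = {}"
  using assms rtrans_off_orbit[OF assms] by (simp add: sph_equiv_def sph_fib_off)

lemma sph_equiv_eq_frame_map:
  assumes C: "C \<in> C_H0" and h: "h \<in> H0"
  shows "sph_equiv \<alpha> C h =
    frame_map C (pull_rep (rtrans h) (sph \<alpha> C)) (\<lambda>b k. sph_class \<alpha> C b (k \<otimes>\<^bsub>H_grp\<^esub> h)) (sph \<alpha> C) (sph_class \<alpha> C)"
  by (rule frame_map_eqI[OF framed_rtrans[OF C h sph_framed[OF C]] sph_framed[OF C]])
    (simp_all add: sph_equiv_class[OF C h] sph_equiv_off[OF C h] sph_fib_off rtrans_off_orbit[OF C h],
     simp_all add: sph_equiv_def)

text \<open>
  Both sides of the composition law send the coordinate \<open>(b, k h1 h2)\<close> to the coordinate \<open>(b, k)\<close>.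
\<close>

lemma sph_right_equivariant:
  fixes C :: "('k::{field,finite}, 'n) dbl set"
  assumes C: "C \<in> C_H0"
  shows "right_equivariant C (sph \<alpha> C) (sph_equiv \<alpha> C)"
  unfolding right_equivariant_def
proof (intro conjI ballI)
  note D = C_H0_subgroup[OF C] and V = sph_framed[OF C]
  show "sph_equiv \<alpha> C h \<in> tw_iso C (pull_rep (rtrans h) (sph \<alpha> C)) (sph \<alpha> C)" if "h \<in> H0" for h
    unfolding sph_equiv_eq_frame_map[OF C that] by (rule frame_map_iso[OF D framed_rtrans[OF C that V] V])
  fix h1 h2 :: "('k, 'n) dbl" assume h: "h1 \<in> H0" "h2 \<in> H0"
  let ?h = "h1 \<otimes>\<^bsub>H_grp\<^esub> h2"
  let ?U = "pull_rep (rtrans ?h) (sph \<alpha> C)"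
  have hh: "?h \<in> H0" using h by simp
  note U = framed_rtrans[OF C hh V]
  show "sph_equiv \<alpha> C ?h = tw_comp C ?U (sph_equiv \<alpha> C h1) (pull_mor C (rtrans h1) (sph_equiv \<alpha> C h2))"
    unfolding sph_equiv_eq_frame_map[OF C hh]
  proof (rule frame_map_eqI[OF U V, symmetric])
    fix b k :: "('k, 'n) dbl" and x assume b: "b \<in> B_H" "k \<in> H0"
    let ?s = "(b \<otimes>\<^bsub>H_grp\<^esub> k) <#\<^bsub>H_grp\<^esub> C"
    have "sph_class \<alpha> C b (k \<otimes>\<^bsub>H_grp\<^esub> ?h) x \<in> carrier (fib ?U ?s)"
      using framed_carrier[OF U b] by blast
    moreover have "rtrans h1 ?s = (b \<otimes>\<^bsub>H_grp\<^esub> (k \<otimes>\<^bsub>H_grp\<^esub> h1)) <#\<^bsub>H_grp\<^esub> C"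
      using b h by (simp add: rtrans_point[OF C] H.m_assoc)
    moreover have "k \<otimes>\<^bsub>H_grp\<^esub> ?h = (k \<otimes>\<^bsub>H_grp\<^esub> h1) \<otimes>\<^bsub>H_grp\<^esub> h2" using b h by (simp add: H.m_assoc)
    moreover have "k \<otimes>\<^bsub>H_grp\<^esub> h1 \<in> H0" using b h by simp
    ultimately show "tw_comp C ?U (sph_equiv \<alpha> C h1) (pull_mor C (rtrans h1) (sph_equiv \<alpha> C h2)) ?s
        (sph_class \<alpha> C b (k \<otimes>\<^bsub>H_grp\<^esub> ?h) x) = sph_class \<alpha> C b k x"
      using S_sp_point[OF b, of C] sph_equiv_class[OF C h(2) b(1), of "k \<otimes>\<^bsub>H_grp\<^esub> h1" x] sph_equiv_class[OF C h(1) b, of x]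
      by (simp add: tw_comp_apply pull_mor_apply del: pull_rep_simps)
  next
    fix s assume s: "s \<in> S_sp C" "s \<notin> O_sp C"
    have "rtrans ?h s \<notin> O_sp C" "rtrans h1 s \<in> S_sp C" "rtrans h1 s \<notin> O_sp C"
      using rtrans_off_orbit[OF C hh s] rtrans_off_orbit[OF C h(1) s] rtrans_in_S_sp[OF C h(1) s(1)] by auto
    then show "tw_comp C ?U (sph_equiv \<alpha> C h1) (pull_mor C (rtrans h1) (sph_equiv \<alpha> C h2)) s \<zero>\<^bsub>fib ?U s\<^esub>
        = \<zero>\<^bsub>fib (sph \<alpha> C) s\<^esub>"
      using s h by (simp add: tw_comp_apply pull_mor_apply sph_fib_off sph_equiv_off[OF C])
  qed (simp_all del: pull_rep_simps)
qed

text \<open>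
  Pairs that represent the same coset of D also represent the same coset of C, with the same transition
  factors. So restricting a class at level C to the representatives of a coset of D leaves a class at level D.
\<close>

lemma sph_refine_class:
  fixes C D :: "('k::{field,finite}, 'n) dbl set"
  assumes C: "C \<in> C_H0" and D: "D \<in> C_H0" "D \<subseteq> C" and b: "b \<in> B_H" "k \<in> H0"
  shows "sph_refine \<alpha> D C ((b \<otimes>\<^bsub>H_grp\<^esub> k) <#\<^bsub>H_grp\<^esub> D) (sph_class \<alpha> C b k x) = sph_class \<alpha> D b k x"
proof -
  let ?s = "(b \<otimes>\<^bsub>H_grp\<^esub> k) <#\<^bsub>H_grp\<^esub> D"
  have p: "proj C ((b' \<otimes>\<^bsub>H_grp\<^esub> k') <#\<^bsub>H_grp\<^esub> D) = (b' \<otimes>\<^bsub>H_grp\<^esub> k') <#\<^bsub>H_grp\<^esub> C" if "b' \<in> B_H" "k' \<in> H0" for b' k'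
    using that by (intro proj_point[OF C_H0_subgroup[OF C] C_H0_subgroup[OF D(1)] D(2)]) auto
  have "sph_class \<alpha> C b k x \<inter> sph_reps D ?s = sph_class \<alpha> D b k x"
  proof (rule Set.set_eqI)
    fix z :: "('k, 'n) dbl \<times> ('k, 'n) dbl \<times> lam"
    obtain b' k' y where z: "z = (b', k', y)" by (cases z rule: prod_cases3)
    show "z \<in> sph_class \<alpha> C b k x \<inter> sph_reps D ?s \<longleftrightarrow> z \<in> sph_class \<alpha> D b k x"
      using p[OF b] p[of b' k'] by (auto simp: z mem_sph_class[OF C b] mem_sph_class[OF D(1) b] sph_reps_def)
  qed
  moreover have "sph_class \<alpha> C b k x \<in> carrier (fib (sph \<alpha> C) (proj C ?s))"
    unfolding p[OF b] using framed_carrier[OF sph_framed[OF C] b] by blast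
  ultimately show ?thesis using S_sp_point[OF b] by (simp add: sph_refine_def)
qed

lemma sph_refine_off:
  assumes "C \<in> C_H0" "D \<in> C_H0" "D \<subseteq> C" "s \<in> S_sp D" "s \<notin> O_sp D"
  shows "sph_refine \<alpha> D C s {} = {}"
  using proj_off_orbit[OF C_H0_subgroup[OF assms(1)] C_H0_subset[OF assms(1)] C_H0_subgroup[OF assms(2)] assms(3-5)] assms
  by (simp add: sph_refine_def sph_fib_off)

text \<open>
  The target is left open between the spherical object at level D and its pullback along the identity
  projection: the former occurs in the refinement isomorphism, the latter in the u-smooth category.
\<close>

lemma sph_refine_eq_frame_map:
  assumes C: "C \<in> C_H0" and D: "D \<in> C_H0" "D \<subseteq> C"
    and W: "framed D W (sph_class \<alpha> D)" "\<And>s. s \<in> S_sp D \<Longrightarrow> s \<notin> O_sp D \<Longrightarrow> \<zero>\<^bsub>fib W s\<^esub> = {}"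
  shows "sph_refine \<alpha> D C = frame_map D (pull_rep (proj C) (sph \<alpha> C)) (sph_class \<alpha> C) W (sph_class \<alpha> D)"
proof -
  have "proj C s \<notin> O_sp C" if "s \<in> S_sp D" "s \<notin> O_sp D" for s
    using proj_off_orbit[OF C_H0_subgroup[OF C] C_H0_subset[OF C] C_H0_subgroup[OF D(1)] D(2) that] .
  then show ?thesis
    by (intro frame_map_eqI[OF sph_framed_proj[OF C C_H0_subgroup[OF D(1)] D(2)] W(1)])
      (simp_all add: sph_refine_class[OF C D] sph_refine_off[OF C D] sph_fib_off W(2),
       simp_all add: sph_refine_def)
qed

text \<open>
  Both composites carry the coordinate \<open>(b, kh)\<close> at level C to the coordinate (b, k) at level D.
\<close>

lemma sph_refinement_compatible:
  fixes C :: "('k::{field,finite}, 'n) dbl set"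
  assumes C: "C \<in> C_H0" and D: "D \<in> C_H0" "D \<subseteq> C"
  shows "refinement_compatible \<alpha> D C"
  unfolding refinement_compatible_def
proof (intro conjI ballI allI)
  note V = sph_framed_proj[OF C C_H0_subgroup[OF D(1)] D(2)] and W = sph_framed[OF D(1)]
  show "sph_refine \<alpha> D C \<in> tw_iso D (pull_rep (proj C) (sph \<alpha> C)) (sph \<alpha> D)"
    using frame_map_iso[OF C_H0_subgroup[OF D(1)] V W] sph_refine_eq_frame_map[OF C D W] by (simp add: sph_fib_off)
  show "sph_refine \<alpha> D C ((b \<otimes>\<^bsub>H_grp\<^esub> k) <#\<^bsub>H_grp\<^esub> D) (sph_class \<alpha> C b k x) = sph_class \<alpha> D b k x"
    if "b \<in> B_H" "k \<in> H0" for b k x by (rule sph_refine_class[OF C D that])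
  fix h :: "('k, 'n) dbl" assume h: "h \<in> H0"
  let ?U = "pull_rep (rtrans h) (pull_rep (proj C) (sph \<alpha> C))"
  note U = framed_rtrans[OF D(1) h V]
  have pt: "proj C ((b \<otimes>\<^bsub>H_grp\<^esub> k) <#\<^bsub>H_grp\<^esub> D) = (b \<otimes>\<^bsub>H_grp\<^esub> k) <#\<^bsub>H_grp\<^esub> C" if "b \<in> B_H" "k \<in> H0" for b k
    using that by (intro proj_point[OF C_H0_subgroup[OF C] C_H0_subgroup[OF D(1)] D(2)]) auto
  have rt: "rtrans h ((b \<otimes>\<^bsub>H_grp\<^esub> k) <#\<^bsub>H_grp\<^esub> D) = (b \<otimes>\<^bsub>H_grp\<^esub> (k \<otimes>\<^bsub>H_grp\<^esub> h)) <#\<^bsub>H_grp\<^esub> D"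
    if "b \<in> B_H" "k \<in> H0" for b k
    using that h by (simp add: rtrans_point[OF D(1)] H.m_assoc)
  have mem: "sph_class \<alpha> C b (k \<otimes>\<^bsub>H_grp\<^esub> h) x \<in> carrier (fib ?U ((b \<otimes>\<^bsub>H_grp\<^esub> k) <#\<^bsub>H_grp\<^esub> D))"
    if "b \<in> B_H" "k \<in> H0" for b k x
    using framed_carrier[OF U that] by blast
  have off: "rtrans h s \<in> S_sp D" "rtrans h s \<notin> O_sp D" "proj C (rtrans h s) \<notin> O_sp C" "proj C s \<notin> O_sp C" "proj C s \<in> S_sp C"
    if "s \<in> S_sp D" "s \<notin> O_sp D" for s
    using rtrans_in_S_sp[OF D(1) h that(1)] rtrans_off_orbit[OF D(1) h that] that
      proj_off_orbit[OF C_H0_subgroup[OF C] C_H0_subset[OF C] C_H0_subgroup[OF D(1)] D(2)]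
      proj_in_S_sp[OF C_H0_subgroup[OF C] C_H0_subgroup[OF D(1)] D(2) that(1)] by blast+
  have "tw_comp D ?U (sph_refine \<alpha> D C) (pull_mor D (proj C) (sph_equiv \<alpha> C h)) =
      frame_map D ?U (\<lambda>b k. sph_class \<alpha> C b (k \<otimes>\<^bsub>H_grp\<^esub> h)) (sph \<alpha> D) (sph_class \<alpha> D)"
  proof (rule frame_map_eqI[OF U W])
    fix b k :: "('k, 'n) dbl" and x assume b: "b \<in> B_H" "k \<in> H0"
    show "tw_comp D ?U (sph_refine \<alpha> D C) (pull_mor D (proj C) (sph_equiv \<alpha> C h)) ((b \<otimes>\<^bsub>H_grp\<^esub> k) <#\<^bsub>H_grp\<^esub> D)
        (sph_class \<alpha> C b (k \<otimes>\<^bsub>H_grp\<^esub> h) x) = sph_class \<alpha> D b k x"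
      using b mem[OF b] S_sp_point[OF b]
      by (simp add: tw_comp_apply pull_mor_apply pt sph_equiv_class[OF C h] sph_refine_class[OF C D] del: pull_rep_simps)
  next
    fix s assume s: "s \<in> S_sp D" "s \<notin> O_sp D"
    show "tw_comp D ?U (sph_refine \<alpha> D C) (pull_mor D (proj C) (sph_equiv \<alpha> C h)) s \<zero>\<^bsub>fib ?U s\<^esub> = \<zero>\<^bsub>fib (sph \<alpha> D) s\<^esub>"
      using s off[OF s]
      by (simp add: tw_comp_apply pull_mor_apply sph_fib_off sph_equiv_off[OF C h] sph_refine_off[OF C D])
  qed (simp_all del: pull_rep_simps)
  moreover have "tw_comp D ?U (sph_equiv \<alpha> D h) (pull_mor D (rtrans h) (sph_refine \<alpha> D C)) =
      frame_map D ?U (\<lambda>b k. sph_class \<alpha> C b (k \<otimes>\<^bsub>H_grp\<^esub> h)) (sph \<alpha> D) (sph_class \<alpha> D)"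
  proof (rule frame_map_eqI[OF U W])
    fix b k :: "('k, 'n) dbl" and x assume b: "b \<in> B_H" "k \<in> H0"
    show "tw_comp D ?U (sph_equiv \<alpha> D h) (pull_mor D (rtrans h) (sph_refine \<alpha> D C)) ((b \<otimes>\<^bsub>H_grp\<^esub> k) <#\<^bsub>H_grp\<^esub> D)
        (sph_class \<alpha> C b (k \<otimes>\<^bsub>H_grp\<^esub> h) x) = sph_class \<alpha> D b k x"
      using b h mem[OF b] S_sp_point[OF b]
      by (simp add: tw_comp_apply pull_mor_apply rt sph_equiv_class[OF D(1) h] sph_refine_class[OF C D] del: pull_rep_simps)
  next
    fix s assume s: "s \<in> S_sp D" "s \<notin> O_sp D"
    show "tw_comp D ?U (sph_equiv \<alpha> D h) (pull_mor D (rtrans h) (sph_refine \<alpha> D C)) s \<zero>\<^bsub>fib ?U s\<^esub> = \<zero>\<^bsub>fib (sph \<alpha> D) s\<^esub>"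
      using s off[OF s]
      by (simp add: tw_comp_apply pull_mor_apply sph_fib_off sph_equiv_off[OF D(1) h] sph_refine_off[OF C D])
  qed (simp_all del: pull_rep_simps)
  ultimately show "tw_comp D ?U (sph_refine \<alpha> D C) (pull_mor D (proj C) (sph_equiv \<alpha> C h)) =
      tw_comp D ?U (sph_equiv \<alpha> D h) (pull_mor D (rtrans h) (sph_refine \<alpha> D C))" by simp
qed

lemma sph_class_one:
  assumes C: "C \<in> C_H0" and k: "k \<in> H0" "k' \<in> H0" "k <#\<^bsub>H_grp\<^esub> C = k' <#\<^bsub>H_grp\<^esub> C"
  shows "sph_class \<alpha> C \<one>\<^bsub>H_grp\<^esub> k x = sph_class \<alpha> C \<one>\<^bsub>H_grp\<^esub> k' x"
  using sph_class_transition[OF C B_H_closed(3) k(1) B_H_closed(3) k(2), of x] k by (simp add: transition_self)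

text \<open>
  The transition factor from q to 1 is \<open>\<sigma>(q, q\<^sup>-\<^sup>1) = 1\<close>.
\<close>

lemma sph_class_Q0:
  assumes C: "C \<in> C_H0" and q: "q \<in> Q0" and k: "k \<in> H0"
  shows "sph_class \<alpha> C q k x = sph_class \<alpha> C \<one>\<^bsub>H_grp\<^esub> (q \<otimes>\<^bsub>H_grp\<^esub> k) x"
proof -
  have q': "q \<in> B_H" "q \<in> H0" using q by (auto simp: Q0_def)
  have "inv\<^bsub>H_grp\<^esub> q \<in> Q0" using q' by (simp add: Q0_def)
  then have "transition q \<one>\<^bsub>H_grp\<^esub> = 1" using sigma_Q0[OF q] q' by (simp add: transition_def)
  then show ?thesis
    using sph_class_transition[OF C q'(1) k B_H_closed(3), of "q \<otimes>\<^bsub>H_grp\<^esub> k" x] q' k by simp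
qed

lemma sph_is_well_defined:
  fixes C :: "('k::{field,finite}, 'n) dbl set"
  assumes C: "C \<in> C_H0"
  shows "sph_well_defined \<alpha> C"
  unfolding sph_well_defined_def Let_def
proof (intro conjI ballI allI impI)
  show "equiv (sph_reps C s) (sph_rel \<alpha> C s)" for s by (rule sph_rel_equiv[OF C])
  show "twisted_rep \<alpha> C (sph \<alpha> C)" by (rule framed_twisted_rep[OF C_H0_subgroup[OF C] sph_framed[OF C]])
  show "sph_class \<alpha> C \<one>\<^bsub>H_grp\<^esub> k x = sph_class \<alpha> C \<one>\<^bsub>H_grp\<^esub> k' x"
    if "k \<in> H0" "k' \<in> H0" "k <#\<^bsub>H_grp\<^esub> C = k' <#\<^bsub>H_grp\<^esub> C" for k k' x by (rule sph_class_one[OF C that])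
  fix b k :: "('k, 'n) dbl" assume b: "b \<in> B_H" "k \<in> H0"
  note L = sph_class_line[OF C b, unfolded line_iso_def]
  show "bij_betw (sph_class \<alpha> C b k) UNIV (carrier (fib (sph \<alpha> C) ((b \<otimes>\<^bsub>H_grp\<^esub> k) <#\<^bsub>H_grp\<^esub> C)))"
    "sph_class \<alpha> C b k (x + y) = sph_class \<alpha> C b k x \<oplus>\<^bsub>fib (sph \<alpha> C) ((b \<otimes>\<^bsub>H_grp\<^esub> k) <#\<^bsub>H_grp\<^esub> C)\<^esub> sph_class \<alpha> C b k y"
    "sph_class \<alpha> C b k (c * x) = c \<odot>\<^bsub>fib (sph \<alpha> C) ((b \<otimes>\<^bsub>H_grp\<^esub> k) <#\<^bsub>H_grp\<^esub> C)\<^esub> sph_class \<alpha> C b k x" for x y c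
    using L by blast+
next
  fix q k :: "('k, 'n) dbl" and c x assume q: "q \<in> Q0" and k: "k \<in> H0"
  then have "q \<in> B_H" by (simp add: Q0_def)
  then show "act (sph \<alpha> C) q (k <#\<^bsub>H_grp\<^esub> C) c (sph_class \<alpha> C \<one>\<^bsub>H_grp\<^esub> k x) =
      sph_class \<alpha> C \<one>\<^bsub>H_grp\<^esub> (q \<otimes>\<^bsub>H_grp\<^esub> k) (c * x)"
    using k by (simp add: sph_class_act[OF C] sigma_one sph_class_Q0[OF C q])
qed

section \<open>Independence of the level\<close>

text \<open>
  The morphism between the spherical objects at levels C and C' that is the identity in coordinates, over
  a common refinement D; the refinement maps are the special case \<open>C' = D\<close>.
\<close>

definition transfer :: "('k::{field,finite}, 'n) dbl set \<Rightarrow> ('k, 'n) dbl set \<Rightarrow> ('k, 'n) dbl set \<Rightarrow>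
    ('k, 'n) dbl set \<Rightarrow> ('k, 'n) sph_vec \<Rightarrow> ('k, 'n) sph_vec" where
  "transfer C C' D = frame_map D (at_level (sph_obj \<alpha> C)) (sph_class \<alpha> C) (at_level (sph_obj \<alpha> C')) (sph_class \<alpha> C')"

definition transfer_class :: "('k::{field,finite}, 'n) dbl set \<Rightarrow> ('k, 'n) dbl set \<Rightarrow> ('k, 'n, ('k, 'n) sph_vec) umor" where
  "transfer_class C C' = u_eq (sph_obj \<alpha> C) (sph_obj \<alpha> C') `` {(C \<inter> C', transfer C C' (C \<inter> C'))}"

lemma sph_obj_simps [simp]:
  "fst (sph_obj \<alpha> C) = C" "at_level (sph_obj \<alpha> C) = pull_rep (proj C) (sph \<alpha> C)"
  by (simp_all add: sph_obj_def at_level_def)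

lemma C_H0_in_C_H: "C \<in> C_H0 \<Longrightarrow> C \<in> C_H"
  using C_H0_subset_C_H by blast

lemma sph_obj_in_u_obj:
  assumes C: "C \<in> C_H0" shows "sph_obj \<alpha> C \<in> u_obj \<alpha>"
  using C_H0_in_C_H[OF C] framed_twisted_rep[OF C_H0_subgroup[OF C] sph_framed[OF C]]
  by (simp add: u_obj_def sph_obj_def)

lemma sph_framed_at_level:
  assumes "C \<in> C_H0" "D \<in> C_H" "D \<subseteq> C"
  shows "framed D (at_level (sph_obj \<alpha> C)) (sph_class \<alpha> C)"
  using sph_framed_proj[OF assms(1) C_H_subgroup[OF assms(2)] assms(3)] by simp

lemma transfer_germ:
  assumes C: "C \<in> C_H0" "C' \<in> C_H0" and D: "D \<in> C_H" "D \<subseteq> C \<inter> C'"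
  shows "(D, transfer C C' D) \<in> u_germs (sph_obj \<alpha> C) (sph_obj \<alpha> C')"
proof -
  have "transfer C C' D \<in> tw_hom D (at_level (sph_obj \<alpha> C)) (at_level (sph_obj \<alpha> C'))"
    unfolding transfer_def using D
    by (intro frame_map_hom C_H_subgroup sph_framed_at_level C) auto
  then show ?thesis using D by (simp add: u_germs_iff del: sph_obj_simps(2))
qed

lemma transfer_pull:
  assumes C: "C \<in> C_H0" "C' \<in> C_H0" and D: "D \<in> C_H" "D \<subseteq> C \<inter> C'" and E: "E \<in> C_H" "E \<subseteq> D"
  shows "pull_mor E (proj D) (transfer C C' D) = transfer C C' E"
proof -
  have sub: "D \<subseteq> C" "D \<subseteq> C'" "E \<subseteq> C" "E \<subseteq> C'" "D \<subseteq> H0" using D E C_H0_subset[OF C(1)] by auto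
  note G = C_H_subgroup[OF D(1)] C_H_subgroup[OF E(1)]
  note frames = sph_framed_at_level[OF C(1) D(1) sub(1)] sph_framed_at_level[OF C(2) D(1) sub(2)]
    sph_framed_at_level[OF C(1) E(1) sub(3)] sph_framed_at_level[OF C(2) E(1) sub(4)]
  have CH: "fst (sph_obj \<alpha> C) \<in> C_H" "fst (sph_obj \<alpha> C') \<in> C_H" using C by (simp_all add: C_H0_in_C_H)
  show ?thesis unfolding transfer_def
  proof (rule frame_map_pull[OF frames])
    show "proj D ((b \<otimes>\<^bsub>H_grp\<^esub> k) <#\<^bsub>H_grp\<^esub> E) = (b \<otimes>\<^bsub>H_grp\<^esub> k) <#\<^bsub>H_grp\<^esub> D" if "b \<in> B_H" "k \<in> H0" for b k
      using that by (intro proj_point[OF G E(2)]) auto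
    show "proj D s \<in> S_sp D - O_sp D" if "s \<in> S_sp E" "s \<notin> O_sp E" for s
      using proj_in_S_sp[OF G E(2) that(1)] proj_off_orbit[OF G(1) sub(5) G(2) E(2) that] by blast
    show "proj D s \<in> S_sp D" if "s \<in> S_sp E" for s by (rule proj_in_S_sp[OF G E(2) that])
    show "fib (at_level (sph_obj \<alpha> C)) s = fib (at_level (sph_obj \<alpha> C)) (proj D s)" if "s \<in> S_sp E" for s
      using at_level_proj(1)[OF CH(1) D(1) E(1) _ E(2) that] sub by simp
    show "fib (at_level (sph_obj \<alpha> C')) s = fib (at_level (sph_obj \<alpha> C')) (proj D s)" if "s \<in> S_sp E" for s
      using at_level_proj(1)[OF CH(2) D(1) E(1) _ E(2) that] sub by simp
  qed
qed

lemma transfer_comp: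
  assumes C: "C \<in> C_H0" "C' \<in> C_H0" "C'' \<in> C_H0" and D: "D \<in> C_H" "D \<subseteq> C" "D \<subseteq> C'" "D \<subseteq> C''"
  shows "tw_comp D (at_level (sph_obj \<alpha> C)) (transfer C' C'' D) (transfer C C' D) = transfer C C'' D"
  unfolding transfer_def by (intro frame_map_comp sph_framed_at_level C D)

lemma transfer_id:
  assumes C: "C \<in> C_H0" and D: "D \<in> C_H" "D \<subseteq> C"
  shows "transfer C C D = tw_id D (at_level (sph_obj \<alpha> C))"
  unfolding transfer_def by (rule frame_map_id[OF sph_framed_at_level[OF C D], symmetric])

lemma sph_refine_eq_transfer:
  assumes C: "C \<in> C_H0" and D: "D \<in> C_H0" "D \<subseteq> C"
  shows "sph_refine \<alpha> D C = transfer C D D"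
proof -
  have "framed D (pull_rep (proj D) (sph \<alpha> D)) (sph_class \<alpha> D)"
    by (rule sph_framed_proj[OF D(1) C_H0_subgroup[OF D(1)] subset_refl])
  then show ?thesis
    unfolding transfer_def sph_obj_simps
    by (rule sph_refine_eq_frame_map[OF C D]) (simp add: proj_self[OF C_H0_subgroup[OF D(1)]] sph_fib_off)
qed

lemma transfer_class_eq:
  assumes C: "C \<in> C_H0" "C' \<in> C_H0" and D: "D \<in> C_H" "D \<subseteq> C \<inter> C'"
  shows "u_eq (sph_obj \<alpha> C) (sph_obj \<alpha> C') `` {(D, transfer C C' D)} = transfer_class C C'"
proof -
  have CC: "C \<inter> C' \<in> C_H" using C by (intro C_H0_in_C_H C_H0_Int)
  have "transfer_class C C' = u_eq (sph_obj \<alpha> C) (sph_obj \<alpha> C') `` {(D, pull_mor D (proj (C \<inter> C')) (transfer C C' (C \<inter> C')))}"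
    unfolding transfer_class_def using C D
    by (intro u_class_pull transfer_germ CC) (auto simp: C_H0_in_C_H)
  then show ?thesis using transfer_pull[OF C CC _ D] by simp
qed

lemma transfer_class_comp:
  assumes C: "C \<in> C_H0" "C' \<in> C_H0" "C'' \<in> C_H0"
  shows "u_comp (sph_obj \<alpha> C) (sph_obj \<alpha> C'') (transfer_class C' C'') (transfer_class C C') = transfer_class C C''"
proof -
  define D where "D = C \<inter> C' \<inter> C''"
  have D: "D \<in> C_H" using C unfolding D_def by (intro C_H0_in_C_H C_H0_Int)
  have CC: "C \<inter> C' \<in> C_H" "C' \<inter> C'' \<in> C_H" using C by (auto intro!: C_H0_in_C_H C_H0_Int)
  have sub: "D \<subseteq> C \<inter> C'" "D \<subseteq> C' \<inter> C''" "D \<subseteq> C \<inter> C''" "D \<subseteq> C" "D \<subseteq> C'" "D \<subseteq> C''" by (auto simp: D_def)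
  have "u_comp (sph_obj \<alpha> C) (sph_obj \<alpha> C'') (transfer_class C' C'') (transfer_class C C') =
      u_eq (sph_obj \<alpha> C) (sph_obj \<alpha> C'') `` {(D, tw_comp D (at_level (sph_obj \<alpha> C))
        (pull_mor D (proj (C' \<inter> C'')) (transfer C' C'' (C' \<inter> C''))) (pull_mor D (proj (C \<inter> C')) (transfer C C' (C \<inter> C'))))}"
    unfolding transfer_class_def
    using C sub by (intro u_comp_class[OF sph_obj_in_u_obj[OF C(1)]] transfer_germ CC D) (auto simp: C_H0_in_C_H)
  also have "\<dots> = u_eq (sph_obj \<alpha> C) (sph_obj \<alpha> C'') `` {(D, transfer C C'' D)}"
    by (simp only: transfer_pull[OF C(2,3) CC(2) subset_refl D sub(2)] transfer_pull[OF C(1,2) CC(1) subset_refl D sub(1)]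
        transfer_comp[OF C D sub(4-6)])
  also have "\<dots> = transfer_class C C''" by (rule transfer_class_eq[OF C(1,3) D sub(3)])
  finally show ?thesis .
qed

lemma u_id_eq_transfer_class:
  assumes C: "C \<in> C_H0"
  shows "u_id (sph_obj \<alpha> C) = transfer_class C C"
  using transfer_id[OF C C_H0_in_C_H[OF C] subset_refl] by (simp add: u_id_def transfer_class_def del: sph_obj_simps(2))

lemma u_refine_eq_transfer_class:
  assumes C: "C \<in> C_H0" and D: "D \<in> C_H0" "D \<subseteq> C"
  shows "u_refine \<alpha> D C = transfer_class C D"
  unfolding u_refine_def sph_refine_eq_transfer[OF C D]
  using D by (intro transfer_class_eq C D C_H0_in_C_H) auto

lemma transfer_class_in_hom:
  assumes "C \<in> C_H0" "C' \<in> C_H0"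
  shows "transfer_class C C' \<in> u_hom (sph_obj \<alpha> C) (sph_obj \<alpha> C')"
  unfolding transfer_class_def
  using assms by (intro u_class_in_hom transfer_germ C_H0_in_C_H C_H0_Int) auto

text \<open>
  Over a small enough level \<open>E'\<close> the given morphism is represented by a map f' whose composite with the
  transfer from C' to D is the transfer from C to D. Composing with the transfer from D back to C' cancels
  the former and identifies f' with the transfer from C to C'.
\<close>

lemma transfer_class_unique:
  assumes C: "C \<in> C_H0" "C' \<in> C_H0" and D: "D \<in> C_H0" "D \<subseteq> C \<inter> C'"
    and \<kappa>: "\<kappa> \<in> u_hom (sph_obj \<alpha> C) (sph_obj \<alpha> C')"
    and comp: "u_comp (sph_obj \<alpha> C) (sph_obj \<alpha> D) (transfer_class C' D) \<kappa> = transfer_class C D"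
  shows "\<kappa> = transfer_class C C'"
proof -
  let ?P = "sph_obj \<alpha> C" and ?R = "sph_obj \<alpha> C'" and ?T = "sph_obj \<alpha> D"
  have CH: "fst ?P \<in> C_H" "fst ?R \<in> C_H" "fst ?T \<in> C_H" using C D by (simp_all add: C_H0_in_C_H)
  have DH: "D \<in> C_H" by (rule C_H0_in_C_H[OF D(1)])
  obtain D1 f where f: "(D1, f) \<in> u_germs ?P ?R" and \<kappa>eq: "\<kappa> = u_eq ?P ?R `` {(D1, f)}"
    using u_hom_cases[OF \<kappa>] .
  have D1: "D1 \<in> C_H" "D1 \<subseteq> C \<inter> C'" using f by (auto simp: u_germs_iff)
  define E where "E = D1 \<inter> D"
  have E: "E \<in> C_H" "E \<subseteq> D1" "E \<subseteq> D" unfolding E_def using C_H_Int[OF D1(1) DH] by auto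
  have EC: "E \<subseteq> C \<inter> D" using E D by auto
  have g: "(D, transfer C' D D) \<in> u_germs ?R ?T" using D by (intro transfer_germ C D DH) auto
  have "transfer_class C' D = u_eq ?R ?T `` {(D, transfer C' D D)}"
    using D by (intro transfer_class_eq[symmetric] C D DH) auto
  then have "u_comp ?P ?T (transfer_class C' D) \<kappa> =
      u_eq ?P ?T `` {(E, tw_comp E (at_level ?P) (pull_mor E (proj D) (transfer C' D D)) (pull_mor E (proj D1) f))}"
    unfolding \<kappa>eq using u_comp_class[OF sph_obj_in_u_obj[OF C(1)] CH(2,3) f g E(1)] E by simp
  also have "pull_mor E (proj D) (transfer C' D D) = transfer C' D E"
    using D by (intro transfer_pull C D DH E) auto
  finally have "u_eq ?P ?T `` {(E, tw_comp E (at_level ?P) (transfer C' D E) (pull_mor E (proj D1) f))} =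
      u_eq ?P ?T `` {(E, transfer C D E)}"
    using comp transfer_class_eq[OF C(1) D(1) E(1) EC] by metis
  moreover have tg: "(E, transfer C D E) \<in> u_germs ?P ?T"
    using D E by (intro transfer_germ C D E) auto
  ultimately have "((E, tw_comp E (at_level ?P) (transfer C' D E) (pull_mor E (proj D1) f)), (E, transfer C D E)) \<in> u_eq ?P ?T"
    using equiv_class_self[OF u_eq_equiv[OF CH(1,3)] tg] by blast
  then obtain E' where E': "E' \<in> C_H" "E' \<subseteq> E"
    and eq: "pull_mor E' (proj E) (tw_comp E (at_level ?P) (transfer C' D E) (pull_mor E (proj D1) f)) =
      pull_mor E' (proj E) (transfer C D E)"
    unfolding u_eq_iff by blast
  define f' where "f' = pull_mor E' (proj D1) f"
  have sub: "E' \<subseteq> C" "E' \<subseteq> C'" "E' \<subseteq> D" "E \<subseteq> C' \<inter> D" "E \<subseteq> C \<inter> D" "E \<subseteq> C" using E' E D D1 by auto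
  have "pull_mor E' (proj E) (pull_mor E (proj D1) f) = f'"
    unfolding f'_def using E E' D1 by (intro pull_mor_pull_mor C_H_subgroup) auto
  then have eq': "tw_comp E' (at_level ?P) (transfer C' D E') f' = transfer C D E'"
    using eq pull_mor_tw_comp[OF CH(1) E(1) E'(1) _ E'(2), of "transfer C' D E" "pull_mor E (proj D1) f"] sub
      transfer_pull[OF C(2) D(1) E(1) sub(4) E'] transfer_pull[OF C(1) D(1) E(1) sub(5) E'] by simp
  have f'_hom: "f' \<in> tw_hom E' (at_level ?P) (at_level ?R)"
    unfolding f'_def using f E E' D1
    by (intro pull_mor_hom[OF CH(1,2) D1(1)]) (auto simp: u_germs_iff)
  have "f' = tw_comp E' (at_level ?P) (transfer C' C' E') f'"
    using tw_comp_id_left[OF f'_hom] transfer_id[OF C(2) E'(1) sub(2)] by simp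
  also have "\<dots> = tw_comp E' (at_level ?P) (tw_comp E' (at_level ?R) (transfer D C' E') (transfer C' D E')) f'"
    using transfer_comp[OF C(2) D(1) C(2) E'(1) sub(2,3,2)] by simp
  also have "\<dots> = tw_comp E' (at_level ?P) (transfer D C' E') (transfer C D E')"
    by (simp only: tw_comp_assoc[OF f'_hom, symmetric] eq')
  also have "\<dots> = transfer C C' E'"
    by (rule transfer_comp[OF C(1) D(1) C(2) E'(1) sub(1,3,2)])
  finally have "f' = transfer C C' E'" .
  then have "\<kappa> = u_eq ?P ?R `` {(E', transfer C C' E')}"
    unfolding \<kappa>eq f'_def using u_class_pull[OF CH(1,2) f E'(1)] E E' by auto
  then show ?thesis using transfer_class_eq[OF C E'(1)] sub by simp
qed

text \<open>
  The refinement \<open>D = C \<inter> C'\<close> alone already determines the isomorphism.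
\<close>

lemma canonical_iso_iff:
  assumes C: "C \<in> C_H0" "C' \<in> C_H0"
  shows "canonical_iso \<alpha> C C' \<kappa> \<longleftrightarrow> \<kappa> = transfer_class C C'"
proof
  assume can: "canonical_iso \<alpha> C C' \<kappa>"
  have CC: "C \<inter> C' \<in> C_H0" by (rule C_H0_Int[OF C])
  have hom: "\<kappa> \<in> u_hom (sph_obj \<alpha> C) (sph_obj \<alpha> C')"
    using can unfolding canonical_iso_def u_iso_def by blast
  have "u_comp (sph_obj \<alpha> C) (sph_obj \<alpha> (C \<inter> C')) (u_refine \<alpha> (C \<inter> C') C') \<kappa> = u_refine \<alpha> (C \<inter> C') C"
    using can CC unfolding canonical_iso_def by blast
  then have "u_comp (sph_obj \<alpha> C) (sph_obj \<alpha> (C \<inter> C')) (transfer_class C' (C \<inter> C')) \<kappa> = transfer_class C (C \<inter> C')"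
    using C CC by (simp add: u_refine_eq_transfer_class)
  then show "\<kappa> = transfer_class C C'" by (rule transfer_class_unique[OF C CC subset_refl hom])
next
  assume \<kappa>: "\<kappa> = transfer_class C C'"
  have "transfer_class C C' \<in> u_iso (sph_obj \<alpha> C) (sph_obj \<alpha> C')"
    unfolding u_iso_def
    using C by (auto simp: transfer_class_comp u_id_eq_transfer_class transfer_class_in_hom
        intro!: bexI[of _ "transfer_class C' C"])
  then show "canonical_iso \<alpha> C C' \<kappa>"
    using C by (simp add: canonical_iso_def \<kappa> u_refine_eq_transfer_class transfer_class_comp)
qed

lemma sph_refine_comp:
  assumes C: "C \<in> C_H0" "D \<in> C_H0" "E \<in> C_H0" and sub: "D \<subseteq> C" "E \<subseteq> D"
  shows "sph_refine \<alpha> E C = tw_comp E (pull_rep (proj C) (sph \<alpha> C)) (sph_refine \<alpha> E D) (pull_mor E (proj D) (sph_refine \<alpha> D C))"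
proof -
  have "pull_mor E (proj D) (transfer C D D) = transfer C D E"
    using C sub by (intro transfer_pull) (auto simp: C_H0_in_C_H)
  moreover have "tw_comp E (at_level (sph_obj \<alpha> C)) (transfer D E E) (transfer C D E) = transfer C E E"
    using C sub by (intro transfer_comp) (auto simp: C_H0_in_C_H)
  ultimately show ?thesis using C sub by (simp add: sph_refine_eq_transfer)
qed

end

theorem proposition5p8:
  fixes \<alpha> :: "'n::{finite,linorder} \<Rightarrow> complex fls"
  assumes "\<forall>r. \<alpha> r \<noteq> 0"
  shows
    "\<forall>C\<in>(C_H0 :: ('k::{field,finite}, 'n) dbl set set).
       sph_well_defined \<alpha> C \<and>
       (\<forall>s\<in>O_sp C. one_dimensional (fib (sph \<alpha> C) s)) \<and>
       (\<forall>s\<in>S_sp C - O_sp C. carrier (fib (sph \<alpha> C) s) = {\<zero>\<^bsub>fib (sph \<alpha> C) s\<^esub>}) \<and>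
       sph_equivariant \<alpha> C \<and>
       (\<forall>D\<in>C_H0. D \<subseteq> C \<longrightarrow> refinement_compatible \<alpha> D C) \<and>
       sph_refine \<alpha> C C = tw_id C (pull_rep (proj C) (sph \<alpha> C)) \<and>
       (\<forall>D\<in>C_H0. \<forall>E\<in>C_H0. D \<subseteq> C \<longrightarrow> E \<subseteq> D \<longrightarrow>
          sph_refine \<alpha> E C = tw_comp E (pull_rep (proj C) (sph \<alpha> C))
            (sph_refine \<alpha> E D) (pull_mor E (proj D) (sph_refine \<alpha> D C))) \<and>
       sph_obj \<alpha> C \<in> u_obj \<alpha> \<and>
       (\<forall>C'\<in>C_H0. \<exists>!\<kappa>. canonical_iso \<alpha> C C' \<kappa>) \<and>
       (\<forall>D\<in>C_H0. D \<subseteq> C \<longrightarrow> canonical_iso \<alpha> C D (u_refine \<alpha> D C)) \<and>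
       canonical_iso \<alpha> C C (u_id (sph_obj \<alpha> C)) \<and>
       (\<forall>C'\<in>C_H0. \<forall>C''\<in>C_H0. \<forall>\<kappa> \<kappa>'.
          canonical_iso \<alpha> C C' \<kappa> \<longrightarrow> canonical_iso \<alpha> C' C'' \<kappa>' \<longrightarrow>
          canonical_iso \<alpha> C C'' (u_comp (sph_obj \<alpha> C) (sph_obj \<alpha> C'') \<kappa>' \<kappa>))"
proof -
  interpret multiplier \<alpha> by unfold_locales (use assms in blast)
  show ?thesis
  proof (intro ballI conjI)
    fix C :: "('k, 'n) dbl set" assume C: "C \<in> C_H0"
    show "sph_well_defined \<alpha> C" by (rule sph_is_well_defined[OF C])
    show "one_dimensional (fib (sph \<alpha> C) s)" if s: "s \<in> O_sp C" for s
    proof -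
      obtain b k where b: "b \<in> B_H" "k \<in> H0" "s = (b \<otimes>\<^bsub>H_grp\<^esub> k) <#\<^bsub>H_grp\<^esub> C" using s by (rule O_sp_cases)
      show ?thesis unfolding b(3) by (rule line_iso_one_dimensional[OF sph_class_line[OF C b(1,2)]])
    qed
    show "carrier (fib (sph \<alpha> C) s) = {\<zero>\<^bsub>fib (sph \<alpha> C) s\<^esub>}" if "s \<in> S_sp C - O_sp C" for s
      using that by (simp add: sph_fib_off)
    show "sph_equivariant \<alpha> C"
      unfolding sph_equivariant_def
    proof (intro conjI ballI allI)
      show "right_equivariant C (sph \<alpha> C) (sph_equiv \<alpha> C)" by (rule sph_right_equivariant[OF C])
      show "sph_equiv \<alpha> C h (k <#\<^bsub>H_grp\<^esub> C) (sph_class \<alpha> C \<one>\<^bsub>H_grp\<^esub> (k \<otimes>\<^bsub>H_grp\<^esub> h) x) = sph_class \<alpha> C \<one>\<^bsub>H_grp\<^esub> k x"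
        if "h \<in> H0" "k \<in> H0" for h k x
        using sph_equiv_class[OF C that(1) B_H_closed(3) that(2), of x] that by simp
    qed
    show "D \<subseteq> C \<longrightarrow> refinement_compatible \<alpha> D C" if "D \<in> C_H0" for D
      using sph_refinement_compatible[OF C that] by blast
    show "sph_refine \<alpha> C C = tw_id C (pull_rep (proj C) (sph \<alpha> C))"
      using C by (simp add: sph_refine_eq_transfer transfer_id C_H0_in_C_H)
    show "D \<subseteq> C \<longrightarrow> E \<subseteq> D \<longrightarrow>
          sph_refine \<alpha> E C = tw_comp E (pull_rep (proj C) (sph \<alpha> C))
            (sph_refine \<alpha> E D) (pull_mor E (proj D) (sph_refine \<alpha> D C))"
      if "D \<in> C_H0" "E \<in> C_H0" for D E
      using sph_refine_comp[OF C that] by blast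
    show "sph_obj \<alpha> C \<in> u_obj \<alpha>" by (rule sph_obj_in_u_obj[OF C])
    show "\<exists>!\<kappa>. canonical_iso \<alpha> C C' \<kappa>" if "C' \<in> C_H0" for C'
      by (simp add: canonical_iso_iff[OF C that])
    show "D \<subseteq> C \<longrightarrow> canonical_iso \<alpha> C D (u_refine \<alpha> D C)" if "D \<in> C_H0" for D
      using C that by (simp add: canonical_iso_iff u_refine_eq_transfer_class)
    show "canonical_iso \<alpha> C C (u_id (sph_obj \<alpha> C))"
      using C by (simp add: canonical_iso_iff u_id_eq_transfer_class)
    show "\<forall>\<kappa> \<kappa>'. canonical_iso \<alpha> C C' \<kappa> \<longrightarrow> canonical_iso \<alpha> C' C'' \<kappa>' \<longrightarrow>
          canonical_iso \<alpha> C C'' (u_comp (sph_obj \<alpha> C) (sph_obj \<alpha> C'') \<kappa>' \<kappa>)"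
      if "C' \<in> C_H0" "C'' \<in> C_H0" for C' C''
      using C that by (simp add: canonical_iso_iff transfer_class_comp)
  qed
qed

end
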